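(* The forgetful 2-functor $U\colon \mathcal{H}yp_{\mathrm{OF}}\to\mathcal{H}yp$, from the 2-category of objectwise-free hypergraph categories to the 2-category of hypergraph categories, is a 2-equivalence. (In particular, every hypergraph category is equivalent, in the 2-category $\mathcal{H}yp$, to an objectwise-free hypergraph category.)
   Context: Composition is written in diagrammatic order $f;g$, and associators and unitors are suppressed in formulas. A Frobenius structure on an object $X$ of a symmetric monoidal category $(\mathcal C,\otimes,I)$ with braiding $\sigma$ is a tuple $(\mu,\eta,\delta,\epsilon)$, $\mu\colon X\otimes X\to X$, $\eta\colon I\to X$, $\delta\colon X\to X\otimes X$, $\epsilon\colon X\to I$, such that $(X,\mu,\eta)$ is a commutative monoid, $(X,\delta,\epsilon)$ is a cocommutative comonoid, $(\delta\otimes \mathrm{id});(\mathrm{id}\otimes\mu)=\mu;\delta=(\mathrm{id}\otimes\delta);(\mu\otimes\mathrm{id})$ (Frobenius law), and $\delta;\mu=\mathrm{id}_X$ (special law). A hypergraph category is a symmetric monoidal category in which each object $X$ is equipped with a Frobenius structure $(\mu_X,\eta_X,\delta_X,\epsilon_X)$ such that, for all $X,Y$: $\mu_{X\otimes Y}=(\mathrm{id}_X\otimes\sigma_{Y,X}\otimes\mathrm{id}_Y);(\mu_X\otimes\mu_Y)$, $\eta_{X\otimes Y}=\eta_X\otimes\eta_Y$, $\delta_{X\otimes Y}=(\delta_X\otimes\delta_Y);(\mathrm{id}_X\otimes\sigma_{X,Y}\otimes\mathrm{id}_Y)$, $\epsilon_{X\otimes Y}=\epsilon_X\otimes\epsilon_Y$,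 and moreover $\eta_I=\mathrm{id}_I=\epsilon_I$. A hypergraph functor is a strong symmetric monoidal functor $(F,\varphi)$ such that for each object $X$ the Frobenius structure on $FX$ is $(\varphi_{X,X};F\mu_X,\ \varphi_I;F\eta_X,\ F\delta_X;\varphi_{X,X}^{-1},\ F\epsilon_X;\varphi_I^{-1})$. $\mathcal{H}yp$ is the 2-category of hypergraph categories, hypergraph functors, and monoidal natural transformations. For a set $\Lambda$, $\mathrm{List}(\Lambda)$ is the free monoid of finite lists in $\Lambda$ under concatenation. An objectwise-free (OF) hypergraph category is a triple $(\mathcal H,\Lambda,i)$ where $\mathcal H$ is a hypergraph category whose underlying monoidal category is strict, $\Lambda$ is a set, and $i\colon\mathrm{List}(\Lambda)\to\mathrm{Ob}(\mathcal H)$ is an isomorphism of monoids. The 2-category $\mathcal{H}yp_{\mathrm{OF}}$ has these as objects, with hom-categories $\mathcal{H}yp_{\mathrm{OF}}((\mathcal H,\Lambda,i),(\mathcal H',\Lambda',i'))=\mathcal{H}yp(\mathcal H,\mathcal H')$; $U$ sends $(\mathcal H,\Lambda,i)$ to $\mathcal H$ and is the identity on hom-categories. A 2-equivalence is a 2-functor that is fully faithful on hom-categories and such that every object of the target is equivalent (in the target 2-category) to one in its image. *)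

theory Defs
  imports Main "HOL-Library.FuncSet"
begin

section \<open>Categories and functors\<close>

text \<open>
  All structure is given by total HOL functions on carrier sets; only the values on the carriers
  are constrained. Composition is diagrammatic.
\<close>

record ('o, 'a) category_data =
  Ob :: "'o set"
  Ar :: "'a set"
  dm :: "'a \<Rightarrow> 'o"
  cd :: "'a \<Rightarrow> 'o"
  idn :: "'o \<Rightarrow> 'a"
  cmp :: "'a \<Rightarrow> 'a \<Rightarrow> 'a" (infixl "\<Zsemi>\<index>" 60)

definition hom_set :: "('o, 'a, 'z) category_data_scheme \<Rightarrow> 'o \<Rightarrow> 'o \<Rightarrow> 'a set" where
  "hom_set C x y = {f \<in> Ar C. dm C f = x \<and> cd C f = y}"

locale category =
  fixes C :: "('o, 'a, 'z) category_data_scheme" (structure)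
  assumes dm_Ob: "f \<in> Ar C \<Longrightarrow> dm C f \<in> Ob C"
    and cd_Ob: "f \<in> Ar C \<Longrightarrow> cd C f \<in> Ob C"
    and idn_hom: "x \<in> Ob C \<Longrightarrow> idn C x \<in> hom_set C x x"
    and comp_hom: "\<lbrakk>f \<in> hom_set C x y; g \<in> hom_set C y z\<rbrakk> \<Longrightarrow> f \<Zsemi> g \<in> hom_set C x z"
    and idn_comp: "f \<in> hom_set C x y \<Longrightarrow> idn C x \<Zsemi> f = f"
    and comp_idn: "f \<in> hom_set C x y \<Longrightarrow> f \<Zsemi> idn C y = f"
    and comp_assoc: "\<lbrakk>f \<in> hom_set C w x; g \<in> hom_set C x y; h \<in> hom_set C y z\<rbrakk>
      \<Longrightarrow> (f \<Zsemi> g) \<Zsemi> h = f \<Zsemi> (g \<Zsemi> h)"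

definition inverse_arrows :: "('o, 'a, 'z) category_data_scheme \<Rightarrow> 'a \<Rightarrow> 'a \<Rightarrow> bool" where
  "inverse_arrows C f g \<longleftrightarrow> f \<in> Ar C \<and> g \<in> hom_set C (cd C f) (dm C f) \<and>
     f \<Zsemi>\<^bsub>C\<^esub> g = idn C (dm C f) \<and> g \<Zsemi>\<^bsub>C\<^esub> f = idn C (cd C f)"

definition is_iso :: "('o, 'a, 'z) category_data_scheme \<Rightarrow> 'a \<Rightarrow> bool" where
  "is_iso C f \<longleftrightarrow> (\<exists>g. inverse_arrows C f g)"

definition inverse_of :: "('o, 'a, 'z) category_data_scheme \<Rightarrow> 'a \<Rightarrow> 'a" where
  "inverse_of C f = (THE g. inverse_arrows C f g)"

definition isomorphic :: "('o, 'a, 'z) category_data_scheme \<Rightarrow> 'o \<Rightarrow> 'o \<Rightarrow> bool" where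
  "isomorphic C x y \<longleftrightarrow> (\<exists>f \<in> hom_set C x y. is_iso C f)"

definition prod_cat ::
  "('o, 'a, 'z) category_data_scheme \<Rightarrow> ('p, 'b, 'w) category_data_scheme
    \<Rightarrow> ('o \<times> 'p, 'a \<times> 'b) category_data" where
  "prod_cat C D =
    \<lparr> Ob = Ob C \<times> Ob D,
      Ar = Ar C \<times> Ar D,
      dm = (\<lambda>(f, g). (dm C f, dm D g)),
      cd = (\<lambda>(f, g). (cd C f, cd D g)),
      idn = (\<lambda>(x, y). (idn C x, idn D y)),
      cmp = (\<lambda>(f, g) (f', g'). (f \<Zsemi>\<^bsub>C\<^esub> f', g \<Zsemi>\<^bsub>D\<^esub> g')) \<rparr>"

locale cat_functor = dom: category C + cod: category D
  for C :: "('o, 'a, 'z) category_data_scheme" and D :: "('p, 'b, 'w) category_data_scheme" +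
  fixes FO :: "'o \<Rightarrow> 'p" and FA :: "'a \<Rightarrow> 'b"
  assumes FO_Ob: "x \<in> Ob C \<Longrightarrow> FO x \<in> Ob D"
    and FA_hom: "f \<in> hom_set C x y \<Longrightarrow> FA f \<in> hom_set D (FO x) (FO y)"
    and FA_idn: "x \<in> Ob C \<Longrightarrow> FA (idn C x) = idn D (FO x)"
    and FA_comp: "\<lbrakk>f \<in> hom_set C x y; g \<in> hom_set C y z\<rbrakk>
      \<Longrightarrow> FA (f \<Zsemi>\<^bsub>C\<^esub> g) = FA f \<Zsemi>\<^bsub>D\<^esub> FA g"

definition fully_faithful ::
  "('o, 'a, 'z) category_data_scheme \<Rightarrow> ('p, 'b, 'w) category_data_scheme
    \<Rightarrow> ('o \<Rightarrow> 'p) \<Rightarrow> ('a \<Rightarrow> 'b) \<Rightarrow> bool" where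
  "fully_faithful C D FO FA \<longleftrightarrow>
     (\<forall>x \<in> Ob C. \<forall>y \<in> Ob C. bij_betw FA (hom_set C x y) (hom_set D (FO x) (FO y)))"


section \<open>Symmetric monoidal categories\<close>

text \<open>
  Orientation of the structure maps: \<open>assr x y z : (x \<otimes> y) \<otimes> z \<rightarrow> x \<otimes> (y \<otimes> z)\<close>,
  \<open>lun x : \<one> \<otimes> x \<rightarrow> x\<close>, \<open>run x : x \<otimes> \<one> \<rightarrow> x\<close>, \<open>braid x y : x \<otimes> y \<rightarrow> y \<otimes> x\<close>.
\<close>

record ('o, 'a) symmetric_monoidal_data = "('o, 'a) category_data" +
  tens_ob :: "'o \<Rightarrow> 'o \<Rightarrow> 'o" (infixl "\<otimes>\<index>" 70)
  tens_ar :: "'a \<Rightarrow> 'a \<Rightarrow> 'a" (infixl "\<otimes>\<^sub>a\<index>" 70)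
  unit_ob :: "'o" ("\<one>\<index>")
  assr :: "'o \<Rightarrow> 'o \<Rightarrow> 'o \<Rightarrow> 'a"
  lun :: "'o \<Rightarrow> 'a"
  run :: "'o \<Rightarrow> 'a"
  braid :: "'o \<Rightarrow> 'o \<Rightarrow> 'a"

locale monoidal_category =
  category C +
  tensor: cat_functor "prod_cat C C" C "\<lambda>(x, y). x \<otimes>\<^bsub>C\<^esub> y" "\<lambda>(f, g). f \<otimes>\<^sub>a\<^bsub>C\<^esub> g"
  for C :: "('o, 'a, 'z) symmetric_monoidal_data_scheme" (structure) +
  assumes unit_Ob: "\<one> \<in> Ob C"
    and assr_hom: "\<lbrakk>x \<in> Ob C; y \<in> Ob C; z \<in> Ob C\<rbrakk>
      \<Longrightarrow> assr C x y z \<in> hom_set C ((x \<otimes> y) \<otimes> z) (x \<otimes> (y \<otimes> z))"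
    and assr_iso: "\<lbrakk>x \<in> Ob C; y \<in> Ob C; z \<in> Ob C\<rbrakk> \<Longrightarrow> is_iso C (assr C x y z)"
    and assr_natural:
      "\<lbrakk>f \<in> hom_set C x x'; g \<in> hom_set C y y'; h \<in> hom_set C z z'\<rbrakk>
      \<Longrightarrow> ((f \<otimes>\<^sub>a g) \<otimes>\<^sub>a h) \<Zsemi> assr C x' y' z' = assr C x y z \<Zsemi> (f \<otimes>\<^sub>a (g \<otimes>\<^sub>a h))"
    and lun_hom: "x \<in> Ob C \<Longrightarrow> lun C x \<in> hom_set C (\<one> \<otimes> x) x"
    and lun_iso: "x \<in> Ob C \<Longrightarrow> is_iso C (lun C x)"
    and lun_natural:
      "f \<in> hom_set C x y \<Longrightarrow> (idn C \<one> \<otimes>\<^sub>a f) \<Zsemi> lun C y = lun C x \<Zsemi> f"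
    and run_hom: "x \<in> Ob C \<Longrightarrow> run C x \<in> hom_set C (x \<otimes> \<one>) x"
    and run_iso: "x \<in> Ob C \<Longrightarrow> is_iso C (run C x)"
    and run_natural:
      "f \<in> hom_set C x y \<Longrightarrow> (f \<otimes>\<^sub>a idn C \<one>) \<Zsemi> run C y = run C x \<Zsemi> f"
    and pentagon: "\<lbrakk>w \<in> Ob C; x \<in> Ob C; y \<in> Ob C; z \<in> Ob C\<rbrakk>
      \<Longrightarrow> assr C (w \<otimes> x) y z \<Zsemi> assr C w x (y \<otimes> z)
        = (assr C w x y \<otimes>\<^sub>a idn C z) \<Zsemi> assr C w (x \<otimes> y) z \<Zsemi> (idn C w \<otimes>\<^sub>a assr C x y z)"
    and triangle: "\<lbrakk>x \<in> Ob C; y \<in> Ob C\<rbrakk>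
      \<Longrightarrow> assr C x \<one> y \<Zsemi> (idn C x \<otimes>\<^sub>a lun C y) = run C x \<otimes>\<^sub>a idn C y"

locale symmetric_monoidal_category = monoidal_category C
  for C :: "('o, 'a, 'z) symmetric_monoidal_data_scheme" (structure) +
  assumes braid_hom: "\<lbrakk>x \<in> Ob C; y \<in> Ob C\<rbrakk> \<Longrightarrow> braid C x y \<in> hom_set C (x \<otimes> y) (y \<otimes> x)"
    and braid_natural: "\<lbrakk>f \<in> hom_set C x x'; g \<in> hom_set C y y'\<rbrakk>
      \<Longrightarrow> (f \<otimes>\<^sub>a g) \<Zsemi> braid C x' y' = braid C x y \<Zsemi> (g \<otimes>\<^sub>a f)"
    and braid_braid: "\<lbrakk>x \<in> Ob C; y \<in> Ob C\<rbrakk> \<Longrightarrow> braid C x y \<Zsemi> braid C y x = idn C (x \<otimes> y)"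
    and hexagon: "\<lbrakk>x \<in> Ob C; y \<in> Ob C; z \<in> Ob C\<rbrakk>
      \<Longrightarrow> assr C x y z \<Zsemi> braid C x (y \<otimes> z) \<Zsemi> assr C y z x
        = (braid C x y \<otimes>\<^sub>a idn C z) \<Zsemi> assr C y x z \<Zsemi> (idn C y \<otimes>\<^sub>a braid C x z)"

definition strict_monoidal :: "('o, 'a, 'z) symmetric_monoidal_data_scheme \<Rightarrow> bool" where
  "strict_monoidal C \<longleftrightarrow>
     (\<forall>x \<in> Ob C. \<forall>y \<in> Ob C. \<forall>z \<in> Ob C.
        (x \<otimes>\<^bsub>C\<^esub> y) \<otimes>\<^bsub>C\<^esub> z = x \<otimes>\<^bsub>C\<^esub> (y \<otimes>\<^bsub>C\<^esub> z) \<and>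
        assr C x y z = idn C (x \<otimes>\<^bsub>C\<^esub> (y \<otimes>\<^bsub>C\<^esub> z))) \<and>
     (\<forall>x \<in> Ob C. \<one>\<^bsub>C\<^esub> \<otimes>\<^bsub>C\<^esub> x = x \<and> lun C x = idn C x \<and>
        x \<otimes>\<^bsub>C\<^esub> \<one>\<^bsub>C\<^esub> = x \<and> run C x = idn C x)"

text \<open>
  The map \<open>id \<otimes> \<sigma>\<^bsub>x,y\<^esub> \<otimes> id : (w \<otimes> x) \<otimes> (y \<otimes> z) \<rightarrow> (w \<otimes> y) \<otimes> (x \<otimes> z)\<close>, with its associators.
\<close>

definition mid_swap ::
  "('o, 'a, 'z) symmetric_monoidal_data_scheme \<Rightarrow> 'o \<Rightarrow> 'o \<Rightarrow> 'o \<Rightarrow> 'o \<Rightarrow> 'a" where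
  "mid_swap C w x y z =
     assr C w x (y \<otimes>\<^bsub>C\<^esub> z)
     \<Zsemi>\<^bsub>C\<^esub> (idn C w \<otimes>\<^sub>a\<^bsub>C\<^esub>
           (inverse_of C (assr C x y z) \<Zsemi>\<^bsub>C\<^esub> (braid C x y \<otimes>\<^sub>a\<^bsub>C\<^esub> idn C z) \<Zsemi>\<^bsub>C\<^esub> assr C y x z))
     \<Zsemi>\<^bsub>C\<^esub> inverse_of C (assr C w y (x \<otimes>\<^bsub>C\<^esub> z))"


section \<open>Frobenius structures and hypergraph categories\<close>

definition commutative_monoid ::
  "('o, 'a, 'z) symmetric_monoidal_data_scheme \<Rightarrow> 'o \<Rightarrow> 'a \<Rightarrow> 'a \<Rightarrow> bool" where
  "commutative_monoid C x m e \<longleftrightarrow>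
     m \<in> hom_set C (x \<otimes>\<^bsub>C\<^esub> x) x \<and> e \<in> hom_set C \<one>\<^bsub>C\<^esub> x \<and>
     (m \<otimes>\<^sub>a\<^bsub>C\<^esub> idn C x) \<Zsemi>\<^bsub>C\<^esub> m = assr C x x x \<Zsemi>\<^bsub>C\<^esub> (idn C x \<otimes>\<^sub>a\<^bsub>C\<^esub> m) \<Zsemi>\<^bsub>C\<^esub> m \<and>
     (e \<otimes>\<^sub>a\<^bsub>C\<^esub> idn C x) \<Zsemi>\<^bsub>C\<^esub> m = lun C x \<and>
     (idn C x \<otimes>\<^sub>a\<^bsub>C\<^esub> e) \<Zsemi>\<^bsub>C\<^esub> m = run C x \<and>
     braid C x x \<Zsemi>\<^bsub>C\<^esub> m = m"

definition cocommutative_comonoid ::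
  "('o, 'a, 'z) symmetric_monoidal_data_scheme \<Rightarrow> 'o \<Rightarrow> 'a \<Rightarrow> 'a \<Rightarrow> bool" where
  "cocommutative_comonoid C x d e \<longleftrightarrow>
     d \<in> hom_set C x (x \<otimes>\<^bsub>C\<^esub> x) \<and> e \<in> hom_set C x \<one>\<^bsub>C\<^esub> \<and>
     d \<Zsemi>\<^bsub>C\<^esub> (d \<otimes>\<^sub>a\<^bsub>C\<^esub> idn C x) \<Zsemi>\<^bsub>C\<^esub> assr C x x x = d \<Zsemi>\<^bsub>C\<^esub> (idn C x \<otimes>\<^sub>a\<^bsub>C\<^esub> d) \<and>
     d \<Zsemi>\<^bsub>C\<^esub> (e \<otimes>\<^sub>a\<^bsub>C\<^esub> idn C x) \<Zsemi>\<^bsub>C\<^esub> lun C x = idn C x \<and>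
     d \<Zsemi>\<^bsub>C\<^esub> (idn C x \<otimes>\<^sub>a\<^bsub>C\<^esub> e) \<Zsemi>\<^bsub>C\<^esub> run C x = idn C x \<and>
     d \<Zsemi>\<^bsub>C\<^esub> braid C x x = d"

definition frobenius_structure ::
  "('o, 'a, 'z) symmetric_monoidal_data_scheme \<Rightarrow> 'o \<Rightarrow> 'a \<Rightarrow> 'a \<Rightarrow> 'a \<Rightarrow> 'a \<Rightarrow> bool" where
  "frobenius_structure C x m n d e \<longleftrightarrow>
     commutative_monoid C x m n \<and>
     cocommutative_comonoid C x d e \<and>
     (d \<otimes>\<^sub>a\<^bsub>C\<^esub> idn C x) \<Zsemi>\<^bsub>C\<^esub> assr C x x x \<Zsemi>\<^bsub>C\<^esub> (idn C x \<otimes>\<^sub>a\<^bsub>C\<^esub> m) = m \<Zsemi>\<^bsub>C\<^esub> d \<and>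
     (idn C x \<otimes>\<^sub>a\<^bsub>C\<^esub> d) \<Zsemi>\<^bsub>C\<^esub> inverse_of C (assr C x x x) \<Zsemi>\<^bsub>C\<^esub> (m \<otimes>\<^sub>a\<^bsub>C\<^esub> idn C x) = m \<Zsemi>\<^bsub>C\<^esub> d \<and>
     d \<Zsemi>\<^bsub>C\<^esub> m = idn C x"

record ('o, 'a) hypergraph_data = "('o, 'a) symmetric_monoidal_data" +
  mu :: "'o \<Rightarrow> 'a"
  eta :: "'o \<Rightarrow> 'a"
  delta :: "'o \<Rightarrow> 'a"
  eps :: "'o \<Rightarrow> 'a"

locale hypergraph_category = symmetric_monoidal_category C
  for C :: "('o, 'a, 'z) hypergraph_data_scheme" (structure) +
  assumes frobenius: "x \<in> Ob C \<Longrightarrow> frobenius_structure C x (mu C x) (eta C x) (delta C x) (eps C x)"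
    and mu_tensor: "\<lbrakk>x \<in> Ob C; y \<in> Ob C\<rbrakk>
      \<Longrightarrow> mu C (x \<otimes> y) = mid_swap C x y x y \<Zsemi> (mu C x \<otimes>\<^sub>a mu C y)"
    and eta_tensor: "\<lbrakk>x \<in> Ob C; y \<in> Ob C\<rbrakk>
      \<Longrightarrow> eta C (x \<otimes> y) = inverse_of C (lun C \<one>) \<Zsemi> (eta C x \<otimes>\<^sub>a eta C y)"
    and delta_tensor: "\<lbrakk>x \<in> Ob C; y \<in> Ob C\<rbrakk>
      \<Longrightarrow> delta C (x \<otimes> y) = (delta C x \<otimes>\<^sub>a delta C y) \<Zsemi> mid_swap C x x y y"
    and eps_tensor: "\<lbrakk>x \<in> Ob C; y \<in> Ob C\<rbrakk>
      \<Longrightarrow> eps C (x \<otimes> y) = (eps C x \<otimes>\<^sub>a eps C y) \<Zsemi> lun C \<one>"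
    and eta_unit: "eta C \<one> = idn C \<one>"
    and eps_unit: "eps C \<one> = idn C \<one>"


section \<open>Hypergraph functors and monoidal natural transformations\<close>

record ('o, 'a, 'p, 'b) monoidal_functor_data =
  on_ob :: "'o \<Rightarrow> 'p"
  on_ar :: "'a \<Rightarrow> 'b"
  phi :: "'o \<Rightarrow> 'o \<Rightarrow> 'b"
  phi_unit :: "'b"

text \<open>
  The three \<open>ext\<close> assumptions fix the values of the underlying HOL functions outside the carriers,
  so that equality of records is equality of functors.
\<close>

locale strong_symmetric_monoidal_functor =
  A: symmetric_monoidal_category A + B: symmetric_monoidal_category B +
  cat_functor A B "on_ob F" "on_ar F"
  for A :: "('o, 'a, 'z) symmetric_monoidal_data_scheme"
    and B :: "('p, 'b, 'w) symmetric_monoidal_data_scheme"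
    and F :: "('o, 'a, 'p, 'b) monoidal_functor_data" +
  assumes on_ob_ext: "on_ob F \<in> extensional (Ob A)"
    and on_ar_ext: "on_ar F \<in> extensional (Ar A)"
    and phi_ext: "\<not> (x \<in> Ob A \<and> y \<in> Ob A) \<Longrightarrow> phi F x y = undefined"
    and phi_hom: "\<lbrakk>x \<in> Ob A; y \<in> Ob A\<rbrakk>
      \<Longrightarrow> phi F x y \<in> hom_set B (on_ob F x \<otimes>\<^bsub>B\<^esub> on_ob F y) (on_ob F (x \<otimes>\<^bsub>A\<^esub> y))"
    and phi_iso: "\<lbrakk>x \<in> Ob A; y \<in> Ob A\<rbrakk> \<Longrightarrow> is_iso B (phi F x y)"
    and phi_natural: "\<lbrakk>f \<in> hom_set A x x'; g \<in> hom_set A y y'\<rbrakk>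
      \<Longrightarrow> (on_ar F f \<otimes>\<^sub>a\<^bsub>B\<^esub> on_ar F g) \<Zsemi>\<^bsub>B\<^esub> phi F x' y' = phi F x y \<Zsemi>\<^bsub>B\<^esub> on_ar F (f \<otimes>\<^sub>a\<^bsub>A\<^esub> g)"
    and phi_unit_hom: "phi_unit F \<in> hom_set B \<one>\<^bsub>B\<^esub> (on_ob F \<one>\<^bsub>A\<^esub>)"
    and phi_unit_iso: "is_iso B (phi_unit F)"
    and phi_assr: "\<lbrakk>x \<in> Ob A; y \<in> Ob A; z \<in> Ob A\<rbrakk>
      \<Longrightarrow> (phi F x y \<otimes>\<^sub>a\<^bsub>B\<^esub> idn B (on_ob F z)) \<Zsemi>\<^bsub>B\<^esub> phi F (x \<otimes>\<^bsub>A\<^esub> y) z \<Zsemi>\<^bsub>B\<^esub> on_ar F (assr A x y z)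
        = assr B (on_ob F x) (on_ob F y) (on_ob F z)
          \<Zsemi>\<^bsub>B\<^esub> (idn B (on_ob F x) \<otimes>\<^sub>a\<^bsub>B\<^esub> phi F y z) \<Zsemi>\<^bsub>B\<^esub> phi F x (y \<otimes>\<^bsub>A\<^esub> z)"
    and phi_lun: "x \<in> Ob A
      \<Longrightarrow> (phi_unit F \<otimes>\<^sub>a\<^bsub>B\<^esub> idn B (on_ob F x)) \<Zsemi>\<^bsub>B\<^esub> phi F \<one>\<^bsub>A\<^esub> x \<Zsemi>\<^bsub>B\<^esub> on_ar F (lun A x)
        = lun B (on_ob F x)"
    and phi_run: "x \<in> Ob A
      \<Longrightarrow> (idn B (on_ob F x) \<otimes>\<^sub>a\<^bsub>B\<^esub> phi_unit F) \<Zsemi>\<^bsub>B\<^esub> phi F x \<one>\<^bsub>A\<^esub> \<Zsemi>\<^bsub>B\<^esub> on_ar F (run A x)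
        = run B (on_ob F x)"
    and phi_braid: "\<lbrakk>x \<in> Ob A; y \<in> Ob A\<rbrakk>
      \<Longrightarrow> phi F x y \<Zsemi>\<^bsub>B\<^esub> on_ar F (braid A x y) = braid B (on_ob F x) (on_ob F y) \<Zsemi>\<^bsub>B\<^esub> phi F y x"

locale hypergraph_functor =
  A: hypergraph_category A + B: hypergraph_category B + strong_symmetric_monoidal_functor A B F
  for A :: "('o, 'a, 'z) hypergraph_data_scheme"
    and B :: "('p, 'b, 'w) hypergraph_data_scheme"
    and F :: "('o, 'a, 'p, 'b) monoidal_functor_data" +
  assumes mu_functor: "x \<in> Ob A \<Longrightarrow> mu B (on_ob F x) = phi F x x \<Zsemi>\<^bsub>B\<^esub> on_ar F (mu A x)"
    and eta_functor: "x \<in> Ob A \<Longrightarrow> eta B (on_ob F x) = phi_unit F \<Zsemi>\<^bsub>B\<^esub> on_ar F (eta A x)"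
    and delta_functor: "x \<in> Ob A
      \<Longrightarrow> delta B (on_ob F x) = on_ar F (delta A x) \<Zsemi>\<^bsub>B\<^esub> inverse_of B (phi F x x)"
    and eps_functor: "x \<in> Ob A
      \<Longrightarrow> eps B (on_ob F x) = on_ar F (eps A x) \<Zsemi>\<^bsub>B\<^esub> inverse_of B (phi_unit F)"

record ('o, 'a, 'p, 'b) transformation_data =
  src :: "('o, 'a, 'p, 'b) monoidal_functor_data"
  tgt :: "('o, 'a, 'p, 'b) monoidal_functor_data"
  component :: "'o \<Rightarrow> 'b"

locale monoidal_transformation =
  src: strong_symmetric_monoidal_functor A B "src t" +
  tgt: strong_symmetric_monoidal_functor A B "tgt t"
  for A :: "('o, 'a, 'z) symmetric_monoidal_data_scheme"
    and B :: "('p, 'b, 'w) symmetric_monoidal_data_scheme"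
    and t :: "('o, 'a, 'p, 'b) transformation_data" +
  assumes component_ext: "component t \<in> extensional (Ob A)"
    and component_hom: "x \<in> Ob A
      \<Longrightarrow> component t x \<in> hom_set B (on_ob (src t) x) (on_ob (tgt t) x)"
    and natural: "f \<in> hom_set A x y
      \<Longrightarrow> on_ar (src t) f \<Zsemi>\<^bsub>B\<^esub> component t y = component t x \<Zsemi>\<^bsub>B\<^esub> on_ar (tgt t) f"
    and monoidal_tensor: "\<lbrakk>x \<in> Ob A; y \<in> Ob A\<rbrakk>
      \<Longrightarrow> phi (src t) x y \<Zsemi>\<^bsub>B\<^esub> component t (x \<otimes>\<^bsub>A\<^esub> y)
        = (component t x \<otimes>\<^sub>a\<^bsub>B\<^esub> component t y) \<Zsemi>\<^bsub>B\<^esub> phi (tgt t) x y"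
    and monoidal_unit: "phi_unit (src t) \<Zsemi>\<^bsub>B\<^esub> component t \<one>\<^bsub>A\<^esub> = phi_unit (tgt t)"


section \<open>2-categories and 2-equivalences\<close>

text \<open>
  Strict 2-categories, presented by their hom-categories. The arrows of \<open>Hom T X Y\<close> are the
  2-cells; its composition is vertical composition, while \<open>comp1\<close> and \<open>comp2\<close> are the actions of
  the horizontal composition functor on 1-cells and 2-cells, in diagrammatic order.
\<close>

record ('x, 'f, 't) two_category_data =
  Obj :: "'x set"
  Hom :: "'x \<Rightarrow> 'x \<Rightarrow> ('f, 't) category_data"
  id1 :: "'x \<Rightarrow> 'f"
  comp1 :: "'x \<Rightarrow> 'x \<Rightarrow> 'x \<Rightarrow> 'f \<Rightarrow> 'f \<Rightarrow> 'f"
  comp2 :: "'x \<Rightarrow> 'x \<Rightarrow> 'x \<Rightarrow> 't \<Rightarrow> 't \<Rightarrow> 't"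

locale two_category =
  fixes T :: "('x, 'f, 't) two_category_data"
  assumes hom_category: "\<lbrakk>X \<in> Obj T; Y \<in> Obj T\<rbrakk> \<Longrightarrow> category (Hom T X Y)"
    and id1_Ob: "X \<in> Obj T \<Longrightarrow> id1 T X \<in> Ob (Hom T X X)"
    and comp_functor: "\<lbrakk>X \<in> Obj T; Y \<in> Obj T; Z \<in> Obj T\<rbrakk>
      \<Longrightarrow> cat_functor (prod_cat (Hom T X Y) (Hom T Y Z)) (Hom T X Z)
            (\<lambda>(f, g). comp1 T X Y Z f g) (\<lambda>(s, t). comp2 T X Y Z s t)"
    and comp1_assoc: "\<lbrakk>W \<in> Obj T; X \<in> Obj T; Y \<in> Obj T; Z \<in> Obj T;
        f \<in> Ob (Hom T W X); g \<in> Ob (Hom T X Y); h \<in> Ob (Hom T Y Z)\<rbrakk>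
      \<Longrightarrow> comp1 T W Y Z (comp1 T W X Y f g) h = comp1 T W X Z f (comp1 T X Y Z g h)"
    and comp2_assoc: "\<lbrakk>W \<in> Obj T; X \<in> Obj T; Y \<in> Obj T; Z \<in> Obj T;
        s \<in> Ar (Hom T W X); t \<in> Ar (Hom T X Y); u \<in> Ar (Hom T Y Z)\<rbrakk>
      \<Longrightarrow> comp2 T W Y Z (comp2 T W X Y s t) u = comp2 T W X Z s (comp2 T X Y Z t u)"
    and id1_comp1: "\<lbrakk>X \<in> Obj T; Y \<in> Obj T; f \<in> Ob (Hom T X Y)\<rbrakk>
      \<Longrightarrow> comp1 T X X Y (id1 T X) f = f"
    and comp1_id1: "\<lbrakk>X \<in> Obj T; Y \<in> Obj T; f \<in> Ob (Hom T X Y)\<rbrakk>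
      \<Longrightarrow> comp1 T X Y Y f (id1 T Y) = f"
    and id1_comp2: "\<lbrakk>X \<in> Obj T; Y \<in> Obj T; s \<in> Ar (Hom T X Y)\<rbrakk>
      \<Longrightarrow> comp2 T X X Y (idn (Hom T X X) (id1 T X)) s = s"
    and comp2_id1: "\<lbrakk>X \<in> Obj T; Y \<in> Obj T; s \<in> Ar (Hom T X Y)\<rbrakk>
      \<Longrightarrow> comp2 T X Y Y s (idn (Hom T Y Y) (id1 T Y)) = s"

definition equivalent_in :: "('x, 'f, 't) two_category_data \<Rightarrow> 'x \<Rightarrow> 'x \<Rightarrow> bool" where
  "equivalent_in T X Y \<longleftrightarrow>
     (\<exists>f \<in> Ob (Hom T X Y). \<exists>g \<in> Ob (Hom T Y X).
        isomorphic (Hom T X X) (id1 T X) (comp1 T X Y X f g) \<and>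
        isomorphic (Hom T Y Y) (comp1 T Y X Y g f) (id1 T Y))"

record ('x, 'f, 't, 'y, 'g, 's) two_functor_data =
  cell0 :: "'x \<Rightarrow> 'y"
  cell1 :: "'x \<Rightarrow> 'x \<Rightarrow> 'f \<Rightarrow> 'g"
  cell2 :: "'x \<Rightarrow> 'x \<Rightarrow> 't \<Rightarrow> 's"

locale two_functor = S: two_category S + T: two_category T
  for S :: "('x, 'f, 't) two_category_data"
    and T :: "('y, 'g, 's) two_category_data"
    and U :: "('x, 'f, 't, 'y, 'g, 's) two_functor_data" +
  assumes cell0_Obj: "X \<in> Obj S \<Longrightarrow> cell0 U X \<in> Obj T"
    and hom_functor: "\<lbrakk>X \<in> Obj S; Y \<in> Obj S\<rbrakk>
      \<Longrightarrow> cat_functor (Hom S X Y) (Hom T (cell0 U X) (cell0 U Y)) (cell1 U X Y) (cell2 U X Y)"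
    and cell1_id1: "X \<in> Obj S \<Longrightarrow> cell1 U X X (id1 S X) = id1 T (cell0 U X)"
    and cell1_comp1: "\<lbrakk>X \<in> Obj S; Y \<in> Obj S; Z \<in> Obj S;
        f \<in> Ob (Hom S X Y); g \<in> Ob (Hom S Y Z)\<rbrakk>
      \<Longrightarrow> cell1 U X Z (comp1 S X Y Z f g)
        = comp1 T (cell0 U X) (cell0 U Y) (cell0 U Z) (cell1 U X Y f) (cell1 U Y Z g)"
    and cell2_comp2: "\<lbrakk>X \<in> Obj S; Y \<in> Obj S; Z \<in> Obj S;
        s \<in> Ar (Hom S X Y); t \<in> Ar (Hom S Y Z)\<rbrakk>
      \<Longrightarrow> cell2 U X Z (comp2 S X Y Z s t)
        = comp2 T (cell0 U X) (cell0 U Y) (cell0 U Z) (cell2 U X Y s) (cell2 U Y Z t)"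

locale two_equivalence = two_functor S T U
  for S :: "('x, 'f, 't) two_category_data"
    and T :: "('y, 'g, 's) two_category_data"
    and U :: "('x, 'f, 't, 'y, 'g, 's) two_functor_data" +
  assumes hom_fully_faithful: "\<lbrakk>X \<in> Obj S; Y \<in> Obj S\<rbrakk>
      \<Longrightarrow> fully_faithful (Hom S X Y) (Hom T (cell0 U X) (cell0 U Y)) (cell1 U X Y) (cell2 U X Y)"
    and essentially_surjective: "Z \<in> Obj T \<Longrightarrow> \<exists>X \<in> Obj S. equivalent_in T Z (cell0 U X)"


section \<open>The 2-category of hypergraph categories\<close>

definition id_functor ::
  "('o, 'a, 'z) hypergraph_data_scheme \<Rightarrow> ('o, 'a, 'o, 'a) monoidal_functor_data" where
  "id_functor A =
    \<lparr> on_ob = restrict (\<lambda>x. x) (Ob A),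
      on_ar = restrict (\<lambda>f. f) (Ar A),
      phi = (\<lambda>x y. if x \<in> Ob A \<and> y \<in> Ob A then idn A (x \<otimes>\<^bsub>A\<^esub> y) else undefined),
      phi_unit = idn A \<one>\<^bsub>A\<^esub> \<rparr>"

definition comp_functors ::
  "('o, 'a, 'z) hypergraph_data_scheme \<Rightarrow> ('q, 'c, 'v) hypergraph_data_scheme
    \<Rightarrow> ('o, 'a, 'p, 'b) monoidal_functor_data \<Rightarrow> ('p, 'b, 'q, 'c) monoidal_functor_data
    \<Rightarrow> ('o, 'a, 'q, 'c) monoidal_functor_data" where
  "comp_functors A C F G =
    \<lparr> on_ob = restrict (\<lambda>x. on_ob G (on_ob F x)) (Ob A),
      on_ar = restrict (\<lambda>f. on_ar G (on_ar F f)) (Ar A),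
      phi = (\<lambda>x y. if x \<in> Ob A \<and> y \<in> Ob A
               then phi G (on_ob F x) (on_ob F y) \<Zsemi>\<^bsub>C\<^esub> on_ar G (phi F x y) else undefined),
      phi_unit = phi_unit G \<Zsemi>\<^bsub>C\<^esub> on_ar G (phi_unit F) \<rparr>"

definition Hyp_hom ::
  "('o, 'a) hypergraph_data \<Rightarrow> ('p, 'b) hypergraph_data
    \<Rightarrow> (('o, 'a, 'p, 'b) monoidal_functor_data, ('o, 'a, 'p, 'b) transformation_data) category_data"
where
  "Hyp_hom A B =
    \<lparr> Ob = {F. hypergraph_functor A B F},
      Ar = {t. hypergraph_functor A B (src t) \<and> hypergraph_functor A B (tgt t) \<and>
               monoidal_transformation A B t},
      dm = src,
      cd = tgt,
      idn = (\<lambda>F. \<lparr> src = F, tgt = F, component = restrict (\<lambda>x. idn B (on_ob F x)) (Ob A) \<rparr>),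
      cmp = (\<lambda>s t. \<lparr> src = src s, tgt = tgt t,
                component = restrict (\<lambda>x. component s x \<Zsemi>\<^bsub>B\<^esub> component t x) (Ob A) \<rparr>) \<rparr>"

definition horizontal_comp ::
  "('o, 'a, 'z) hypergraph_data_scheme \<Rightarrow> ('q, 'c, 'v) hypergraph_data_scheme
    \<Rightarrow> ('o, 'a, 'p, 'b) transformation_data \<Rightarrow> ('p, 'b, 'q, 'c) transformation_data
    \<Rightarrow> ('o, 'a, 'q, 'c) transformation_data" where
  "horizontal_comp A C s t =
    \<lparr> src = comp_functors A C (src s) (src t),
      tgt = comp_functors A C (tgt s) (tgt t),
      component = restrict
        (\<lambda>x. on_ar (src t) (component s x) \<Zsemi>\<^bsub>C\<^esub> component t (on_ob (tgt s) x)) (Ob A) \<rparr>"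

type_synonym ('o, 'a) hyp_1cell = "('o, 'a, 'o, 'a) monoidal_functor_data"
type_synonym ('o, 'a) hyp_2cell = "('o, 'a, 'o, 'a) transformation_data"

text \<open>
  The types \<open>'o\<close> and \<open>'a\<close> play the role of the universe: the objects of \<open>Hyp\<close> are the hypergraph
  categories whose objects and arrows form subsets of \<open>'o\<close> and \<open>'a\<close>.
\<close>

definition Hyp ::
  "(('o, 'a) hypergraph_data, ('o, 'a) hyp_1cell, ('o, 'a) hyp_2cell) two_category_data" where
  "Hyp =
    \<lparr> Obj = {A. hypergraph_category A},
      Hom = Hyp_hom,
      id1 = id_functor,
      comp1 = (\<lambda>A B C. comp_functors A C),
      comp2 = (\<lambda>A B C. horizontal_comp A C) \<rparr>"


section \<open>Objectwise-free hypergraph categories\<close>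

record ('o, 'a) of_hypergraph_data =
  of_cat :: "('o, 'a) hypergraph_data"
  of_gen :: "'o set"
  of_iso :: "'o list \<Rightarrow> 'o"

locale of_hypergraph_category =
  fixes X :: "('o, 'a) of_hypergraph_data"
  assumes hypergraph: "hypergraph_category (of_cat X)"
    and strict: "strict_monoidal (of_cat X)"
    and of_iso_bij: "bij_betw (of_iso X) (lists (of_gen X)) (Ob (of_cat X))"
    and of_iso_Nil: "of_iso X [] = \<one>\<^bsub>of_cat X\<^esub>"
    and of_iso_append: "\<lbrakk>us \<in> lists (of_gen X); vs \<in> lists (of_gen X)\<rbrakk>
      \<Longrightarrow> of_iso X (us @ vs) = of_iso X us \<otimes>\<^bsub>of_cat X\<^esub> of_iso X vs"

definition Hyp_OF ::
  "(('o, 'a) of_hypergraph_data, ('o, 'a) hyp_1cell, ('o, 'a) hyp_2cell) two_category_data" where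
  "Hyp_OF =
    \<lparr> Obj = {X. of_hypergraph_category X},
      Hom = (\<lambda>X Y. Hom Hyp (of_cat X) (of_cat Y)),
      id1 = (\<lambda>X. id1 Hyp (of_cat X)),
      comp1 = (\<lambda>X Y Z. comp1 Hyp (of_cat X) (of_cat Y) (of_cat Z)),
      comp2 = (\<lambda>X Y Z. comp2 Hyp (of_cat X) (of_cat Y) (of_cat Z)) \<rparr>"

definition forget_OF ::
  "(('o, 'a) of_hypergraph_data, ('o, 'a) hyp_1cell, ('o, 'a) hyp_2cell,
    ('o, 'a) hypergraph_data, ('o, 'a) hyp_1cell, ('o, 'a) hyp_2cell) two_functor_data" where
  "forget_OF = \<lparr> cell0 = of_cat, cell1 = (\<lambda>X Y F. F), cell2 = (\<lambda>X Y t. t) \<rparr>"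

end

theory Submission
  imports Defs
begin

text \<open>
  The forgetful 2-functor is the identity on hom-categories. Once \<open>Hyp\<close> is known to be a
  2-category, what remains is to find, for every hypergraph category \<open>H\<close>, an equivalent
  objectwise-free one.

  The candidate \<open>S\<close> has words in the objects of \<open>H\<close> as objects. An arrow from \<open>xs\<close> to \<open>ys\<close> is an
  arrow of \<open>H\<close> between the right-bracketed tensor products of \<open>xs\<close> and of \<open>ys\<close>. The tensor product
  of objects is concatenation, and \<open>H\<close> enters it through coherence isomorphisms \<open>join\<close> from
  \<open>(\<Otimes>xs) \<otimes> (\<Otimes>ys)\<close> to \<open>\<Otimes>(xs @ ys)\<close>. These are associative and unital (\<open>join_assoc\<close>, \<open>join_Nil\<close>), which
  is exactly what allows the associators and unitors of \<open>S\<close> to be identities.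

  All axioms are transferred along the fully faithful functor \<open>S \<rightarrow> H\<close> by one device. A frame of an
  object \<open>X\<close> of \<open>H\<close> at \<open>s\<close> is an isomorphism from \<open>X\<close> to the image of \<open>s\<close>, and an arrow \<open>a\<close> of \<open>S\<close> lies
  over an arrow \<open>g\<close> of \<open>H\<close> if the square formed by \<open>g\<close>, the image of \<open>a\<close> and two frames commutes. For
  given frames exactly one arrow lies over \<open>g\<close>. Lying over is preserved by composition and by tensor
  products, and every structure map of \<open>S\<close> lies over the corresponding one of \<open>H\<close>. So an equation
  between formal composites holds in \<open>S\<close> as soon as it holds in \<open>H\<close>. This yields the symmetric
  monoidal axioms of \<open>S\<close> (\<open>symmetric_monoidal\<close>), its Frobenius axioms (\<open>frobenius_reflect\<close>), the
  pseudo-inverse \<open>H \<rightarrow> S\<close> as a hypergraph functor (\<open>hypergraph_functor_up\<close>), and the monoidality of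
  unit and counit (\<open>unit_isomorphic\<close>, \<open>counit_isomorphic\<close>).

  The Frobenius structure of a word is defined by recursion from those of its letters, by the tensor
  formula itself. That it lies over the structure of the tensor product in \<open>H\<close> is an induction on the
  word (\<open>frobenius_over_word\<close>). That the formula then holds for an arbitrary concatenation is a second
  induction, inside \<open>S\<close>, where strictness reduces it to the associativity of the middle swap
  \<open>id \<otimes> \<sigma> \<otimes> id\<close> (\<open>mid_swap_assoc\<close>).

  Finally \<open>S\<close> has to fit into the types of \<open>H\<close>. Words over an infinite type can be encoded in that
  type. An arrow of \<open>S\<close> carries two words of objects, which might not fit into the type of arrows; but
  identities embed the objects of \<open>H\<close> into its arrows (\<open>free_strictification_exists\<close>).
\<close>

section \<open>Derived rules for categories and monoidal categories\<close>

text \<open>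
  Typing conditions are expressed by equations on \<open>dm\<close> and \<open>cd\<close> instead of membership in a hom-set:
  the hom-set form of the axioms has objects in its premises that do not occur in its conclusion, so
  that it cannot be used for rewriting. Composites are normalised to the right.
\<close>

lemma hom_setI: "\<lbrakk>f \<in> Ar C; dm C f = x; cd C f = y\<rbrakk> \<Longrightarrow> f \<in> hom_set C x y"
  by (simp add: hom_set_def)

lemma hom_setD:
  assumes "f \<in> hom_set C x y"
  shows "f \<in> Ar C" "dm C f = x" "cd C f = y"
  using assms by (simp_all add: hom_set_def)

lemma hom_set_self: "f \<in> Ar C \<Longrightarrow> f \<in> hom_set C (dm C f) (cd C f)"
  by (simp add: hom_set_def)

context category
begin

lemma hom_Ob: "f \<in> hom_set C x y \<Longrightarrow> x \<in> Ob C" "f \<in> hom_set C x y \<Longrightarrow> y \<in> Ob C"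
  using dm_Ob cd_Ob by (auto simp: hom_set_def)

lemma idn_Ar [simp]:
  assumes "x \<in> Ob C"
  shows "idn C x \<in> Ar C" "dm C (idn C x) = x" "cd C (idn C x) = x"
  using hom_setD[OF idn_hom[OF assms]] by auto

lemma comp_Ar [simp]:
  assumes "f \<in> Ar C" "g \<in> Ar C" "cd C f = dm C g"
  shows "f \<Zsemi> g \<in> Ar C" "dm C (f \<Zsemi> g) = dm C f" "cd C (f \<Zsemi> g) = cd C g"
  using hom_setD[OF comp_hom[of f "dm C f" "cd C f" g "cd C g"]] assms
  by (auto simp: hom_set_def)

lemma assoc [simp]:
  "\<lbrakk>f \<in> Ar C; g \<in> Ar C; h \<in> Ar C; cd C f = dm C g; cd C g = dm C h\<rbrakk>
    \<Longrightarrow> f \<Zsemi> g \<Zsemi> h = f \<Zsemi> (g \<Zsemi> h)"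
  using comp_assoc[of f "dm C f" "cd C f" g "cd C g" h "cd C h"] by (simp add: hom_set_def)

lemma idn_left [simp]: "\<lbrakk>f \<in> Ar C; dm C f = x\<rbrakk> \<Longrightarrow> idn C x \<Zsemi> f = f"
  using idn_comp[of f x "cd C f"] by (simp add: hom_set_def)

lemma idn_right [simp]: "\<lbrakk>f \<in> Ar C; cd C f = x\<rbrakk> \<Longrightarrow> f \<Zsemi> idn C x = f"
  using comp_idn[of f "dm C f" x] by (simp add: hom_set_def)

lemma dm_cd_Ob [simp]: "f \<in> Ar C \<Longrightarrow> dm C f \<in> Ob C" "f \<in> Ar C \<Longrightarrow> cd C f \<in> Ob C"
  using dm_Ob cd_Ob by auto

text \<open>Equations between composites are used inside longer, right-bracketed composites.\<close>

lemma comp_eq_extend: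
  assumes "f \<Zsemi> g = h" "f \<in> Ar C" "g \<in> Ar C" "cd C f = dm C g" "k \<in> Ar C" "cd C g = dm C k"
  shows "f \<Zsemi> (g \<Zsemi> k) = h \<Zsemi> k"
  using assoc[of f g k] assms by simp

lemma inverse_arrows_unique:
  assumes "inverse_arrows C f g" "inverse_arrows C f h"
  shows "g = h"
proof -
  have g: "g \<in> Ar C" "dm C g = cd C f" "cd C g = dm C f"
    and h: "h \<in> Ar C" "dm C h = cd C f" "cd C h = dm C f" and f: "f \<in> Ar C"
    using assms by (auto simp: inverse_arrows_def hom_set_def)
  have "g = g \<Zsemi> (f \<Zsemi> h)" using assms g h f by (simp add: inverse_arrows_def)
  also have "\<dots> = (g \<Zsemi> f) \<Zsemi> h" using g h f by simp
  also have "\<dots> = h" using assms g h f by (simp only: inverse_arrows_def) (simp)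
  finally show ?thesis .
qed

lemma inverse_of_eq: "inverse_arrows C f g \<Longrightarrow> inverse_of C f = g"
  unfolding inverse_of_def by (blast intro: the_equality inverse_arrows_unique)

lemma inverse_arrows_inverse_of: "is_iso C f \<Longrightarrow> inverse_arrows C f (inverse_of C f)"
  unfolding is_iso_def using inverse_of_eq by blast

lemma inverse_arrows_sym: "inverse_arrows C f g \<Longrightarrow> inverse_arrows C g f"
  by (auto simp: inverse_arrows_def hom_set_def)

lemma iso_Ar [simp]: "is_iso C f \<Longrightarrow> f \<in> Ar C"
  by (auto simp: is_iso_def inverse_arrows_def)

lemma inverse_of_Ar [simp]:
  assumes "is_iso C f"
  shows "inverse_of C f \<in> Ar C" "dm C (inverse_of C f) = cd C f" "cd C (inverse_of C f) = dm C f"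
    "f \<Zsemi> inverse_of C f = idn C (dm C f)" "inverse_of C f \<Zsemi> f = idn C (cd C f)"
  using inverse_arrows_inverse_of[OF assms] by (auto simp: inverse_arrows_def hom_set_def)

lemma inverse_of_cancel [simp]:
  assumes "is_iso C f"
  shows "\<lbrakk>h \<in> Ar C; dm C h = dm C f\<rbrakk> \<Longrightarrow> f \<Zsemi> (inverse_of C f \<Zsemi> h) = h"
    "\<lbrakk>h \<in> Ar C; dm C h = cd C f\<rbrakk> \<Longrightarrow> inverse_of C f \<Zsemi> (f \<Zsemi> h) = h"
  using assoc[of f "inverse_of C f" h] assoc[of "inverse_of C f" f h] assms by auto

lemma is_iso_inverse_of [simp]: "is_iso C f \<Longrightarrow> is_iso C (inverse_of C f)"
  using inverse_arrows_inverse_of inverse_arrows_sym unfolding is_iso_def by blast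

lemma inverse_of_inverse_of [simp]: "is_iso C f \<Longrightarrow> inverse_of C (inverse_of C f) = f"
  using inverse_of_eq[OF inverse_arrows_sym[OF inverse_arrows_inverse_of]] .

lemma inverse_arrows_comp:
  assumes "is_iso C f" "is_iso C g" "cd C f = dm C g"
  shows "inverse_arrows C (f \<Zsemi> g) (inverse_of C g \<Zsemi> inverse_of C f)"
  using assms by (simp add: inverse_arrows_def hom_set_def)

lemma iso_comp [simp]:
  assumes "is_iso C f" "is_iso C g" "cd C f = dm C g"
  shows "is_iso C (f \<Zsemi> g)" "inverse_of C (f \<Zsemi> g) = inverse_of C g \<Zsemi> inverse_of C f"
  using inverse_arrows_comp[OF assms] inverse_of_eq unfolding is_iso_def by blast+

lemma iso_idn [simp]:
  assumes "x \<in> Ob C"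
  shows "is_iso C (idn C x)" "inverse_of C (idn C x) = idn C x"
proof -
  have "inverse_arrows C (idn C x) (idn C x)"
    using assms by (simp add: inverse_arrows_def hom_set_def)
  then show "is_iso C (idn C x)" "inverse_of C (idn C x) = idn C x"
    using inverse_of_eq unfolding is_iso_def by blast+
qed

lemma iso_cancel_left:
  assumes "f \<Zsemi> g = f \<Zsemi> h" "is_iso C f" "g \<in> Ar C" "h \<in> Ar C" "dm C g = cd C f" "dm C h = cd C f"
  shows "g = h"
proof -
  have "inverse_of C f \<Zsemi> (f \<Zsemi> g) = inverse_of C f \<Zsemi> (f \<Zsemi> h)" using assms(1) by simp
  then show ?thesis using assms(2-) by simp
qed

lemma iso_cancel_right:
  assumes "g \<Zsemi> f = h \<Zsemi> f" "is_iso C f" "g \<in> Ar C" "h \<in> Ar C" "cd C g = dm C f" "cd C h = dm C f"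
  shows "g = h"
proof -
  have "g \<Zsemi> f \<Zsemi> inverse_of C f = h \<Zsemi> f \<Zsemi> inverse_of C f" using assms(1) by simp
  then show ?thesis using assms(2-) by simp
qed

lemma inverse_square:
  assumes "f \<Zsemi> h = k \<Zsemi> g" "is_iso C f" "is_iso C g" "h \<in> Ar C" "k \<in> Ar C"
    "cd C f = dm C h" "cd C k = dm C g" "dm C f = dm C k" "cd C h = cd C g"
  shows "h \<Zsemi> inverse_of C g = inverse_of C f \<Zsemi> k"
proof (rule iso_cancel_left[of f])
  have "f \<Zsemi> (h \<Zsemi> inverse_of C g) = f \<Zsemi> h \<Zsemi> inverse_of C g" using assms(2-) by simp
  also have "\<dots> = k" using assms by simp
  finally show "f \<Zsemi> (h \<Zsemi> inverse_of C g) = f \<Zsemi> (inverse_of C f \<Zsemi> k)" using assms(2-) by simp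
qed (use assms(2-) in simp_all)

end

lemma category_prod_cat:
  assumes "category C" "category D"
  shows "category (prod_cat C D)"
proof -
  interpret C: category C by fact
  interpret D: category D by fact
  show ?thesis
    by unfold_locales (auto simp: prod_cat_def hom_set_def)
qed

lemma hom_set_prod_cat:
  "hom_set (prod_cat C D) (x, y) (x', y') = hom_set C x x' \<times> hom_set D y y'"
  by (auto simp: hom_set_def prod_cat_def)

context cat_functor
begin

lemma FA_Ar [simp]:
  assumes "f \<in> Ar C"
  shows "FA f \<in> Ar D" "dm D (FA f) = FO (dm C f)" "cd D (FA f) = FO (cd C f)"
  using hom_setD[OF FA_hom[OF hom_set_self[OF assms]]] by auto

lemma FA_cmp [simp]:
  "\<lbrakk>f \<in> Ar C; g \<in> Ar C; cd C f = dm C g\<rbrakk> \<Longrightarrow> FA (f \<Zsemi>\<^bsub>C\<^esub> g) = FA f \<Zsemi>\<^bsub>D\<^esub> FA g"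
  using FA_comp[of f "dm C f" "cd C f" g "cd C g"] by (simp add: hom_set_def)

lemmas FO_FA [simp] = FO_Ob FA_idn

lemma FA_inverse_arrows: "inverse_arrows C f g \<Longrightarrow> inverse_arrows D (FA f) (FA g)"
  by (auto simp: inverse_arrows_def hom_set_def simp flip: FA_cmp)

lemma FA_iso [simp]:
  assumes "is_iso C f"
  shows "is_iso D (FA f)" "inverse_of D (FA f) = FA (inverse_of C f)"
  using FA_inverse_arrows[OF dom.inverse_arrows_inverse_of[OF assms]] cod.inverse_of_eq
  unfolding is_iso_def by blast+

end

context monoidal_category
begin

lemma tens_Ob [simp]: "\<lbrakk>x \<in> Ob C; y \<in> Ob C\<rbrakk> \<Longrightarrow> x \<otimes> y \<in> Ob C"
  using tensor.FO_Ob[of "(x, y)"] by (simp add: prod_cat_def)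

lemma tens_Ar [simp]:
  assumes "f \<in> Ar C" "g \<in> Ar C"
  shows "f \<otimes>\<^sub>a g \<in> Ar C" "dm C (f \<otimes>\<^sub>a g) = dm C f \<otimes> dm C g" "cd C (f \<otimes>\<^sub>a g) = cd C f \<otimes> cd C g"
  using tensor.FA_Ar[of "(f, g)"] assms by (simp_all add: prod_cat_def)

lemma tens_idn [simp]: "\<lbrakk>x \<in> Ob C; y \<in> Ob C\<rbrakk> \<Longrightarrow> idn C x \<otimes>\<^sub>a idn C y = idn C (x \<otimes> y)"
  using tensor.FA_idn[of "(x, y)"] by (simp add: prod_cat_def)

lemma interchange:
  "\<lbrakk>f \<in> Ar C; g \<in> Ar C; f' \<in> Ar C; g' \<in> Ar C; cd C f = dm C f'; cd C g = dm C g'\<rbrakk>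
    \<Longrightarrow> (f \<otimes>\<^sub>a g) \<Zsemi> (f' \<otimes>\<^sub>a g') = (f \<Zsemi> f') \<otimes>\<^sub>a (g \<Zsemi> g')"
  using tensor.FA_cmp[of "(f, g)" "(f', g')"] by (simp add: prod_cat_def)

lemma interchange_extend:
  assumes "f \<in> Ar C" "g \<in> Ar C" "f' \<in> Ar C" "g' \<in> Ar C" "cd C f = dm C f'" "cd C g = dm C g'"
    "k \<in> Ar C" "dm C k = cd C f' \<otimes> cd C g'"
  shows "(f \<otimes>\<^sub>a g) \<Zsemi> ((f' \<otimes>\<^sub>a g') \<Zsemi> k) = ((f \<Zsemi> f') \<otimes>\<^sub>a (g \<Zsemi> g')) \<Zsemi> k"
  using comp_eq_extend[OF interchange, of f g f' g' k] assms by simp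

lemma inverse_arrows_tens:
  assumes "is_iso C f" "is_iso C g"
  shows "inverse_arrows C (f \<otimes>\<^sub>a g) (inverse_of C f \<otimes>\<^sub>a inverse_of C g)"
  using assms by (simp add: inverse_arrows_def hom_set_def interchange)

lemma iso_tens [simp]:
  assumes "is_iso C f" "is_iso C g"
  shows "is_iso C (f \<otimes>\<^sub>a g)" "inverse_of C (f \<otimes>\<^sub>a g) = inverse_of C f \<otimes>\<^sub>a inverse_of C g"
  using inverse_arrows_tens[OF assms] inverse_of_eq unfolding is_iso_def by blast+

lemmas unit_iso [simp] = unit_Ob assr_iso lun_iso run_iso

lemma assr_Ar [simp]:
  assumes "x \<in> Ob C" "y \<in> Ob C" "z \<in> Ob C"
  shows "assr C x y z \<in> Ar C" "dm C (assr C x y z) = x \<otimes> y \<otimes> z" "cd C (assr C x y z) = x \<otimes> (y \<otimes> z)"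
  using hom_setD[OF assr_hom[OF assms]] by auto

lemma lun_Ar [simp]:
  assumes "x \<in> Ob C"
  shows "lun C x \<in> Ar C" "dm C (lun C x) = \<one> \<otimes> x" "cd C (lun C x) = x"
  using hom_setD[OF lun_hom[OF assms]] by auto

lemma run_Ar [simp]:
  assumes "x \<in> Ob C"
  shows "run C x \<in> Ar C" "dm C (run C x) = x \<otimes> \<one>" "cd C (run C x) = x"
  using hom_setD[OF run_hom[OF assms]] by auto

lemma assr_nat:
  "\<lbrakk>f \<in> Ar C; g \<in> Ar C; h \<in> Ar C; x' = cd C f; y' = cd C g; z' = cd C h\<rbrakk>
    \<Longrightarrow> ((f \<otimes>\<^sub>a g) \<otimes>\<^sub>a h) \<Zsemi> assr C x' y' z' = assr C (dm C f) (dm C g) (dm C h) \<Zsemi> (f \<otimes>\<^sub>a (g \<otimes>\<^sub>a h))"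
  by (rule assr_natural) (simp_all add: hom_set_def)

lemma lun_nat: "\<lbrakk>f \<in> Ar C; y = cd C f\<rbrakk> \<Longrightarrow> (idn C \<one> \<otimes>\<^sub>a f) \<Zsemi> lun C y = lun C (dm C f) \<Zsemi> f"
  by (rule lun_natural) (simp_all add: hom_set_def)

lemma run_nat: "\<lbrakk>f \<in> Ar C; y = cd C f\<rbrakk> \<Longrightarrow> (f \<otimes>\<^sub>a idn C \<one>) \<Zsemi> run C y = run C (dm C f) \<Zsemi> f"
  by (rule run_natural) (simp_all add: hom_set_def)

text \<open>
  By naturality of the unitor, tensoring with the unit is isomorphic to the identity functor.
\<close>

lemma unit_tens_faithful:
  assumes "idn C \<one> \<otimes>\<^sub>a f = idn C \<one> \<otimes>\<^sub>a g" "f \<in> hom_set C x y" "g \<in> hom_set C x y"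
  shows "f = g"
proof (rule iso_cancel_left[of "lun C x"])
  show "lun C x \<Zsemi> f = lun C x \<Zsemi> g"
    using lun_natural[OF assms(2)] lun_natural[OF assms(3)] assms(1) by simp
qed (use hom_setD[OF assms(2)] hom_setD[OF assms(3)] hom_Ob[OF assms(2)] in simp_all)

lemma tens_unit_faithful:
  assumes "f \<otimes>\<^sub>a idn C \<one> = g \<otimes>\<^sub>a idn C \<one>" "f \<in> hom_set C x y" "g \<in> hom_set C x y"
  shows "f = g"
proof (rule iso_cancel_left[of "run C x"])
  show "run C x \<Zsemi> f = run C x \<Zsemi> g"
    using run_natural[OF assms(2)] run_natural[OF assms(3)] assms(1) by simp
qed (use hom_setD[OF assms(2)] hom_setD[OF assms(3)] hom_Ob[OF assms(2)] in simp_all)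

text \<open>
  Kelly's argument: after tensoring with the unit on the left, the equation follows from the pentagon
  on \<open>\<one>, \<one>, x, y\<close> and two instances of the triangle, by cancelling isomorphisms.
\<close>

lemma assr_lun:
  assumes [simp]: "x \<in> Ob C" "y \<in> Ob C"
  shows "assr C \<one> x y \<Zsemi> lun C (x \<otimes> y) = lun C x \<otimes>\<^sub>a idn C y"
proof (rule unit_tens_faithful)
  let ?a = "assr C \<one> \<one> x \<otimes>\<^sub>a idn C y" and ?b = "assr C \<one> (\<one> \<otimes> x) y"
  have "?a \<Zsemi> (?b \<Zsemi> (idn C \<one> \<otimes>\<^sub>a (assr C \<one> x y \<Zsemi> lun C (x \<otimes> y))))
      = ?a \<Zsemi> ?b \<Zsemi> (idn C \<one> \<otimes>\<^sub>a assr C \<one> x y) \<Zsemi> (idn C \<one> \<otimes>\<^sub>a lun C (x \<otimes> y))"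
    by (simp add: interchange)
  also have "\<dots> = assr C (\<one> \<otimes> \<one>) x y \<Zsemi> (assr C \<one> \<one> (x \<otimes> y) \<Zsemi> (idn C \<one> \<otimes>\<^sub>a lun C (x \<otimes> y)))"
    by (subst pentagon[symmetric]) simp_all
  also have "\<dots> = assr C (\<one> \<otimes> \<one>) x y \<Zsemi> (run C \<one> \<otimes>\<^sub>a (idn C x \<otimes>\<^sub>a idn C y))"
    by (simp add: triangle)
  also have "\<dots> = ((run C \<one> \<otimes>\<^sub>a idn C x) \<otimes>\<^sub>a idn C y) \<Zsemi> assr C \<one> x y"
    by (subst assr_nat) simp_all
  also have "\<dots> = ((assr C \<one> \<one> x \<Zsemi> (idn C \<one> \<otimes>\<^sub>a lun C x)) \<otimes>\<^sub>a (idn C y \<Zsemi> idn C y)) \<Zsemi> assr C \<one> x y"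
    by (simp add: triangle)
  also have "\<dots> = ?a \<Zsemi> (((idn C \<one> \<otimes>\<^sub>a lun C x) \<otimes>\<^sub>a idn C y) \<Zsemi> assr C \<one> x y)"
    by (subst interchange[symmetric]) simp_all
  also have "\<dots> = ?a \<Zsemi> (?b \<Zsemi> (idn C \<one> \<otimes>\<^sub>a (lun C x \<otimes>\<^sub>a idn C y)))"
    by (subst assr_nat) simp_all
  finally have "?a \<Zsemi> (?b \<Zsemi> (idn C \<one> \<otimes>\<^sub>a (assr C \<one> x y \<Zsemi> lun C (x \<otimes> y))))
    = ?a \<Zsemi> (?b \<Zsemi> (idn C \<one> \<otimes>\<^sub>a (lun C x \<otimes>\<^sub>a idn C y)))" .
  then have "?b \<Zsemi> (idn C \<one> \<otimes>\<^sub>a (assr C \<one> x y \<Zsemi> lun C (x \<otimes> y)))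
    = ?b \<Zsemi> (idn C \<one> \<otimes>\<^sub>a (lun C x \<otimes>\<^sub>a idn C y))"
    by (rule iso_cancel_left) simp_all
  then show "idn C \<one> \<otimes>\<^sub>a (assr C \<one> x y \<Zsemi> lun C (x \<otimes> y)) = idn C \<one> \<otimes>\<^sub>a (lun C x \<otimes>\<^sub>a idn C y)"
    by (rule iso_cancel_left) simp_all
qed (simp_all add: hom_set_def)

text \<open>
  The mirror image of the preceding argument, with the pentagon on \<open>x, y, \<one>, \<one>\<close>.
\<close>

lemma assr_run:
  assumes [simp]: "x \<in> Ob C" "y \<in> Ob C"
  shows "assr C x y \<one> \<Zsemi> (idn C x \<otimes>\<^sub>a run C y) = run C (x \<otimes> y)"
proof (rule tens_unit_faithful)
  let ?c = "assr C x y \<one>"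
  have "((?c \<Zsemi> (idn C x \<otimes>\<^sub>a run C y)) \<otimes>\<^sub>a (idn C \<one> \<Zsemi> idn C \<one>)) \<Zsemi> ?c
      = (?c \<otimes>\<^sub>a idn C \<one>) \<Zsemi> (((idn C x \<otimes>\<^sub>a run C y) \<otimes>\<^sub>a idn C \<one>) \<Zsemi> ?c)"
    by (subst interchange[symmetric]) simp_all
  also have "\<dots> = (?c \<otimes>\<^sub>a idn C \<one>) \<Zsemi> (assr C x (y \<otimes> \<one>) \<one> \<Zsemi>
      ((idn C x \<Zsemi> idn C x) \<otimes>\<^sub>a (assr C y \<one> \<one> \<Zsemi> (idn C y \<otimes>\<^sub>a lun C \<one>))))"
    by (subst assr_nat) (simp_all add: triangle)
  also have "\<dots> = (?c \<otimes>\<^sub>a idn C \<one>) \<Zsemi> assr C x (y \<otimes> \<one>) \<one> \<Zsemi> (idn C x \<otimes>\<^sub>a assr C y \<one> \<one>) \<Zsemi>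
      (idn C x \<otimes>\<^sub>a (idn C y \<otimes>\<^sub>a lun C \<one>))"
    by (subst interchange[symmetric]) simp_all
  also have "\<dots> = assr C (x \<otimes> y) \<one> \<one> \<Zsemi> (assr C x y (\<one> \<otimes> \<one>) \<Zsemi> (idn C x \<otimes>\<^sub>a (idn C y \<otimes>\<^sub>a lun C \<one>)))"
    by (subst pentagon[symmetric]) simp_all
  also have "\<dots> = assr C (x \<otimes> y) \<one> \<one> \<Zsemi> (((idn C x \<otimes>\<^sub>a idn C y) \<otimes>\<^sub>a lun C \<one>) \<Zsemi> ?c)"
    by (subst assr_nat) simp_all
  also have "\<dots> = assr C (x \<otimes> y) \<one> \<one> \<Zsemi> (idn C (x \<otimes> y) \<otimes>\<^sub>a lun C \<one>) \<Zsemi> ?c"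
    by simp
  also have "\<dots> = (run C (x \<otimes> y) \<otimes>\<^sub>a idn C \<one>) \<Zsemi> ?c"
    by (subst triangle) simp_all
  finally have "((?c \<Zsemi> (idn C x \<otimes>\<^sub>a run C y)) \<otimes>\<^sub>a idn C \<one>) \<Zsemi> ?c = (run C (x \<otimes> y) \<otimes>\<^sub>a idn C \<one>) \<Zsemi> ?c"
    by simp
  then show "(?c \<Zsemi> (idn C x \<otimes>\<^sub>a run C y)) \<otimes>\<^sub>a idn C \<one> = run C (x \<otimes> y) \<otimes>\<^sub>a idn C \<one>"
    by (rule iso_cancel_right) simp_all
qed (simp_all add: hom_set_def)

text \<open>
  Tensored with the unit on the right, the left-hand side is computed by \<open>assr_lun\<close> and the right-hand
  side by the triangle. The two agree because naturality of \<open>lun\<close> at \<open>lun \<one>\<close> gives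
  \<open>lun (\<one> \<otimes> \<one>) = id \<otimes> lun \<one>\<close>.
\<close>

lemma lun_unit_eq_run_unit: "lun C \<one> = run C \<one>"
proof (rule tens_unit_faithful)
  have "lun C (\<one> \<otimes> \<one>) = idn C \<one> \<otimes>\<^sub>a lun C \<one>"
    by (rule iso_cancel_right[of _ "lun C \<one>"]) (simp_all add: lun_nat)
  then show "lun C \<one> \<otimes>\<^sub>a idn C \<one> = run C \<one> \<otimes>\<^sub>a idn C \<one>"
    using assr_lun[of \<one> \<one>] triangle[of \<one> \<one>] by simp
qed (simp_all add: hom_set_def)

end

context symmetric_monoidal_category
begin

lemma braid_Ar [simp]:
  assumes "x \<in> Ob C" "y \<in> Ob C"
  shows "braid C x y \<in> Ar C" "dm C (braid C x y) = x \<otimes> y" "cd C (braid C x y) = y \<otimes> x"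
  using hom_setD[OF braid_hom[OF assms]] by auto

lemma braid_nat:
  "\<lbrakk>f \<in> Ar C; g \<in> Ar C; x' = cd C f; y' = cd C g\<rbrakk>
    \<Longrightarrow> (f \<otimes>\<^sub>a g) \<Zsemi> braid C x' y' = braid C (dm C f) (dm C g) \<Zsemi> (g \<otimes>\<^sub>a f)"
  by (rule braid_natural) (simp_all add: hom_set_def)

end

section \<open>The 2-category of hypergraph categories\<close>

context strong_symmetric_monoidal_functor
begin

lemma phi_Ar [simp]:
  assumes "x \<in> Ob A" "y \<in> Ob A"
  shows "phi F x y \<in> Ar B" "dm B (phi F x y) = on_ob F x \<otimes>\<^bsub>B\<^esub> on_ob F y"
    "cd B (phi F x y) = on_ob F (x \<otimes>\<^bsub>A\<^esub> y)" "is_iso B (phi F x y)"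
  using hom_setD[OF phi_hom[OF assms]] phi_iso[OF assms] by auto

lemma phi_unit_Ar [simp]:
  shows "phi_unit F \<in> Ar B" "dm B (phi_unit F) = \<one>\<^bsub>B\<^esub>" "cd B (phi_unit F) = on_ob F \<one>\<^bsub>A\<^esub>"
    "is_iso B (phi_unit F)"
  using hom_setD[OF phi_unit_hom] phi_unit_iso by auto

lemma phi_nat:
  "\<lbrakk>f \<in> Ar A; g \<in> Ar A; x' = cd A f; y' = cd A g\<rbrakk>
    \<Longrightarrow> (on_ar F f \<otimes>\<^sub>a\<^bsub>B\<^esub> on_ar F g) \<Zsemi>\<^bsub>B\<^esub> phi F x' y'
      = phi F (dm A f) (dm A g) \<Zsemi>\<^bsub>B\<^esub> on_ar F (f \<otimes>\<^sub>a\<^bsub>A\<^esub> g)"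
  by (rule phi_natural) (simp_all add: hom_set_def)

end

lemma (in hypergraph_category) hyp_Ar [simp]:
  assumes "x \<in> Ob C"
  shows "mu C x \<in> Ar C" "dm C (mu C x) = x \<otimes> x" "cd C (mu C x) = x"
    "eta C x \<in> Ar C" "dm C (eta C x) = \<one>" "cd C (eta C x) = x"
    "delta C x \<in> Ar C" "dm C (delta C x) = x" "cd C (delta C x) = x \<otimes> x"
    "eps C x \<in> Ar C" "dm C (eps C x) = x" "cd C (eps C x) = \<one>"
  using frobenius[OF assms]
  by (auto simp: frobenius_structure_def commutative_monoid_def cocommutative_comonoid_def hom_set_def)

lemma hypergraph_functor_id:
  assumes "hypergraph_category A"
  shows "hypergraph_functor A A (id_functor A)"
proof -
  interpret A: hypergraph_category A by fact
  show ?thesis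
    by unfold_locales
      (auto simp: id_functor_def hom_set_def A.interchange A.lun_nat A.run_nat A.assr_nat
        A.lun_natural A.hexagon)
qed

locale composable_hypergraph_functors =
  F: hypergraph_functor A B F + G: hypergraph_functor B C G
  for A :: "('o, 'a, 'z) hypergraph_data_scheme"
    and B :: "('p, 'b, 'w) hypergraph_data_scheme"
    and C :: "('q, 'c, 'v) hypergraph_data_scheme"
    and F G
begin

abbreviation "FG \<equiv> comp_functors A C F G"

lemma comp_on [simp]:
  "x \<in> Ob A \<Longrightarrow> on_ob FG x = on_ob G (on_ob F x)"
  "f \<in> Ar A \<Longrightarrow> on_ar FG f = on_ar G (on_ar F f)"
  "\<lbrakk>x \<in> Ob A; y \<in> Ob A\<rbrakk>
    \<Longrightarrow> phi FG x y = phi G (on_ob F x) (on_ob F y) \<Zsemi>\<^bsub>C\<^esub> on_ar G (phi F x y)"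
  "phi_unit FG = phi_unit G \<Zsemi>\<^bsub>C\<^esub> on_ar G (phi_unit F)"
  by (simp_all add: comp_functors_def)

lemma comp_natural:
  assumes "f \<in> hom_set A x x'" "g \<in> hom_set A y y'"
  shows "(on_ar FG f \<otimes>\<^sub>a\<^bsub>C\<^esub> on_ar FG g) \<Zsemi>\<^bsub>C\<^esub> phi FG x' y'
    = phi FG x y \<Zsemi>\<^bsub>C\<^esub> on_ar FG (f \<otimes>\<^sub>a\<^bsub>A\<^esub> g)"
proof -
  note [simp] = hom_setD[OF assms(1)] hom_setD[OF assms(2)]
    F.A.hom_Ob[OF assms(1)] F.A.hom_Ob[OF assms(2)]
  let ?f = "on_ar F f" and ?g = "on_ar F g"
  have "(on_ar G ?f \<otimes>\<^sub>a\<^bsub>C\<^esub> on_ar G ?g) \<Zsemi>\<^bsub>C\<^esub>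
        (phi G (on_ob F x') (on_ob F y') \<Zsemi>\<^bsub>C\<^esub> on_ar G (phi F x' y'))
      = ((on_ar G ?f \<otimes>\<^sub>a\<^bsub>C\<^esub> on_ar G ?g) \<Zsemi>\<^bsub>C\<^esub> phi G (on_ob F x') (on_ob F y'))
        \<Zsemi>\<^bsub>C\<^esub> on_ar G (phi F x' y')"
    by simp
  also have "\<dots> = phi G (on_ob F x) (on_ob F y) \<Zsemi>\<^bsub>C\<^esub> on_ar G ((?f \<otimes>\<^sub>a\<^bsub>B\<^esub> ?g) \<Zsemi>\<^bsub>B\<^esub> phi F x' y')"
    by (subst G.phi_nat) simp_all
  also have "\<dots> = phi G (on_ob F x) (on_ob F y) \<Zsemi>\<^bsub>C\<^esub>
      on_ar G (phi F x y \<Zsemi>\<^bsub>B\<^esub> on_ar F (f \<otimes>\<^sub>a\<^bsub>A\<^esub> g))"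
    by (subst F.phi_nat) simp_all
  finally show ?thesis by simp
qed

text \<open>
  Each coherence condition for a composite functor is obtained by pasting: the structure maps of \<open>F\<close>
  are moved past those of \<open>G\<close> by naturality, then the condition for \<open>F\<close> is used under \<open>G\<close>, and
  finally the condition for \<open>G\<close>.
\<close>

lemma comp_assr:
  assumes [simp]: "x \<in> Ob A" "y \<in> Ob A" "z \<in> Ob A"
  shows "(phi FG x y \<otimes>\<^sub>a\<^bsub>C\<^esub> idn C (on_ob FG z)) \<Zsemi>\<^bsub>C\<^esub> phi FG (x \<otimes>\<^bsub>A\<^esub> y) z \<Zsemi>\<^bsub>C\<^esub> on_ar FG (assr A x y z)
      = assr C (on_ob FG x) (on_ob FG y) (on_ob FG z)
        \<Zsemi>\<^bsub>C\<^esub> (idn C (on_ob FG x) \<otimes>\<^sub>a\<^bsub>C\<^esub> phi FG y z) \<Zsemi>\<^bsub>C\<^esub> phi FG x (y \<otimes>\<^bsub>A\<^esub> z)"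
    (is "?lhs = ?rhs")
proof -
  let ?x = "on_ob F x" and ?y = "on_ob F y" and ?z = "on_ob F z"
  let ?px = "phi G ?x ?y \<otimes>\<^sub>a\<^bsub>C\<^esub> idn C (on_ob G ?z)" and ?pz = "idn C (on_ob G ?x) \<otimes>\<^sub>a\<^bsub>C\<^esub> phi G ?y ?z"
  have "?lhs = (?px \<Zsemi>\<^bsub>C\<^esub> (on_ar G (phi F x y) \<otimes>\<^sub>a\<^bsub>C\<^esub> on_ar G (idn B ?z)))
      \<Zsemi>\<^bsub>C\<^esub> (phi G (on_ob F (x \<otimes>\<^bsub>A\<^esub> y)) ?z
      \<Zsemi>\<^bsub>C\<^esub> on_ar G (phi F (x \<otimes>\<^bsub>A\<^esub> y) z \<Zsemi>\<^bsub>B\<^esub> on_ar F (assr A x y z)))"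
    by (subst G.B.interchange) simp_all
  also have "\<dots> = ?px \<Zsemi>\<^bsub>C\<^esub> ((on_ar G (phi F x y) \<otimes>\<^sub>a\<^bsub>C\<^esub> on_ar G (idn B ?z))
      \<Zsemi>\<^bsub>C\<^esub> phi G (on_ob F (x \<otimes>\<^bsub>A\<^esub> y)) ?z)
      \<Zsemi>\<^bsub>C\<^esub> on_ar G (phi F (x \<otimes>\<^bsub>A\<^esub> y) z \<Zsemi>\<^bsub>B\<^esub> on_ar F (assr A x y z))"
    by simp
  also have "\<dots> = (?px \<Zsemi>\<^bsub>C\<^esub> phi G (?x \<otimes>\<^bsub>B\<^esub> ?y) ?z) \<Zsemi>\<^bsub>C\<^esub> on_ar G
      ((phi F x y \<otimes>\<^sub>a\<^bsub>B\<^esub> idn B ?z) \<Zsemi>\<^bsub>B\<^esub> phi F (x \<otimes>\<^bsub>A\<^esub> y) z \<Zsemi>\<^bsub>B\<^esub> on_ar F (assr A x y z))"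
    by (subst G.phi_nat) simp_all
  also have "\<dots> = (?px \<Zsemi>\<^bsub>C\<^esub> phi G (?x \<otimes>\<^bsub>B\<^esub> ?y) ?z \<Zsemi>\<^bsub>C\<^esub> on_ar G (assr B ?x ?y ?z)) \<Zsemi>\<^bsub>C\<^esub>
      on_ar G ((idn B ?x \<otimes>\<^sub>a\<^bsub>B\<^esub> phi F y z) \<Zsemi>\<^bsub>B\<^esub> phi F x (y \<otimes>\<^bsub>A\<^esub> z))"
    by (subst F.phi_assr) simp_all
  also have "\<dots> = assr C (on_ob G ?x) (on_ob G ?y) (on_ob G ?z) \<Zsemi>\<^bsub>C\<^esub> ?pz \<Zsemi>\<^bsub>C\<^esub>
      (phi G ?x (?y \<otimes>\<^bsub>B\<^esub> ?z) \<Zsemi>\<^bsub>C\<^esub> on_ar G (idn B ?x \<otimes>\<^sub>a\<^bsub>B\<^esub> phi F y z)) \<Zsemi>\<^bsub>C\<^esub> on_ar G (phi F x (y \<otimes>\<^bsub>A\<^esub> z))"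
    by (subst G.phi_assr) simp_all
  also have "\<dots> = assr C (on_ob G ?x) (on_ob G ?y) (on_ob G ?z) \<Zsemi>\<^bsub>C\<^esub> ?pz \<Zsemi>\<^bsub>C\<^esub>
      ((on_ar G (idn B ?x) \<otimes>\<^sub>a\<^bsub>C\<^esub> on_ar G (phi F y z)) \<Zsemi>\<^bsub>C\<^esub> phi G ?x (on_ob F (y \<otimes>\<^bsub>A\<^esub> z)))
      \<Zsemi>\<^bsub>C\<^esub> on_ar G (phi F x (y \<otimes>\<^bsub>A\<^esub> z))"
    by (subst G.phi_nat) simp_all
  also have "\<dots> = assr C (on_ob G ?x) (on_ob G ?y) (on_ob G ?z) \<Zsemi>\<^bsub>C\<^esub>
      (?pz \<Zsemi>\<^bsub>C\<^esub> (on_ar G (idn B ?x) \<otimes>\<^sub>a\<^bsub>C\<^esub> on_ar G (phi F y z)))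
      \<Zsemi>\<^bsub>C\<^esub> (phi G ?x (on_ob F (y \<otimes>\<^bsub>A\<^esub> z)) \<Zsemi>\<^bsub>C\<^esub> on_ar G (phi F x (y \<otimes>\<^bsub>A\<^esub> z)))"
    by simp
  also have "\<dots> = ?rhs"
    by (subst G.B.interchange) simp_all
  finally show ?thesis .
qed

lemma comp_lun:
  assumes [simp]: "x \<in> Ob A"
  shows "(phi_unit FG \<otimes>\<^sub>a\<^bsub>C\<^esub> idn C (on_ob FG x)) \<Zsemi>\<^bsub>C\<^esub> phi FG \<one>\<^bsub>A\<^esub> x \<Zsemi>\<^bsub>C\<^esub> on_ar FG (lun A x)
    = lun C (on_ob FG x)" (is "?lhs = _")
proof -
  let ?x = "on_ob F x"
  let ?px = "phi_unit G \<otimes>\<^sub>a\<^bsub>C\<^esub> idn C (on_ob G ?x)"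
  have "?lhs = (?px \<Zsemi>\<^bsub>C\<^esub> (on_ar G (phi_unit F) \<otimes>\<^sub>a\<^bsub>C\<^esub> on_ar G (idn B ?x)))
      \<Zsemi>\<^bsub>C\<^esub> (phi G (on_ob F \<one>\<^bsub>A\<^esub>) ?x \<Zsemi>\<^bsub>C\<^esub> on_ar G (phi F \<one>\<^bsub>A\<^esub> x \<Zsemi>\<^bsub>B\<^esub> on_ar F (lun A x)))"
    by (subst G.B.interchange) simp_all
  also have "\<dots> = ?px \<Zsemi>\<^bsub>C\<^esub> ((on_ar G (phi_unit F) \<otimes>\<^sub>a\<^bsub>C\<^esub> on_ar G (idn B ?x))
      \<Zsemi>\<^bsub>C\<^esub> phi G (on_ob F \<one>\<^bsub>A\<^esub>) ?x) \<Zsemi>\<^bsub>C\<^esub> on_ar G (phi F \<one>\<^bsub>A\<^esub> x \<Zsemi>\<^bsub>B\<^esub> on_ar F (lun A x))"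
    by simp
  also have "\<dots> = ?px \<Zsemi>\<^bsub>C\<^esub> phi G \<one>\<^bsub>B\<^esub> ?x \<Zsemi>\<^bsub>C\<^esub> on_ar G
      ((phi_unit F \<otimes>\<^sub>a\<^bsub>B\<^esub> idn B ?x) \<Zsemi>\<^bsub>B\<^esub> phi F \<one>\<^bsub>A\<^esub> x \<Zsemi>\<^bsub>B\<^esub> on_ar F (lun A x))"
    by (subst G.phi_nat) simp_all
  also have "\<dots> = ?px \<Zsemi>\<^bsub>C\<^esub> phi G \<one>\<^bsub>B\<^esub> ?x \<Zsemi>\<^bsub>C\<^esub> on_ar G (lun B ?x)"
    by (subst F.phi_lun) simp_all
  also have "\<dots> = lun C (on_ob G ?x)"
    by (rule G.phi_lun) simp_all
  finally show ?thesis by simp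
qed

lemma comp_run:
  assumes [simp]: "x \<in> Ob A"
  shows "(idn C (on_ob FG x) \<otimes>\<^sub>a\<^bsub>C\<^esub> phi_unit FG) \<Zsemi>\<^bsub>C\<^esub> phi FG x \<one>\<^bsub>A\<^esub> \<Zsemi>\<^bsub>C\<^esub> on_ar FG (run A x)
    = run C (on_ob FG x)" (is "?lhs = _")
proof -
  let ?x = "on_ob F x"
  let ?px = "idn C (on_ob G ?x) \<otimes>\<^sub>a\<^bsub>C\<^esub> phi_unit G"
  have "?lhs = (?px \<Zsemi>\<^bsub>C\<^esub> (on_ar G (idn B ?x) \<otimes>\<^sub>a\<^bsub>C\<^esub> on_ar G (phi_unit F)))
      \<Zsemi>\<^bsub>C\<^esub> (phi G ?x (on_ob F \<one>\<^bsub>A\<^esub>) \<Zsemi>\<^bsub>C\<^esub> on_ar G (phi F x \<one>\<^bsub>A\<^esub> \<Zsemi>\<^bsub>B\<^esub> on_ar F (run A x)))"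
    by (subst G.B.interchange) simp_all
  also have "\<dots> = ?px \<Zsemi>\<^bsub>C\<^esub> ((on_ar G (idn B ?x) \<otimes>\<^sub>a\<^bsub>C\<^esub> on_ar G (phi_unit F))
      \<Zsemi>\<^bsub>C\<^esub> phi G ?x (on_ob F \<one>\<^bsub>A\<^esub>)) \<Zsemi>\<^bsub>C\<^esub> on_ar G (phi F x \<one>\<^bsub>A\<^esub> \<Zsemi>\<^bsub>B\<^esub> on_ar F (run A x))"
    by simp
  also have "\<dots> = ?px \<Zsemi>\<^bsub>C\<^esub> phi G ?x \<one>\<^bsub>B\<^esub> \<Zsemi>\<^bsub>C\<^esub> on_ar G
      ((idn B ?x \<otimes>\<^sub>a\<^bsub>B\<^esub> phi_unit F) \<Zsemi>\<^bsub>B\<^esub> phi F x \<one>\<^bsub>A\<^esub> \<Zsemi>\<^bsub>B\<^esub> on_ar F (run A x))"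
    by (subst G.phi_nat) simp_all
  also have "\<dots> = ?px \<Zsemi>\<^bsub>C\<^esub> phi G ?x \<one>\<^bsub>B\<^esub> \<Zsemi>\<^bsub>C\<^esub> on_ar G (run B ?x)"
    by (subst F.phi_run) simp_all
  also have "\<dots> = run C (on_ob G ?x)"
    by (rule G.phi_run) simp_all
  finally show ?thesis by simp
qed

lemma comp_braid:
  assumes [simp]: "x \<in> Ob A" "y \<in> Ob A"
  shows "phi FG x y \<Zsemi>\<^bsub>C\<^esub> on_ar FG (braid A x y)
    = braid C (on_ob FG x) (on_ob FG y) \<Zsemi>\<^bsub>C\<^esub> phi FG y x" (is "?lhs = ?rhs")
proof -
  let ?x = "on_ob F x" and ?y = "on_ob F y"
  have "?lhs = phi G ?x ?y \<Zsemi>\<^bsub>C\<^esub> on_ar G (phi F x y \<Zsemi>\<^bsub>B\<^esub> on_ar F (braid A x y))"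
    by simp
  also have "\<dots> = (phi G ?x ?y \<Zsemi>\<^bsub>C\<^esub> on_ar G (braid B ?x ?y)) \<Zsemi>\<^bsub>C\<^esub> on_ar G (phi F y x)"
    by (subst F.phi_braid) simp_all
  also have "\<dots> = ?rhs"
    by (subst G.phi_braid) simp_all
  finally show ?thesis .
qed

lemma hypergraph_functor_comp: "hypergraph_functor A C FG"
proof unfold_locales
  show "phi FG x y = undefined" if "\<not> (x \<in> Ob A \<and> y \<in> Ob A)" for x y
    using that by (auto simp: comp_functors_def)
  show "on_ob FG \<in> extensional (Ob A)" "on_ar FG \<in> extensional (Ar A)"
    by (simp_all add: comp_functors_def)
  show "on_ar FG f \<in> hom_set C (on_ob FG x) (on_ob FG y)" if "f \<in> hom_set A x y" for f x y
    using that F.A.hom_Ob[OF that] by (simp add: hom_set_def)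
  show "on_ar FG (f \<Zsemi>\<^bsub>A\<^esub> g) = on_ar FG f \<Zsemi>\<^bsub>C\<^esub> on_ar FG g"
    if "f \<in> hom_set A x y" "g \<in> hom_set A y z" for f g x y z
    using that by (simp add: hom_set_def)
qed (rule comp_natural comp_assr comp_lun comp_run comp_braid
    | simp add: hom_set_def F.mu_functor G.mu_functor F.eta_functor G.eta_functor
      F.delta_functor G.delta_functor F.eps_functor G.eps_functor)+

end

lemma Hyp_arrowD:
  assumes "t \<in> Ar (Hyp_hom A B)"
  shows "hypergraph_functor A B (src t)" "hypergraph_functor A B (tgt t)"
    "monoidal_transformation A B t"
  using assms by (simp_all add: Hyp_hom_def)

text \<open>
  The values outside the carriers are fixed, so agreement on the carriers is equality of records. The
  strict laws of the 2-category, which are equations between functors, rest on this.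
\<close>

lemma functor_eqI:
  fixes F F' :: "('o, 'a, 'p, 'b) monoidal_functor_data"
  assumes "hypergraph_functor A B F" "hypergraph_functor A B F'"
    and "\<And>x. x \<in> Ob A \<Longrightarrow> on_ob F x = on_ob F' x" "\<And>f. f \<in> Ar A \<Longrightarrow> on_ar F f = on_ar F' f"
    and "\<And>x y. \<lbrakk>x \<in> Ob A; y \<in> Ob A\<rbrakk> \<Longrightarrow> phi F x y = phi F' x y" "phi_unit F = phi_unit F'"
  shows "F = F'"
proof -
  interpret F: hypergraph_functor A B F by fact
  interpret F': hypergraph_functor A B F' by fact
  have "on_ob F = on_ob F'" "on_ar F = on_ar F'"
    using F.on_ob_ext F'.on_ob_ext F.on_ar_ext F'.on_ar_ext assms(3,4)
    by (blast intro: extensionalityI)+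
  moreover have "phi F = phi F'"
  proof (intro ext)
    show "phi F x y = phi F' x y" for x y
      using F.phi_ext[of x y] F'.phi_ext[of x y] assms(5)[of x y] by (cases "x \<in> Ob A \<and> y \<in> Ob A") simp_all
  qed
  ultimately show ?thesis using assms(6) by simp
qed

lemma transformation_eqI:
  fixes s t :: "('o, 'a, 'p, 'b) transformation_data"
  assumes "s \<in> Ar (Hyp_hom A B)" "t \<in> Ar (Hyp_hom A B)" "src s = src t" "tgt s = tgt t"
    and "\<And>x. x \<in> Ob A \<Longrightarrow> component s x = component t x"
  shows "s = t"
proof -
  interpret s: monoidal_transformation A B s by (rule Hyp_arrowD[OF assms(1)])
  interpret t: monoidal_transformation A B t by (rule Hyp_arrowD[OF assms(2)])
  have "component s = component t"
    using s.component_ext t.component_ext assms(5) by (blast intro: extensionalityI)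
  then show ?thesis using assms by simp
qed

context monoidal_transformation
begin

lemma component_Ar [simp]:
  assumes "x \<in> Ob A"
  shows "component t x \<in> Ar B" "dm B (component t x) = on_ob (src t) x"
    "cd B (component t x) = on_ob (tgt t) x"
  using hom_setD[OF component_hom[OF assms]] by auto

lemma component_nat:
  "\<lbrakk>f \<in> Ar A; y = cd A f\<rbrakk>
    \<Longrightarrow> on_ar (src t) f \<Zsemi>\<^bsub>B\<^esub> component t y = component t (dm A f) \<Zsemi>\<^bsub>B\<^esub> on_ar (tgt t) f"
  by (rule natural) (simp add: hom_set_def)

end

lemma transformation_idn:
  assumes "hypergraph_functor A B F"
  shows "idn (Hyp_hom A B) F \<in> Ar (Hyp_hom A B)"
proof -
  interpret F: hypergraph_functor A B F by fact
  let ?t = "idn (Hyp_hom A B) F"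
  have [simp]: "src ?t = F" "tgt ?t = F" "\<And>x. x \<in> Ob A \<Longrightarrow> component ?t x = idn B (on_ob F x)"
    and ext: "component ?t \<in> extensional (Ob A)"
    by (simp_all add: Hyp_hom_def)
  have t: "?t \<in> Ar (Hyp_hom A B) \<longleftrightarrow> monoidal_transformation A B ?t"
    using assms by (simp add: Hyp_hom_def)
  have hom: "f \<in> hom_set A x y \<Longrightarrow> f \<in> Ar A \<and> dm A f = x \<and> cd A f = y \<and> x \<in> Ob A \<and> y \<in> Ob A"
    for f x y using F.A.hom_Ob hom_setD[of f A x y] by blast
  have "strong_symmetric_monoidal_functor A B F" ..
  then show ?thesis
    unfolding t monoidal_transformation_def monoidal_transformation_axioms_def
    using ext by (auto dest!: hom simp: hom_setI)
qed

lemma transformation_comp: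
  assumes s: "s \<in> Ar (Hyp_hom A B)" and t: "t \<in> Ar (Hyp_hom A B)" and "tgt s = src t"
  shows "s \<Zsemi>\<^bsub>Hyp_hom A B\<^esub> t \<in> Ar (Hyp_hom A B)"
proof -
  interpret s: monoidal_transformation A B s by (rule Hyp_arrowD[OF s])
  interpret t: monoidal_transformation A B t by (rule Hyp_arrowD[OF t])
  let ?r = "s \<Zsemi>\<^bsub>Hyp_hom A B\<^esub> t"
  have [simp]: "src ?r = src s" "tgt ?r = tgt t"
    "\<And>x. x \<in> Ob A \<Longrightarrow> component ?r x = component s x \<Zsemi>\<^bsub>B\<^esub> component t x"
    by (simp_all add: Hyp_hom_def)
  note [simp] = assms(3)
  note mid [simp] = s.tgt.phi_Ar[unfolded assms(3)] s.component_Ar[unfolded assms(3)]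
  have "strong_symmetric_monoidal_functor A B (src s)" "strong_symmetric_monoidal_functor A B (tgt t)" ..
  then have "monoidal_transformation A B ?r"
  proof (intro monoidal_transformation.intro monoidal_transformation_axioms.intro)
    show "component ?r \<in> extensional (Ob A)" by (simp add: Hyp_hom_def)
    show "component ?r x \<in> hom_set B (on_ob (src ?r) x) (on_ob (tgt ?r) x)" if "x \<in> Ob A" for x
      using that by (simp add: hom_set_def)
    show "on_ar (src ?r) f \<Zsemi>\<^bsub>B\<^esub> component ?r y = component ?r x \<Zsemi>\<^bsub>B\<^esub> on_ar (tgt ?r) f"
      if "f \<in> hom_set A x y" for f x y
    proof -
      note [simp] = hom_setD[OF that] s.src.A.hom_Ob[OF that]
      have "on_ar (src ?r) f \<Zsemi>\<^bsub>B\<^esub> component ?r y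
          = (on_ar (src s) f \<Zsemi>\<^bsub>B\<^esub> component s y) \<Zsemi>\<^bsub>B\<^esub> component t y" by simp
      also have "\<dots> = component s x \<Zsemi>\<^bsub>B\<^esub> (on_ar (src t) f \<Zsemi>\<^bsub>B\<^esub> component t y)"
        by (subst s.component_nat) simp_all
      also have "\<dots> = component s x \<Zsemi>\<^bsub>B\<^esub> (component t x \<Zsemi>\<^bsub>B\<^esub> on_ar (tgt t) f)"
        by (subst t.component_nat) simp_all
      finally show ?thesis by simp
    qed
    show "phi (src ?r) x y \<Zsemi>\<^bsub>B\<^esub> component ?r (x \<otimes>\<^bsub>A\<^esub> y)
        = (component ?r x \<otimes>\<^sub>a\<^bsub>B\<^esub> component ?r y) \<Zsemi>\<^bsub>B\<^esub> phi (tgt ?r) x y"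
      if [simp]: "x \<in> Ob A" "y \<in> Ob A" for x y
    proof -
      have "phi (src ?r) x y \<Zsemi>\<^bsub>B\<^esub> component ?r (x \<otimes>\<^bsub>A\<^esub> y)
          = (phi (src s) x y \<Zsemi>\<^bsub>B\<^esub> component s (x \<otimes>\<^bsub>A\<^esub> y)) \<Zsemi>\<^bsub>B\<^esub> component t (x \<otimes>\<^bsub>A\<^esub> y)"
        by simp
      also have "\<dots> = (component s x \<otimes>\<^sub>a\<^bsub>B\<^esub> component s y) \<Zsemi>\<^bsub>B\<^esub>
          (phi (src t) x y \<Zsemi>\<^bsub>B\<^esub> component t (x \<otimes>\<^bsub>A\<^esub> y))"
        by (subst s.monoidal_tensor) simp_all
      also have "\<dots> = ((component s x \<otimes>\<^sub>a\<^bsub>B\<^esub> component s y) \<Zsemi>\<^bsub>B\<^esub>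
          (component t x \<otimes>\<^sub>a\<^bsub>B\<^esub> component t y)) \<Zsemi>\<^bsub>B\<^esub> phi (tgt t) x y"
        by (subst t.monoidal_tensor) simp_all
      also have "\<dots> = (component ?r x \<otimes>\<^sub>a\<^bsub>B\<^esub> component ?r y) \<Zsemi>\<^bsub>B\<^esub> phi (tgt ?r) x y"
        by (subst s.src.B.interchange) simp_all
      finally show ?thesis .
    qed
    show "phi_unit (src ?r) \<Zsemi>\<^bsub>B\<^esub> component ?r \<one>\<^bsub>A\<^esub> = phi_unit (tgt ?r)"
    proof -
      have "phi_unit (src ?r) \<Zsemi>\<^bsub>B\<^esub> component ?r \<one>\<^bsub>A\<^esub>
          = (phi_unit (src s) \<Zsemi>\<^bsub>B\<^esub> component s \<one>\<^bsub>A\<^esub>) \<Zsemi>\<^bsub>B\<^esub> component t \<one>\<^bsub>A\<^esub>"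
        by simp
      then show ?thesis by (simp add: s.monoidal_unit t.monoidal_unit)
    qed
  qed simp_all
  then show ?thesis using Hyp_arrowD[OF s] Hyp_arrowD[OF t] by (simp add: Hyp_hom_def)
qed

lemma category_Hyp_hom: "category (Hyp_hom A B)"
proof
  fix F x y z w f g h
  show "dm (Hyp_hom A B) f \<in> Ob (Hyp_hom A B)" "cd (Hyp_hom A B) f \<in> Ob (Hyp_hom A B)"
    if "f \<in> Ar (Hyp_hom A B)"
    using that by (simp_all add: Hyp_hom_def)
  show "idn (Hyp_hom A B) x \<in> hom_set (Hyp_hom A B) x x" if "x \<in> Ob (Hyp_hom A B)"
    using that transformation_idn[of A B x] by (simp add: hom_set_def) (simp add: Hyp_hom_def)
  show "f \<Zsemi>\<^bsub>Hyp_hom A B\<^esub> g \<in> hom_set (Hyp_hom A B) x z"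
    if "f \<in> hom_set (Hyp_hom A B) x y" "g \<in> hom_set (Hyp_hom A B) y z"
    using that transformation_comp[of f A B g] by (simp add: hom_set_def) (simp add: Hyp_hom_def)
  show "(f \<Zsemi>\<^bsub>Hyp_hom A B\<^esub> g) \<Zsemi>\<^bsub>Hyp_hom A B\<^esub> h = f \<Zsemi>\<^bsub>Hyp_hom A B\<^esub> (g \<Zsemi>\<^bsub>Hyp_hom A B\<^esub> h)"
    if f: "f \<in> hom_set (Hyp_hom A B) x y" and g: "g \<in> hom_set (Hyp_hom A B) y z"
      and h: "h \<in> hom_set (Hyp_hom A B) z w"
  proof -
    interpret f: monoidal_transformation A B f by (rule Hyp_arrowD[OF hom_setD(1)[OF f]])
    interpret g: monoidal_transformation A B g by (rule Hyp_arrowD[OF hom_setD(1)[OF g]])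
    interpret h: monoidal_transformation A B h by (rule Hyp_arrowD[OF hom_setD(1)[OF h]])
    have [simp]: "tgt f = src g" "tgt g = src h" using f g h by (auto simp: hom_set_def Hyp_hom_def)
    show ?thesis by (auto simp: Hyp_hom_def restrict_def)
  qed
  show "idn (Hyp_hom A B) x \<Zsemi>\<^bsub>Hyp_hom A B\<^esub> f = f" if f: "f \<in> hom_set (Hyp_hom A B) x y"
  proof -
    interpret f: monoidal_transformation A B f by (rule Hyp_arrowD[OF hom_setD(1)[OF f]])
    have "src f = x" using f by (auto simp: hom_set_def Hyp_hom_def)
    then show ?thesis using f.component_ext
      by (auto simp: Hyp_hom_def restrict_def extensional_def intro!: transformation_data.equality)
  qed
  show "f \<Zsemi>\<^bsub>Hyp_hom A B\<^esub> idn (Hyp_hom A B) y = f" if f: "f \<in> hom_set (Hyp_hom A B) x y"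
  proof -
    interpret f: monoidal_transformation A B f by (rule Hyp_arrowD[OF hom_setD(1)[OF f]])
    have "tgt f = y" using f by (auto simp: hom_set_def Hyp_hom_def)
    then show ?thesis using f.component_ext
      by (auto simp: Hyp_hom_def restrict_def extensional_def intro!: transformation_data.equality)
  qed
qed

lemma whisker_idn:
  assumes "hypergraph_functor A B F" "hypergraph_functor B C G"
  shows "horizontal_comp A C (idn (Hyp_hom A B) F) (idn (Hyp_hom B C) G)
    = idn (Hyp_hom A C) (comp_functors A C F G)"
proof -
  interpret composable_hypergraph_functors A B C F G
    using assms by (rule composable_hypergraph_functors.intro)
  show ?thesis
    by (auto simp: horizontal_comp_def Hyp_hom_def restrict_def fun_eq_iff)
qed

lemma transformation_horizontal:
  fixes A :: "('o, 'a) hypergraph_data" and B :: "('p, 'b) hypergraph_data"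
    and C :: "('q, 'c) hypergraph_data"
  assumes s: "s \<in> Ar (Hyp_hom A B)" and t: "t \<in> Ar (Hyp_hom B C)"
  shows "horizontal_comp A C s t \<in> Ar (Hyp_hom A C)"
proof -
  interpret s: monoidal_transformation A B s by (rule Hyp_arrowD[OF s])
  interpret t: monoidal_transformation B C t by (rule Hyp_arrowD[OF t])
  interpret S: composable_hypergraph_functors A B C "src s" "src t"
    using Hyp_arrowD[OF s] Hyp_arrowD[OF t] by (intro composable_hypergraph_functors.intro)
  interpret T: composable_hypergraph_functors A B C "tgt s" "tgt t"
    using Hyp_arrowD[OF s] Hyp_arrowD[OF t] by (intro composable_hypergraph_functors.intro)
  interpret SFG: hypergraph_functor A C S.FG by (rule S.hypergraph_functor_comp)
  interpret TFG: hypergraph_functor A C T.FG by (rule T.hypergraph_functor_comp)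
  let ?r = "horizontal_comp A C s t"
  let ?G = "on_ar (src t)"
  have [simp]: "src ?r = S.FG" "tgt ?r = T.FG"
    "\<And>x. x \<in> Ob A \<Longrightarrow> component ?r x = ?G (component s x) \<Zsemi>\<^bsub>C\<^esub> component t (on_ob (tgt s) x)"
    by (simp_all add: horizontal_comp_def)
  have "strong_symmetric_monoidal_functor A C S.FG" "strong_symmetric_monoidal_functor A C T.FG" ..
  then have "monoidal_transformation A C ?r"
  proof (intro monoidal_transformation.intro monoidal_transformation_axioms.intro)
    show "component ?r \<in> extensional (Ob A)" by (simp add: horizontal_comp_def)
    show "component ?r x \<in> hom_set C (on_ob (src ?r) x) (on_ob (tgt ?r) x)" if "x \<in> Ob A" for x
      using that by (simp add: hom_set_def)
    show "on_ar (src ?r) f \<Zsemi>\<^bsub>C\<^esub> component ?r y = component ?r x \<Zsemi>\<^bsub>C\<^esub> on_ar (tgt ?r) f"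
      if "f \<in> hom_set A x y" for f x y
    proof -
      note [simp] = hom_setD[OF that] s.src.A.hom_Ob[OF that]
      have "on_ar (src ?r) f \<Zsemi>\<^bsub>C\<^esub> component ?r y
          = ?G (on_ar (src s) f \<Zsemi>\<^bsub>B\<^esub> component s y) \<Zsemi>\<^bsub>C\<^esub> component t (on_ob (tgt s) y)" by simp
      also have "\<dots> = ?G (component s x) \<Zsemi>\<^bsub>C\<^esub>
          (?G (on_ar (tgt s) f) \<Zsemi>\<^bsub>C\<^esub> component t (on_ob (tgt s) y))"
        by (subst s.component_nat) simp_all
      also have "\<dots> = component ?r x \<Zsemi>\<^bsub>C\<^esub> on_ar (tgt ?r) f"
        by (subst t.component_nat) simp_all
      finally show ?thesis .
    qed
    show "phi (src ?r) x y \<Zsemi>\<^bsub>C\<^esub> component ?r (x \<otimes>\<^bsub>A\<^esub> y)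
        = (component ?r x \<otimes>\<^sub>a\<^bsub>C\<^esub> component ?r y) \<Zsemi>\<^bsub>C\<^esub> phi (tgt ?r) x y"
      if [simp]: "x \<in> Ob A" "y \<in> Ob A" for x y
    proof -
      let ?F = "on_ob (src s)" and ?F' = "on_ob (tgt s)"
      let ?s = "component s" and ?t = "component t"
      have "phi (src ?r) x y \<Zsemi>\<^bsub>C\<^esub> component ?r (x \<otimes>\<^bsub>A\<^esub> y)
          = phi (src t) (?F x) (?F y) \<Zsemi>\<^bsub>C\<^esub> ?G (phi (src s) x y \<Zsemi>\<^bsub>B\<^esub> ?s (x \<otimes>\<^bsub>A\<^esub> y))
            \<Zsemi>\<^bsub>C\<^esub> ?t (?F' (x \<otimes>\<^bsub>A\<^esub> y))"
        by simp
      also have "\<dots> = (phi (src t) (?F x) (?F y) \<Zsemi>\<^bsub>C\<^esub> ?G (?s x \<otimes>\<^sub>a\<^bsub>B\<^esub> ?s y))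
          \<Zsemi>\<^bsub>C\<^esub> (?G (phi (tgt s) x y) \<Zsemi>\<^bsub>C\<^esub> ?t (?F' (x \<otimes>\<^bsub>A\<^esub> y)))"
        by (subst s.monoidal_tensor) simp_all
      also have "\<dots> = ((?G (?s x) \<otimes>\<^sub>a\<^bsub>C\<^esub> ?G (?s y)) \<Zsemi>\<^bsub>C\<^esub> phi (src t) (?F' x) (?F' y))
          \<Zsemi>\<^bsub>C\<^esub> (?t (?F' x \<otimes>\<^bsub>B\<^esub> ?F' y) \<Zsemi>\<^bsub>C\<^esub> on_ar (tgt t) (phi (tgt s) x y))"
        by (subst t.src.phi_nat, simp_all add: t.component_nat)
      also have "\<dots> = (?G (?s x) \<otimes>\<^sub>a\<^bsub>C\<^esub> ?G (?s y)) \<Zsemi>\<^bsub>C\<^esub> (phi (src t) (?F' x) (?F' y)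
          \<Zsemi>\<^bsub>C\<^esub> ?t (?F' x \<otimes>\<^bsub>B\<^esub> ?F' y)) \<Zsemi>\<^bsub>C\<^esub> on_ar (tgt t) (phi (tgt s) x y)"
        by simp
      also have "\<dots> = ((?G (?s x) \<otimes>\<^sub>a\<^bsub>C\<^esub> ?G (?s y)) \<Zsemi>\<^bsub>C\<^esub> (?t (?F' x) \<otimes>\<^sub>a\<^bsub>C\<^esub> ?t (?F' y)))
          \<Zsemi>\<^bsub>C\<^esub> (phi (tgt t) (?F' x) (?F' y) \<Zsemi>\<^bsub>C\<^esub> on_ar (tgt t) (phi (tgt s) x y))"
        by (subst t.monoidal_tensor) simp_all
      also have "\<dots> = (component ?r x \<otimes>\<^sub>a\<^bsub>C\<^esub> component ?r y) \<Zsemi>\<^bsub>C\<^esub> phi (tgt ?r) x y"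
        by (subst t.src.B.interchange) simp_all
      finally show ?thesis .
    qed
    show "phi_unit (src ?r) \<Zsemi>\<^bsub>C\<^esub> component ?r \<one>\<^bsub>A\<^esub> = phi_unit (tgt ?r)"
    proof -
      have "phi_unit (src ?r) \<Zsemi>\<^bsub>C\<^esub> component ?r \<one>\<^bsub>A\<^esub>
          = phi_unit (src t) \<Zsemi>\<^bsub>C\<^esub> (?G (phi_unit (src s) \<Zsemi>\<^bsub>B\<^esub> component s \<one>\<^bsub>A\<^esub>)
            \<Zsemi>\<^bsub>C\<^esub> component t (on_ob (tgt s) \<one>\<^bsub>A\<^esub>))"
        by simp
      also have "\<dots> = (phi_unit (src t) \<Zsemi>\<^bsub>C\<^esub> component t \<one>\<^bsub>B\<^esub>) \<Zsemi>\<^bsub>C\<^esub> on_ar (tgt t) (phi_unit (tgt s))"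
        by (subst s.monoidal_unit) (simp_all add: t.component_nat)
      finally show ?thesis by (simp add: t.monoidal_unit)
    qed
  qed simp_all
  then show ?thesis
    using S.hypergraph_functor_comp T.hypergraph_functor_comp by (simp add: Hyp_hom_def)
qed

text \<open>
  The two sides differ by one naturality square of \<open>t\<close>, at the component of \<open>s'\<close>.
\<close>

lemma horizontal_interchange:
  fixes A :: "('o, 'a) hypergraph_data" and B :: "('p, 'b) hypergraph_data"
    and C :: "('q, 'c) hypergraph_data"
  assumes s: "s \<in> Ar (Hyp_hom A B)" and t: "t \<in> Ar (Hyp_hom B C)"
    and s': "s' \<in> Ar (Hyp_hom A B)" and t': "t' \<in> Ar (Hyp_hom B C)"
    and eq: "tgt s = src s'" "tgt t = src t'"
  shows "horizontal_comp A C (s \<Zsemi>\<^bsub>Hyp_hom A B\<^esub> s') (t \<Zsemi>\<^bsub>Hyp_hom B C\<^esub> t')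
    = horizontal_comp A C s t \<Zsemi>\<^bsub>Hyp_hom A C\<^esub> horizontal_comp A C s' t'"
proof -
  interpret s: monoidal_transformation A B s by (rule Hyp_arrowD[OF s])
  interpret t: monoidal_transformation B C t by (rule Hyp_arrowD[OF t])
  interpret s': monoidal_transformation A B s' by (rule Hyp_arrowD[OF s'])
  interpret t': monoidal_transformation B C t' by (rule Hyp_arrowD[OF t'])
  note mid [simp] = eq s.component_Ar[unfolded eq] t.component_Ar[unfolded eq]
  have "(on_ar (src t) (component s x) \<Zsemi>\<^bsub>C\<^esub> on_ar (src t) (component s' x)) \<Zsemi>\<^bsub>C\<^esub>
      (component t (on_ob (tgt s') x) \<Zsemi>\<^bsub>C\<^esub> component t' (on_ob (tgt s') x))
    = (on_ar (src t) (component s x) \<Zsemi>\<^bsub>C\<^esub> component t (on_ob (src s') x)) \<Zsemi>\<^bsub>C\<^esub>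
      (on_ar (src t') (component s' x) \<Zsemi>\<^bsub>C\<^esub> component t' (on_ob (tgt s') x))" (is "?l = ?r")
    if [simp]: "x \<in> Ob A" for x
  proof -
    have "?l = on_ar (src t) (component s x) \<Zsemi>\<^bsub>C\<^esub> (on_ar (src t) (component s' x) \<Zsemi>\<^bsub>C\<^esub>
      component t (on_ob (tgt s') x)) \<Zsemi>\<^bsub>C\<^esub> component t' (on_ob (tgt s') x)"
      by simp
    also have "\<dots> = ?r"
      by (subst t.component_nat) simp_all
    finally show ?thesis .
  qed
  then show ?thesis
    by (auto simp: Hyp_hom_def horizontal_comp_def restrict_def fun_eq_iff)
qed

lemma horizontal_comp_functor:
  fixes A :: "('o, 'a) hypergraph_data" and B :: "('p, 'b) hypergraph_data"
    and C :: "('q, 'c) hypergraph_data"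
  shows "cat_functor (prod_cat (Hyp_hom A B) (Hyp_hom B C)) (Hyp_hom A C)
    (\<lambda>(F, G). comp_functors A C F G) (\<lambda>(s, t). horizontal_comp A C s t)"
proof (intro cat_functor.intro cat_functor_axioms.intro category_prod_cat category_Hyp_hom)
  have comp: "hypergraph_functor A C (comp_functors A C F G)"
    if "hypergraph_functor A B F" "hypergraph_functor B C G" for F G
    using that by (intro composable_hypergraph_functors.hypergraph_functor_comp[of A B C]
        composable_hypergraph_functors.intro)
  have st: "src (horizontal_comp A C s t) = comp_functors A C (src s) (src t)"
    "tgt (horizontal_comp A C s t) = comp_functors A C (tgt s) (tgt t)"
    for s :: "('o, 'a, 'p, 'b) transformation_data" and t :: "('p, 'b, 'q, 'c) transformation_data"
    by (simp_all add: horizontal_comp_def)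
  let ?P = "prod_cat (Hyp_hom A B) (Hyp_hom B C)"
  show "(case FG of (F, G) \<Rightarrow> comp_functors A C F G) \<in> Ob (Hyp_hom A C)"
    if "FG \<in> Ob ?P" for FG
    using that comp by (auto simp: prod_cat_def Hyp_hom_def)
  show "(case st of (s, t) \<Rightarrow> horizontal_comp A C s t)
      \<in> hom_set (Hyp_hom A C) (case FG of (F, G) \<Rightarrow> comp_functors A C F G)
        (case FG' of (F, G) \<Rightarrow> comp_functors A C F G)"
    if "st \<in> hom_set ?P FG FG'" for st FG FG'
  proof (cases st)
    case (Pair s t)
    with that have "s \<in> Ar (Hyp_hom A B)" "t \<in> Ar (Hyp_hom B C)" "FG = (src s, src t)" "FG' = (tgt s, tgt t)"
      by (auto simp: hom_set_def prod_cat_def Hyp_hom_def)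
    then show ?thesis using transformation_horizontal[of s A B t C] st Pair
      by (simp add: hom_set_def) (simp add: Hyp_hom_def)
  qed
  show "(case idn ?P FG of (s, t) \<Rightarrow> horizontal_comp A C s t)
      = idn (Hyp_hom A C) (case FG of (F, G) \<Rightarrow> comp_functors A C F G)"
    if "FG \<in> Ob ?P" for FG
  proof (cases FG)
    case (Pair F G)
    then have "hypergraph_functor A B F" "hypergraph_functor B C G"
      using that by (auto simp: prod_cat_def Hyp_hom_def)
    from whisker_idn[OF this] show ?thesis by (simp add: Pair prod_cat_def)
  qed
  show "(case st \<Zsemi>\<^bsub>?P\<^esub> st' of (s, t) \<Rightarrow> horizontal_comp A C s t)
      = (case st of (s, t) \<Rightarrow> horizontal_comp A C s t) \<Zsemi>\<^bsub>Hyp_hom A C\<^esub>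
        (case st' of (s, t) \<Rightarrow> horizontal_comp A C s t)"
    if "st \<in> hom_set ?P X Y" "st' \<in> hom_set ?P Y Z" for st st' X Y Z
  proof -
    obtain s t s' t' where p: "st = (s, t)" "st' = (s', t')" by (cases st, cases st')
    have "s \<in> Ar (Hyp_hom A B)" "t \<in> Ar (Hyp_hom B C)" "s' \<in> Ar (Hyp_hom A B)" "t' \<in> Ar (Hyp_hom B C)"
      "tgt s = src s'" "tgt t = src t'"
      using that p by (auto simp: hom_set_def prod_cat_def Hyp_hom_def)
    from horizontal_interchange[OF this] show ?thesis by (simp add: p prod_cat_def)
  qed
qed

lemma hypergraph_functor_composite:
  assumes "hypergraph_functor A B F" "hypergraph_functor B C G"
  shows "hypergraph_functor A C (comp_functors A C F G)"
  using assms
  by (intro composable_hypergraph_functors.hypergraph_functor_comp composable_hypergraph_functors.intro)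

lemma comp_functors_assoc:
  fixes B :: "('p, 'b, 'w) hypergraph_data_scheme" and C :: "('q, 'c, 'v) hypergraph_data_scheme"
  assumes F: "hypergraph_functor A B F" and G: "hypergraph_functor B C G" and K: "hypergraph_functor C D K"
  shows "comp_functors A D (comp_functors A C F G) K = comp_functors A D F (comp_functors B D G K)"
proof -
  interpret F: hypergraph_functor A B F by fact
  interpret G: hypergraph_functor B C G by fact
  interpret K: hypergraph_functor C D K by fact
  have "hypergraph_functor A D (comp_functors A D (comp_functors A C F G) K)"
    "hypergraph_functor A D (comp_functors A D F (comp_functors B D G K))"
    using F G K by (blast intro: hypergraph_functor_composite)+
  then show ?thesis by (rule functor_eqI) (simp_all add: comp_functors_def)
qed

lemma comp_functors_unit:
  assumes F: "hypergraph_functor A B F"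
  shows "comp_functors A B (id_functor A) F = F" "comp_functors A B F (id_functor B) = F"
proof -
  interpret F: hypergraph_functor A B F by fact
  have "hypergraph_category A" "hypergraph_category B" ..
  then have "hypergraph_functor A A (id_functor A)" "hypergraph_functor B B (id_functor B)"
    by (simp_all only: hypergraph_functor_id)
  note hyp = hypergraph_functor_composite[OF this(1) F] hypergraph_functor_composite[OF F this(2)]
  show "comp_functors A B (id_functor A) F = F"
    by (rule functor_eqI[OF hyp(1) F]) (simp_all add: comp_functors_def id_functor_def)
  show "comp_functors A B F (id_functor B) = F"
    by (rule functor_eqI[OF hyp(2) F]) (simp_all add: comp_functors_def id_functor_def)
qed

lemma horizontal_comp_assoc:
  fixes A :: "('o, 'a) hypergraph_data" and B :: "('p, 'b) hypergraph_data"
    and C :: "('q, 'c) hypergraph_data" and D :: "('r, 'd) hypergraph_data"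
  assumes s: "s \<in> Ar (Hyp_hom A B)" and t: "t \<in> Ar (Hyp_hom B C)" and u: "u \<in> Ar (Hyp_hom C D)"
  shows "horizontal_comp A D (horizontal_comp A C s t) u = horizontal_comp A D s (horizontal_comp B D t u)"
proof (rule transformation_eqI)
  interpret s: monoidal_transformation A B s by (rule Hyp_arrowD[OF s])
  interpret t: monoidal_transformation B C t by (rule Hyp_arrowD[OF t])
  interpret u: monoidal_transformation C D u by (rule Hyp_arrowD[OF u])
  show "horizontal_comp A D (horizontal_comp A C s t) u \<in> Ar (Hyp_hom A D)"
    "horizontal_comp A D s (horizontal_comp B D t u) \<in> Ar (Hyp_hom A D)"
    by (intro transformation_horizontal[OF transformation_horizontal[OF s t] u]
        transformation_horizontal[OF s transformation_horizontal[OF t u]])+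
  show "src (horizontal_comp A D (horizontal_comp A C s t) u)
      = src (horizontal_comp A D s (horizontal_comp B D t u))"
    "tgt (horizontal_comp A D (horizontal_comp A C s t) u)
      = tgt (horizontal_comp A D s (horizontal_comp B D t u))"
    using comp_functors_assoc[OF Hyp_arrowD(1)[OF s] Hyp_arrowD(1)[OF t] Hyp_arrowD(1)[OF u]]
      comp_functors_assoc[OF Hyp_arrowD(2)[OF s] Hyp_arrowD(2)[OF t] Hyp_arrowD(2)[OF u]]
    by (simp_all add: horizontal_comp_def)
  show "component (horizontal_comp A D (horizontal_comp A C s t) u) x
      = component (horizontal_comp A D s (horizontal_comp B D t u)) x" if "x \<in> Ob A" for x
    using that by (simp add: horizontal_comp_def comp_functors_def)
qed

lemma horizontal_comp_unit:
  fixes A :: "('o, 'a) hypergraph_data" and B :: "('p, 'b) hypergraph_data"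
  assumes "hypergraph_category A" "hypergraph_category B" and s: "s \<in> Ar (Hyp_hom A B)"
  shows "horizontal_comp A B (idn (Hyp_hom A A) (id_functor A)) s = s"
    "horizontal_comp A B s (idn (Hyp_hom B B) (id_functor B)) = s"
proof -
  interpret s: monoidal_transformation A B s by (rule Hyp_arrowD[OF s])
  note idA = transformation_idn[OF hypergraph_functor_id[OF assms(1)]]
  note idB = transformation_idn[OF hypergraph_functor_id[OF assms(2)]]
  show "horizontal_comp A B (idn (Hyp_hom A A) (id_functor A)) s = s"
    by (rule transformation_eqI[OF transformation_horizontal[OF idA s] s])
      (simp_all add: horizontal_comp_def Hyp_hom_def comp_functors_unit[OF Hyp_arrowD(1)[OF s]]
        comp_functors_unit[OF Hyp_arrowD(2)[OF s]], simp add: id_functor_def)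
  show "horizontal_comp A B s (idn (Hyp_hom B B) (id_functor B)) = s"
    by (rule transformation_eqI[OF transformation_horizontal[OF s idB] s])
      (simp_all add: horizontal_comp_def Hyp_hom_def comp_functors_unit[OF Hyp_arrowD(1)[OF s]]
        comp_functors_unit[OF Hyp_arrowD(2)[OF s]], simp add: id_functor_def)
qed

lemma two_category_Hyp: "two_category (Hyp :: (('o, 'a) hypergraph_data, ('o, 'a) hyp_1cell, ('o, 'a) hyp_2cell) two_category_data)"
proof (rule two_category.intro)
  fix X Y Z W :: "('o, 'a) hypergraph_data"
  show "category (Hom Hyp X Y)" by (simp add: Hyp_def category_Hyp_hom)
  show "id1 Hyp X \<in> Ob (Hom Hyp X X)" if "X \<in> Obj Hyp"
    using that hypergraph_functor_id[of X] by (simp add: Hyp_def Hyp_hom_def)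
  show "cat_functor (prod_cat (Hom Hyp X Y) (Hom Hyp Y Z)) (Hom Hyp X Z)
      (\<lambda>(f, g). comp1 Hyp X Y Z f g) (\<lambda>(s, t). comp2 Hyp X Y Z s t)"
    by (simp add: Hyp_def horizontal_comp_functor)
  show "comp1 Hyp W Y Z (comp1 Hyp W X Y f g) h = comp1 Hyp W X Z f (comp1 Hyp X Y Z g h)"
    if "f \<in> Ob (Hom Hyp W X)" "g \<in> Ob (Hom Hyp X Y)" "h \<in> Ob (Hom Hyp Y Z)" for f g h
    using that by (simp add: Hyp_def Hyp_hom_def comp_functors_assoc)
  show "comp2 Hyp W Y Z (comp2 Hyp W X Y s t) u = comp2 Hyp W X Z s (comp2 Hyp X Y Z t u)"
    if "s \<in> Ar (Hom Hyp W X)" "t \<in> Ar (Hom Hyp X Y)" "u \<in> Ar (Hom Hyp Y Z)" for s t u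
    using that by (simp add: Hyp_def horizontal_comp_assoc)
  show "comp1 Hyp X X Y (id1 Hyp X) f = f" "comp1 Hyp X Y Y f (id1 Hyp Y) = f"
    if "f \<in> Ob (Hom Hyp X Y)" for f
    using that by (simp_all add: Hyp_def Hyp_hom_def comp_functors_unit)
  show "comp2 Hyp X X Y (idn (Hom Hyp X X) (id1 Hyp X)) s = s"
    "comp2 Hyp X Y Y s (idn (Hom Hyp Y Y) (id1 Hyp Y)) = s"
    if "X \<in> Obj Hyp" "Y \<in> Obj Hyp" "s \<in> Ar (Hom Hyp X Y)" for s
    using that by (simp_all add: Hyp_def horizontal_comp_unit)
qed

lemma two_category_Hyp_OF: "two_category (Hyp_OF :: (('o, 'a) of_hypergraph_data, ('o, 'a) hyp_1cell, ('o, 'a) hyp_2cell) two_category_data)"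
proof -
  interpret two_category "Hyp :: (('o, 'a) hypergraph_data, ('o, 'a) hyp_1cell, ('o, 'a) hyp_2cell) two_category_data"
    by (rule two_category_Hyp)
  have "of_cat X \<in> Obj Hyp" if "X \<in> Obj Hyp_OF" for X :: "('o, 'a) of_hypergraph_data"
    using that by (simp add: Hyp_OF_def Hyp_def of_hypergraph_category.hypergraph)
  then show ?thesis
    by (intro two_category.intro) (simp_all add: Hyp_OF_def hom_category id1_Ob comp_functor comp1_assoc
        comp2_assoc id1_comp1 comp1_id1 id1_comp2 comp2_id1)
qed

lemma two_functor_forget_OF: "two_functor
  (Hyp_OF :: (('o, 'a) of_hypergraph_data, ('o, 'a) hyp_1cell, ('o, 'a) hyp_2cell) two_category_data)
  (Hyp :: (('o, 'a) hypergraph_data, ('o, 'a) hyp_1cell, ('o, 'a) hyp_2cell) two_category_data) forget_OF"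
proof (intro two_functor.intro two_functor_axioms.intro two_category_Hyp two_category_Hyp_OF)
  fix X Y :: "('o, 'a) of_hypergraph_data"
  show "cell0 forget_OF X \<in> Obj Hyp" if "X \<in> Obj Hyp_OF"
    using that by (simp add: forget_OF_def Hyp_OF_def Hyp_def of_hypergraph_category.hypergraph)
  show "cat_functor (Hom Hyp_OF X Y) (Hom Hyp (cell0 forget_OF X) (cell0 forget_OF Y))
      (cell1 forget_OF X Y) (cell2 forget_OF X Y)"
    by (intro cat_functor.intro cat_functor_axioms.intro)
      (simp_all add: forget_OF_def Hyp_OF_def Hyp_def category_Hyp_hom)
qed (simp_all add: forget_OF_def Hyp_OF_def)

lemma fully_faithful_forget_OF:
  "fully_faithful (Hom Hyp_OF X Y) (Hom Hyp (cell0 forget_OF X) (cell0 forget_OF Y))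
    (cell1 forget_OF X Y) (cell2 forget_OF X Y)"
  by (simp add: fully_faithful_def forget_OF_def Hyp_OF_def bij_betw_def inj_on_def)

text \<open>
  The pointwise inverses form a monoidal transformation because each of its axioms is the
  corresponding diagram for \<open>t\<close> with the components inverted.
\<close>

lemma monoidal_transformation_inverse:
  fixes A :: "('o, 'a) hypergraph_data" and B :: "('p, 'b) hypergraph_data"
  assumes t: "t \<in> Ar (Hyp_hom A B)" and iso: "\<And>x. x \<in> Ob A \<Longrightarrow> is_iso B (component t x)"
  shows "is_iso (Hyp_hom A B) t"
proof -
  interpret t: monoidal_transformation A B t by (rule Hyp_arrowD[OF t])
  note [simp] = iso
  let ?r = "\<lparr>src = tgt t, tgt = src t, component = restrict (\<lambda>x. inverse_of B (component t x)) (Ob A)\<rparr>"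
  have "strong_symmetric_monoidal_functor A B (src t)" "strong_symmetric_monoidal_functor A B (tgt t)" ..
  then have "monoidal_transformation A B ?r"
  proof (intro monoidal_transformation.intro monoidal_transformation_axioms.intro)
    show "component ?r x \<in> hom_set B (on_ob (src ?r) x) (on_ob (tgt ?r) x)" if "x \<in> Ob A" for x
      using that by (simp add: hom_set_def)
    show "on_ar (src ?r) f \<Zsemi>\<^bsub>B\<^esub> component ?r y = component ?r x \<Zsemi>\<^bsub>B\<^esub> on_ar (tgt ?r) f"
      if "f \<in> hom_set A x y" for f x y
    proof -
      note [simp] = hom_setD[OF that] t.src.A.hom_Ob[OF that]
      show ?thesis
        using t.src.B.inverse_square[of "component t x" "on_ar (tgt t) f" "on_ar (src t) f" "component t y"]
        by (simp add: t.component_nat)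
    qed
    show "phi (src ?r) x y \<Zsemi>\<^bsub>B\<^esub> component ?r (x \<otimes>\<^bsub>A\<^esub> y)
        = (component ?r x \<otimes>\<^sub>a\<^bsub>B\<^esub> component ?r y) \<Zsemi>\<^bsub>B\<^esub> phi (tgt ?r) x y"
      if [simp]: "x \<in> Ob A" "y \<in> Ob A" for x y
      using t.src.B.inverse_square[of "component t x \<otimes>\<^sub>a\<^bsub>B\<^esub> component t y" "phi (tgt t) x y"
          "phi (src t) x y" "component t (x \<otimes>\<^bsub>A\<^esub> y)"]
      by (simp add: t.monoidal_tensor)
    show "phi_unit (src ?r) \<Zsemi>\<^bsub>B\<^esub> component ?r \<one>\<^bsub>A\<^esub> = phi_unit (tgt ?r)"
      by (simp add: flip: t.monoidal_unit)
  qed simp_all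
  then have "inverse_arrows (Hyp_hom A B) t ?r"
    using Hyp_arrowD[OF t] by (auto simp: inverse_arrows_def Hyp_hom_def hom_set_def restrict_def fun_eq_iff)
  then show ?thesis unfolding is_iso_def by blast
qed

section \<open>Symmetric monoidal structure created by a fully faithful functor\<close>

text \<open>
  The assumptions on \<open>m\<close> and \<open>m0\<close> are those of a strong symmetric monoidal functor from \<open>D\<close> to \<open>C\<close>.
  However, \<open>D\<close> is only assumed to be a category with operations of the right types: that these satisfy
  the axioms of a symmetric monoidal category will follow from full faithfulness.
\<close>

locale monoidal_comparison =
  C: symmetric_monoidal_category C + cat_functor D C P U
  for D :: "('p, 'b, 'w) symmetric_monoidal_data_scheme"
    and C :: "('o, 'a, 'z) symmetric_monoidal_data_scheme"
    and P :: "'p \<Rightarrow> 'o" and U :: "'b \<Rightarrow> 'a" +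
  fixes m :: "'p \<Rightarrow> 'p \<Rightarrow> 'a" and m0 :: 'a
  assumes full_faithful: "fully_faithful D C P U"
    and D_unit_Ob: "\<one>\<^bsub>D\<^esub> \<in> Ob D"
    and D_tens_Ob: "\<lbrakk>s \<in> Ob D; t \<in> Ob D\<rbrakk> \<Longrightarrow> s \<otimes>\<^bsub>D\<^esub> t \<in> Ob D"
    and D_tens_hom: "\<lbrakk>a \<in> hom_set D s s'; b \<in> hom_set D t t'\<rbrakk>
      \<Longrightarrow> a \<otimes>\<^sub>a\<^bsub>D\<^esub> b \<in> hom_set D (s \<otimes>\<^bsub>D\<^esub> t) (s' \<otimes>\<^bsub>D\<^esub> t')"
    and D_assr_hom: "\<lbrakk>s \<in> Ob D; t \<in> Ob D; u \<in> Ob D\<rbrakk>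
      \<Longrightarrow> assr D s t u \<in> hom_set D (s \<otimes>\<^bsub>D\<^esub> t \<otimes>\<^bsub>D\<^esub> u) (s \<otimes>\<^bsub>D\<^esub> (t \<otimes>\<^bsub>D\<^esub> u))"
    and D_lun_hom: "s \<in> Ob D \<Longrightarrow> lun D s \<in> hom_set D (\<one>\<^bsub>D\<^esub> \<otimes>\<^bsub>D\<^esub> s) s"
    and D_run_hom: "s \<in> Ob D \<Longrightarrow> run D s \<in> hom_set D (s \<otimes>\<^bsub>D\<^esub> \<one>\<^bsub>D\<^esub>) s"
    and D_braid_hom: "\<lbrakk>s \<in> Ob D; t \<in> Ob D\<rbrakk>
      \<Longrightarrow> braid D s t \<in> hom_set D (s \<otimes>\<^bsub>D\<^esub> t) (t \<otimes>\<^bsub>D\<^esub> s)"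
    and m_hom: "\<lbrakk>s \<in> Ob D; t \<in> Ob D\<rbrakk> \<Longrightarrow> m s t \<in> hom_set C (P s \<otimes>\<^bsub>C\<^esub> P t) (P (s \<otimes>\<^bsub>D\<^esub> t))"
    and m_iso: "\<lbrakk>s \<in> Ob D; t \<in> Ob D\<rbrakk> \<Longrightarrow> is_iso C (m s t)"
    and m_natural: "\<lbrakk>a \<in> hom_set D s s'; b \<in> hom_set D t t'\<rbrakk>
      \<Longrightarrow> (U a \<otimes>\<^sub>a\<^bsub>C\<^esub> U b) \<Zsemi>\<^bsub>C\<^esub> m s' t' = m s t \<Zsemi>\<^bsub>C\<^esub> U (a \<otimes>\<^sub>a\<^bsub>D\<^esub> b)"
    and m0_hom: "m0 \<in> hom_set C \<one>\<^bsub>C\<^esub> (P \<one>\<^bsub>D\<^esub>)"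
    and m0_iso: "is_iso C m0"
    and m_assr: "\<lbrakk>s \<in> Ob D; t \<in> Ob D; u \<in> Ob D\<rbrakk>
      \<Longrightarrow> (m s t \<otimes>\<^sub>a\<^bsub>C\<^esub> idn C (P u)) \<Zsemi>\<^bsub>C\<^esub> m (s \<otimes>\<^bsub>D\<^esub> t) u \<Zsemi>\<^bsub>C\<^esub> U (assr D s t u)
        = assr C (P s) (P t) (P u) \<Zsemi>\<^bsub>C\<^esub> (idn C (P s) \<otimes>\<^sub>a\<^bsub>C\<^esub> m t u) \<Zsemi>\<^bsub>C\<^esub> m s (t \<otimes>\<^bsub>D\<^esub> u)"
    and m_lun: "s \<in> Ob D
      \<Longrightarrow> (m0 \<otimes>\<^sub>a\<^bsub>C\<^esub> idn C (P s)) \<Zsemi>\<^bsub>C\<^esub> m \<one>\<^bsub>D\<^esub> s \<Zsemi>\<^bsub>C\<^esub> U (lun D s) = lun C (P s)"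
    and m_run: "s \<in> Ob D
      \<Longrightarrow> (idn C (P s) \<otimes>\<^sub>a\<^bsub>C\<^esub> m0) \<Zsemi>\<^bsub>C\<^esub> m s \<one>\<^bsub>D\<^esub> \<Zsemi>\<^bsub>C\<^esub> U (run D s) = run C (P s)"
    and m_braid: "\<lbrakk>s \<in> Ob D; t \<in> Ob D\<rbrakk>
      \<Longrightarrow> m s t \<Zsemi>\<^bsub>C\<^esub> U (braid D s t) = braid C (P s) (P t) \<Zsemi>\<^bsub>C\<^esub> m t s"
begin

lemmas D_Ob [simp] = D_unit_Ob D_tens_Ob

lemma D_tens_Ar [simp]:
  assumes "a \<in> Ar D" "b \<in> Ar D"
  shows "a \<otimes>\<^sub>a\<^bsub>D\<^esub> b \<in> Ar D" "dm D (a \<otimes>\<^sub>a\<^bsub>D\<^esub> b) = dm D a \<otimes>\<^bsub>D\<^esub> dm D b"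
    "cd D (a \<otimes>\<^sub>a\<^bsub>D\<^esub> b) = cd D a \<otimes>\<^bsub>D\<^esub> cd D b"
  using hom_setD[OF D_tens_hom[OF hom_set_self[OF assms(1)] hom_set_self[OF assms(2)]]] by auto

lemma m_Ar [simp]:
  assumes "s \<in> Ob D" "t \<in> Ob D"
  shows "m s t \<in> Ar C" "dm C (m s t) = P s \<otimes>\<^bsub>C\<^esub> P t" "cd C (m s t) = P (s \<otimes>\<^bsub>D\<^esub> t)" "is_iso C (m s t)"
  using hom_setD[OF m_hom[OF assms]] m_iso[OF assms] by auto

lemma m0_Ar [simp]: "m0 \<in> Ar C" "dm C m0 = \<one>\<^bsub>C\<^esub>" "cd C m0 = P \<one>\<^bsub>D\<^esub>" "is_iso C m0"
  using hom_setD[OF m0_hom] m0_iso by auto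

text \<open>
  A frame presents an object \<open>X\<close> of \<open>C\<close>, up to isomorphism, as the image of an object \<open>s\<close> of \<open>D\<close>.
  Allowing arbitrary isomorphisms, not only identities, is what makes the notion closed under tensor
  products and applicable to objects outside the image of \<open>P\<close>.
\<close>

definition frame :: "'o \<Rightarrow> 'p \<Rightarrow> 'a \<Rightarrow> bool" where
  "frame X s i \<longleftrightarrow> s \<in> Ob D \<and> is_iso C i \<and> dm C i = X \<and> cd C i = P s"

definition tens_frame :: "'p \<Rightarrow> 'a \<Rightarrow> 'p \<Rightarrow> 'a \<Rightarrow> 'a" where
  "tens_frame s i t j = (i \<otimes>\<^sub>a\<^bsub>C\<^esub> j) \<Zsemi>\<^bsub>C\<^esub> m s t"

text \<open>
  A commuting square with sides \<open>g\<close> and \<open>U a\<close> and the frames of their domains and codomains. For identity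
  frames it says \<open>U a = g\<close>.
\<close>

definition over :: "'p \<Rightarrow> 'p \<Rightarrow> 'a \<Rightarrow> 'a \<Rightarrow> 'a \<Rightarrow> 'b \<Rightarrow> bool" where
  "over s t i j g a \<longleftrightarrow> frame (dm C g) s i \<and> frame (cd C g) t j \<and> g \<in> Ar C \<and> a \<in> hom_set D s t \<and>
     i \<Zsemi>\<^bsub>C\<^esub> U a = g \<Zsemi>\<^bsub>C\<^esub> j"

lemma frameD:
  assumes "frame X s i"
  shows "s \<in> Ob D" "i \<in> Ar C" "is_iso C i" "dm C i = X" "cd C i = P s" "X \<in> Ob C"
  using assms by (auto simp: frame_def)

lemma overD:
  assumes "over s t i j g a"
  shows "frame (dm C g) s i" "frame (cd C g) t j" "g \<in> Ar C" "a \<in> Ar D" "dm D a = s" "cd D a = t"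
    "i \<Zsemi>\<^bsub>C\<^esub> U a = g \<Zsemi>\<^bsub>C\<^esub> j"
  using assms by (auto simp: over_def hom_set_def)

lemma overI:
  assumes "frame X s i" "frame Y t j" "g \<in> Ar C" "dm C g = X" "cd C g = Y"
    "a \<in> Ar D" "dm D a = s" "cd D a = t" "i \<Zsemi>\<^bsub>C\<^esub> U a = g \<Zsemi>\<^bsub>C\<^esub> j"
  shows "over s t i j g a"
  using assms by (simp add: over_def hom_set_def)

lemma frame_idn: "s \<in> Ob D \<Longrightarrow> frame (P s) s (idn C (P s))"
  by (simp add: frame_def)

lemma frame_unit: "frame \<one>\<^bsub>C\<^esub> \<one>\<^bsub>D\<^esub> m0"
  by (simp add: frame_def)

lemma frame_tens:
  assumes "frame X s i" "frame Y t j"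
  shows "frame (X \<otimes>\<^bsub>C\<^esub> Y) (s \<otimes>\<^bsub>D\<^esub> t) (tens_frame s i t j)"
  using frameD[OF assms(1)] frameD[OF assms(2)] by (simp add: frame_def tens_frame_def)

text \<open>
  The transfer principle: an equation in \<open>D\<close> is proved by finding arrows of \<open>C\<close> over which its two sides
  lie, with respect to the same frames, and proving those equal. Faithfulness makes the arrow lying
  over \<open>g\<close> unique. The arrows of \<open>C\<close> are found by unification with the closure rules below.
\<close>

lemma over_eqI:
  assumes "over s t i j g a" "over s t i j g' b" "g = g'"
  shows "a = b"
proof -
  note a = overD[OF assms(1)] and b = overD[OF assms(2)]
  note i = frameD[OF a(1)] and j = frameD[OF a(2)]
  have "U a = U b"
    using a b i j assms(3) by (intro C.iso_cancel_left[of i "U a" "U b"]) simp_all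
  moreover have "inj_on U (hom_set D s t)"
    using full_faithful i j by (simp add: fully_faithful_def bij_betw_def)
  ultimately show ?thesis using a b by (simp add: inj_on_def hom_set_def)
qed

lemma over_exists:
  assumes "frame X s i" "frame Y t j" "g \<in> Ar C" "dm C g = X" "cd C g = Y"
  shows "\<exists>a. over s t i j g a"
proof -
  note i = frameD[OF assms(1)] and j = frameD[OF assms(2)]
  have "inverse_of C i \<Zsemi>\<^bsub>C\<^esub> g \<Zsemi>\<^bsub>C\<^esub> j \<in> hom_set C (P s) (P t)"
    using assms i j by (simp add: hom_set_def)
  then obtain a where "a \<in> hom_set D s t" "U a = inverse_of C i \<Zsemi>\<^bsub>C\<^esub> g \<Zsemi>\<^bsub>C\<^esub> j"
    using full_faithful i j unfolding fully_faithful_def bij_betw_def by (metis imageE)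
  then show ?thesis using assms i j
    by (intro exI[of _ a] overI[of X _ _ Y]) (simp_all add: hom_set_def)
qed

definition lift :: "'p \<Rightarrow> 'p \<Rightarrow> 'a \<Rightarrow> 'a \<Rightarrow> 'a \<Rightarrow> 'b" where
  "lift s t i j g = (THE a. over s t i j g a)"

lemma over_lift:
  assumes "frame X s i" "frame Y t j" "g \<in> Ar C" "dm C g = X" "cd C g = Y"
  shows "over s t i j g (lift s t i j g)"
  unfolding lift_def using over_exists[OF assms] over_eqI by (metis theI)

lemma over_self:
  assumes "a \<in> hom_set D s t"
  shows "over s t (idn C (P s)) (idn C (P t)) (U a) a"
  by (rule overI[OF frame_idn frame_idn]) (use hom_setD[OF assms] dom.hom_Ob[OF assms] in simp_all)

lemma over_idn: "frame X s i \<Longrightarrow> over s s i i (idn C X) (idn D s)"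
  by (rule overI) (use frameD[of X s i] in simp_all)

lemma over_comp:
  assumes "over s t i j g a" "over t u j k h b"
  shows "over s u i k (g \<Zsemi>\<^bsub>C\<^esub> h) (a \<Zsemi>\<^bsub>D\<^esub> b)"
proof -
  have gh: "cd C g = dm C h"
    by (rule trans[OF sym[OF frameD(4)[OF overD(2)[OF assms(1)]]] frameD(4)[OF overD(1)[OF assms(2)]]])
  note [simp] = overD(3-6)[OF assms(1)] overD(3-6)[OF assms(2)]
  note [simp] = frameD[OF overD(1)[OF assms(1)]] frameD[OF overD(2)[OF assms(1)]]
    frameD[OF overD(1)[OF assms(2)]] frameD[OF overD(2)[OF assms(2)]]
  have "i \<Zsemi>\<^bsub>C\<^esub> U (a \<Zsemi>\<^bsub>D\<^esub> b) = (i \<Zsemi>\<^bsub>C\<^esub> U a) \<Zsemi>\<^bsub>C\<^esub> U b" by simp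
  also have "\<dots> = g \<Zsemi>\<^bsub>C\<^esub> (j \<Zsemi>\<^bsub>C\<^esub> U b)" using gh by (simp add: overD(7)[OF assms(1)])
  also have "\<dots> = (g \<Zsemi>\<^bsub>C\<^esub> h) \<Zsemi>\<^bsub>C\<^esub> k" using gh by (simp add: overD(7)[OF assms(2)])
  finally show ?thesis
    using gh by (intro overI[OF overD(1)[OF assms(1)] overD(2)[OF assms(2)]]) simp_all
qed

lemma over_tens:
  assumes "over s t i j g a" "over s' t' i' j' g' a'"
  shows "over (s \<otimes>\<^bsub>D\<^esub> s') (t \<otimes>\<^bsub>D\<^esub> t') (tens_frame s i s' i') (tens_frame t j t' j')
    (g \<otimes>\<^sub>a\<^bsub>C\<^esub> g') (a \<otimes>\<^sub>a\<^bsub>D\<^esub> a')"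
proof -
  note [simp] = overD(3-6)[OF assms(1)] overD(3-6)[OF assms(2)]
  note [simp] = frameD[OF overD(1)[OF assms(1)]] frameD[OF overD(2)[OF assms(1)]]
    frameD[OF overD(1)[OF assms(2)]] frameD[OF overD(2)[OF assms(2)]]
  have "tens_frame s i s' i' \<Zsemi>\<^bsub>C\<^esub> U (a \<otimes>\<^sub>a\<^bsub>D\<^esub> a')
      = (i \<otimes>\<^sub>a\<^bsub>C\<^esub> i') \<Zsemi>\<^bsub>C\<^esub> (m s s' \<Zsemi>\<^bsub>C\<^esub> U (a \<otimes>\<^sub>a\<^bsub>D\<^esub> a'))" by (simp add: tens_frame_def)
  also have "\<dots> = ((i \<otimes>\<^sub>a\<^bsub>C\<^esub> i') \<Zsemi>\<^bsub>C\<^esub> (U a \<otimes>\<^sub>a\<^bsub>C\<^esub> U a')) \<Zsemi>\<^bsub>C\<^esub> m t t'"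
    by (subst m_natural[symmetric, of a s t a' s' t']) (simp_all add: hom_set_def)
  also have "\<dots> = ((g \<Zsemi>\<^bsub>C\<^esub> j) \<otimes>\<^sub>a\<^bsub>C\<^esub> (g' \<Zsemi>\<^bsub>C\<^esub> j')) \<Zsemi>\<^bsub>C\<^esub> m t t'"
    by (simp add: C.interchange overD(7)[OF assms(1)] overD(7)[OF assms(2)])
  also have "\<dots> = (g \<otimes>\<^sub>a\<^bsub>C\<^esub> g') \<Zsemi>\<^bsub>C\<^esub> tens_frame t j t' j'"
    unfolding tens_frame_def by (subst C.interchange[symmetric]) simp_all
  finally show ?thesis
    by (intro overI[OF frame_tens[OF overD(1)[OF assms(1)] overD(1)[OF assms(2)]]
          frame_tens[OF overD(2)[OF assms(1)] overD(2)[OF assms(2)]]]) simp_all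
qed

text \<open>
  The coherence condition \<open>m_assr\<close> is the case of identity frames. Naturality of the associator of \<open>C\<close>
  gives the general case; the same holds for the other structure maps.
\<close>

lemma over_assr:
  assumes "frame X s i" "frame Y t j" "frame Z u k"
  shows "over (s \<otimes>\<^bsub>D\<^esub> t \<otimes>\<^bsub>D\<^esub> u) (s \<otimes>\<^bsub>D\<^esub> (t \<otimes>\<^bsub>D\<^esub> u))
    (tens_frame (s \<otimes>\<^bsub>D\<^esub> t) (tens_frame s i t j) u k)
    (tens_frame s i (t \<otimes>\<^bsub>D\<^esub> u) (tens_frame t j u k)) (assr C X Y Z) (assr D s t u)"
proof -
  note [simp] = frameD[OF assms(1)] frameD[OF assms(2)] frameD[OF assms(3)]
  note [simp] = hom_setD[OF D_assr_hom[of s t u]]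
  have "tens_frame (s \<otimes>\<^bsub>D\<^esub> t) (tens_frame s i t j) u k \<Zsemi>\<^bsub>C\<^esub> U (assr D s t u)
      = ((((i \<otimes>\<^sub>a\<^bsub>C\<^esub> j) \<Zsemi>\<^bsub>C\<^esub> m s t) \<otimes>\<^sub>a\<^bsub>C\<^esub> (k \<Zsemi>\<^bsub>C\<^esub> idn C (P u))) \<Zsemi>\<^bsub>C\<^esub> m (s \<otimes>\<^bsub>D\<^esub> t) u) \<Zsemi>\<^bsub>C\<^esub> U (assr D s t u)"
    by (simp add: tens_frame_def)
  also have "\<dots> = ((i \<otimes>\<^sub>a\<^bsub>C\<^esub> j) \<otimes>\<^sub>a\<^bsub>C\<^esub> k) \<Zsemi>\<^bsub>C\<^esub>
      ((m s t \<otimes>\<^sub>a\<^bsub>C\<^esub> idn C (P u)) \<Zsemi>\<^bsub>C\<^esub> m (s \<otimes>\<^bsub>D\<^esub> t) u \<Zsemi>\<^bsub>C\<^esub> U (assr D s t u))"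
    by (subst C.interchange[symmetric]) simp_all
  also have "\<dots> = (((i \<otimes>\<^sub>a\<^bsub>C\<^esub> j) \<otimes>\<^sub>a\<^bsub>C\<^esub> k) \<Zsemi>\<^bsub>C\<^esub> assr C (P s) (P t) (P u)) \<Zsemi>\<^bsub>C\<^esub>
      ((idn C (P s) \<otimes>\<^sub>a\<^bsub>C\<^esub> m t u) \<Zsemi>\<^bsub>C\<^esub> m s (t \<otimes>\<^bsub>D\<^esub> u))"
    by (subst m_assr) simp_all
  also have "\<dots> = assr C X Y Z \<Zsemi>\<^bsub>C\<^esub> (((i \<otimes>\<^sub>a\<^bsub>C\<^esub> (j \<otimes>\<^sub>a\<^bsub>C\<^esub> k)) \<Zsemi>\<^bsub>C\<^esub>
      (idn C (P s) \<otimes>\<^sub>a\<^bsub>C\<^esub> m t u)) \<Zsemi>\<^bsub>C\<^esub> m s (t \<otimes>\<^bsub>D\<^esub> u))"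
    by (subst C.assr_nat) simp_all
  also have "\<dots> = assr C X Y Z \<Zsemi>\<^bsub>C\<^esub> tens_frame s i (t \<otimes>\<^bsub>D\<^esub> u) (tens_frame t j u k)"
    unfolding tens_frame_def by (subst C.interchange) simp_all
  finally show ?thesis
    by (intro overI[OF frame_tens[OF frame_tens[OF assms(1,2)] assms(3)]
          frame_tens[OF assms(1) frame_tens[OF assms(2,3)]]]) simp_all
qed

lemma over_lun:
  assumes "frame X s i"
  shows "over (\<one>\<^bsub>D\<^esub> \<otimes>\<^bsub>D\<^esub> s) s (tens_frame \<one>\<^bsub>D\<^esub> m0 s i) i (lun C X) (lun D s)"
proof -
  note [simp] = frameD[OF assms] hom_setD[OF D_lun_hom[of s]]
  have "tens_frame \<one>\<^bsub>D\<^esub> m0 s i \<Zsemi>\<^bsub>C\<^esub> U (lun D s)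
      = ((idn C \<one>\<^bsub>C\<^esub> \<Zsemi>\<^bsub>C\<^esub> m0) \<otimes>\<^sub>a\<^bsub>C\<^esub> (i \<Zsemi>\<^bsub>C\<^esub> idn C (P s))) \<Zsemi>\<^bsub>C\<^esub> m \<one>\<^bsub>D\<^esub> s \<Zsemi>\<^bsub>C\<^esub> U (lun D s)"
    by (simp add: tens_frame_def)
  also have "\<dots> = (idn C \<one>\<^bsub>C\<^esub> \<otimes>\<^sub>a\<^bsub>C\<^esub> i) \<Zsemi>\<^bsub>C\<^esub> ((m0 \<otimes>\<^sub>a\<^bsub>C\<^esub> idn C (P s)) \<Zsemi>\<^bsub>C\<^esub> m \<one>\<^bsub>D\<^esub> s \<Zsemi>\<^bsub>C\<^esub> U (lun D s))"
    by (subst C.interchange[symmetric]) simp_all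
  also have "\<dots> = lun C X \<Zsemi>\<^bsub>C\<^esub> i"
    by (subst m_lun) (simp_all add: C.lun_nat)
  finally show ?thesis by (intro overI[OF frame_tens[OF frame_unit assms] assms]) simp_all
qed

lemma over_run:
  assumes "frame X s i"
  shows "over (s \<otimes>\<^bsub>D\<^esub> \<one>\<^bsub>D\<^esub>) s (tens_frame s i \<one>\<^bsub>D\<^esub> m0) i (run C X) (run D s)"
proof -
  note [simp] = frameD[OF assms] hom_setD[OF D_run_hom[of s]]
  have "tens_frame s i \<one>\<^bsub>D\<^esub> m0 \<Zsemi>\<^bsub>C\<^esub> U (run D s)
      = ((i \<Zsemi>\<^bsub>C\<^esub> idn C (P s)) \<otimes>\<^sub>a\<^bsub>C\<^esub> (idn C \<one>\<^bsub>C\<^esub> \<Zsemi>\<^bsub>C\<^esub> m0)) \<Zsemi>\<^bsub>C\<^esub> m s \<one>\<^bsub>D\<^esub> \<Zsemi>\<^bsub>C\<^esub> U (run D s)"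
    by (simp add: tens_frame_def)
  also have "\<dots> = (i \<otimes>\<^sub>a\<^bsub>C\<^esub> idn C \<one>\<^bsub>C\<^esub>) \<Zsemi>\<^bsub>C\<^esub> ((idn C (P s) \<otimes>\<^sub>a\<^bsub>C\<^esub> m0) \<Zsemi>\<^bsub>C\<^esub> m s \<one>\<^bsub>D\<^esub> \<Zsemi>\<^bsub>C\<^esub> U (run D s))"
    by (subst C.interchange[symmetric]) simp_all
  also have "\<dots> = run C X \<Zsemi>\<^bsub>C\<^esub> i"
    by (subst m_run) (simp_all add: C.run_nat)
  finally show ?thesis by (intro overI[OF frame_tens[OF assms frame_unit] assms]) simp_all
qed

lemma over_braid:
  assumes "frame X s i" "frame Y t j"
  shows "over (s \<otimes>\<^bsub>D\<^esub> t) (t \<otimes>\<^bsub>D\<^esub> s) (tens_frame s i t j) (tens_frame t j s i)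
    (braid C X Y) (braid D s t)"
proof -
  note [simp] = frameD[OF assms(1)] frameD[OF assms(2)] hom_setD[OF D_braid_hom[of s t]]
  have "tens_frame s i t j \<Zsemi>\<^bsub>C\<^esub> U (braid D s t) = (i \<otimes>\<^sub>a\<^bsub>C\<^esub> j) \<Zsemi>\<^bsub>C\<^esub> (m s t \<Zsemi>\<^bsub>C\<^esub> U (braid D s t))"
    by (simp add: tens_frame_def)
  also have "\<dots> = ((i \<otimes>\<^sub>a\<^bsub>C\<^esub> j) \<Zsemi>\<^bsub>C\<^esub> braid C (P s) (P t)) \<Zsemi>\<^bsub>C\<^esub> m t s"
    by (subst m_braid) simp_all
  also have "\<dots> = braid C X Y \<Zsemi>\<^bsub>C\<^esub> tens_frame t j s i"
    by (subst C.braid_nat) (simp_all add: tens_frame_def)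
  finally show ?thesis by (intro overI[OF frame_tens[OF assms] frame_tens[OF assms(2,1)]]) simp_all
qed

text \<open>
  A fully faithful functor reflects isomorphisms.
\<close>

lemma over_inverse:
  assumes "over s t i j g a" "is_iso C g"
  shows "is_iso D a" "over t s j i (inverse_of C g) (inverse_of D a)"
proof -
  note a = overD[OF assms(1)]
  obtain b where b: "over t s j i (inverse_of C g) b"
    using over_exists[OF a(2,1), of "inverse_of C g"] assms(2) a by auto
  have "inverse_arrows D a b"
    unfolding inverse_arrows_def
  proof (intro conjI)
    show "b \<in> hom_set D (cd D a) (dm D a)" using a overD[OF b] by (simp add: hom_set_def)
    show "a \<Zsemi>\<^bsub>D\<^esub> b = idn D (dm D a)"
      by (rule over_eqI[OF over_comp[OF assms(1) b] ]) (use over_idn[OF a(1)] a assms(2) in simp_all)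
    show "b \<Zsemi>\<^bsub>D\<^esub> a = idn D (cd D a)"
      by (rule over_eqI[OF over_comp[OF b assms(1)]]) (use over_idn[OF a(2)] a assms(2) in simp_all)
  qed (rule a)
  then show "is_iso D a" "over t s j i (inverse_of C g) (inverse_of D a)"
    using b dom.inverse_of_eq unfolding is_iso_def by blast+
qed

text \<open>
  A part of the codomain frame can be moved into the lower arrow. This is needed to compare arrows whose
  frames arise in different ways.
\<close>

lemma over_reframe:
  assumes "over s t i (h \<Zsemi>\<^bsub>C\<^esub> j) g a" "is_iso C h" "frame Y t j" "cd C h = Y" "cd C g = dm C h"
  shows "over s t i j (g \<Zsemi>\<^bsub>C\<^esub> h) a"
  using overD[OF assms(1)] assms(2-) frameD[OF assms(3)] frameD[OF overD(1)[OF assms(1)]]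
  by (intro overI[of _ s i Y]) simp_all

text \<open>
  The middle swap is a formal composite of structure maps, so this is an instance of the closure rules
  and contains the statement that \<open>(U, m)\<close> preserves it.
\<close>

lemma over_mid_swap:
  assumes "frame X s i" "frame Y t j" "frame Z u k" "frame W v l"
  shows "over (s \<otimes>\<^bsub>D\<^esub> t \<otimes>\<^bsub>D\<^esub> (u \<otimes>\<^bsub>D\<^esub> v)) (s \<otimes>\<^bsub>D\<^esub> u \<otimes>\<^bsub>D\<^esub> (t \<otimes>\<^bsub>D\<^esub> v))
    (tens_frame (s \<otimes>\<^bsub>D\<^esub> t) (tens_frame s i t j) (u \<otimes>\<^bsub>D\<^esub> v) (tens_frame u k v l))
    (tens_frame (s \<otimes>\<^bsub>D\<^esub> u) (tens_frame s i u k) (t \<otimes>\<^bsub>D\<^esub> v) (tens_frame t j v l))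
    (mid_swap C X Y Z W) (mid_swap D s t u v)"
  unfolding mid_swap_def
  by (rule over_comp over_tens over_assr over_braid over_idn over_inverse(2) frame_tens assms
      | (simp add: frameD[OF assms(1)] frameD[OF assms(2)] frameD[OF assms(3)] frameD[OF assms(4)]; fail))+

text \<open>
  For each axiom, the two sides in \<open>D\<close> lie over the two sides of the same axiom in \<open>C\<close>.
\<close>

theorem symmetric_monoidal: "symmetric_monoidal_category D"
proof (intro symmetric_monoidal_category.intro monoidal_category.intro cat_functor.intro
    cat_functor_axioms.intro category_prod_cat monoidal_category_axioms.intro
    symmetric_monoidal_category_axioms.intro)
  show "category D" "category D" "category D" "category D" by unfold_locales
  fix s t u v
  assume s: "s \<in> Ob D"
  note fs = frame_idn[OF s] and [simp] = s
  show "is_iso D (lun D s)" by (rule over_inverse(1)[OF over_lun[OF fs]]) simp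
  show "is_iso D (run D s)" by (rule over_inverse(1)[OF over_run[OF fs]]) simp
  assume t: "t \<in> Ob D"
  note ft = frame_idn[OF t] and [simp] = t
  show "assr D s \<one>\<^bsub>D\<^esub> t \<Zsemi>\<^bsub>D\<^esub> (idn D s \<otimes>\<^sub>a\<^bsub>D\<^esub> lun D t) = run D s \<otimes>\<^sub>a\<^bsub>D\<^esub> idn D t"
    by (rule over_eqI, (rule over_comp over_tens over_assr over_lun over_run over_idn frame_unit fs ft)+)
      (rule C.triangle, simp_all)
  show "braid D s t \<Zsemi>\<^bsub>D\<^esub> braid D t s = idn D (s \<otimes>\<^bsub>D\<^esub> t)"
    by (rule over_eqI, (rule over_comp over_braid over_idn frame_tens fs ft)+)
      (rule C.braid_braid, simp_all)
  assume u: "u \<in> Ob D"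
  note fu = frame_idn[OF u] and [simp] = u
  show "is_iso D (assr D s t u)" by (rule over_inverse(1)[OF over_assr[OF fs ft fu]]) simp
  show "assr D s t u \<Zsemi>\<^bsub>D\<^esub> braid D s (t \<otimes>\<^bsub>D\<^esub> u) \<Zsemi>\<^bsub>D\<^esub> assr D t u s
      = (braid D s t \<otimes>\<^sub>a\<^bsub>D\<^esub> idn D u) \<Zsemi>\<^bsub>D\<^esub> assr D t s u \<Zsemi>\<^bsub>D\<^esub> (idn D t \<otimes>\<^sub>a\<^bsub>D\<^esub> braid D s u)"
    by (rule over_eqI, (rule over_comp over_tens over_assr over_braid over_idn frame_tens fs ft fu)+)
      (rule C.hexagon, simp_all)
  assume v: "v \<in> Ob D"
  note fv = frame_idn[OF v] and [simp] = v
  show "assr D (s \<otimes>\<^bsub>D\<^esub> t) u v \<Zsemi>\<^bsub>D\<^esub> assr D s t (u \<otimes>\<^bsub>D\<^esub> v)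
      = (assr D s t u \<otimes>\<^sub>a\<^bsub>D\<^esub> idn D v) \<Zsemi>\<^bsub>D\<^esub> assr D s (t \<otimes>\<^bsub>D\<^esub> u) v \<Zsemi>\<^bsub>D\<^esub> (idn D s \<otimes>\<^sub>a\<^bsub>D\<^esub> assr D t u v)"
    by (rule over_eqI, (rule over_comp over_tens over_assr over_idn frame_tens fs ft fu fv)+)
      (rule C.pentagon, simp_all)
next
  fix st :: "'p \<times> 'p" assume "st \<in> Ob (prod_cat D D)"
  then obtain s t where st: "st = (s, t)" "s \<in> Ob D" "t \<in> Ob D" by (auto simp: prod_cat_def)
  show "(case st of (s, t) \<Rightarrow> s \<otimes>\<^bsub>D\<^esub> t) \<in> Ob D" using st by simp
  note fs = frame_idn[OF st(2)] and ft = frame_idn[OF st(3)]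
  have "idn D s \<otimes>\<^sub>a\<^bsub>D\<^esub> idn D t = idn D (s \<otimes>\<^bsub>D\<^esub> t)"
    by (rule over_eqI, (rule over_tens over_idn frame_tens fs ft)+) (simp add: st)
  then show "(case idn (prod_cat D D) st of (f, g) \<Rightarrow> f \<otimes>\<^sub>a\<^bsub>D\<^esub> g) = idn D (case st of (s, t) \<Rightarrow> s \<otimes>\<^bsub>D\<^esub> t)"
    by (simp add: st prod_cat_def)
next
  fix ab st st' assume ab: "ab \<in> hom_set (prod_cat D D) st st'"
  obtain a b s t s' t' where [simp]: "ab = (a, b)" "st = (s, t)" "st' = (s', t')"
    by (cases ab, cases st, cases st')
  show "(case ab of (f, g) \<Rightarrow> f \<otimes>\<^sub>a\<^bsub>D\<^esub> g)
      \<in> hom_set D (case st of (s, t) \<Rightarrow> s \<otimes>\<^bsub>D\<^esub> t) (case st' of (s, t) \<Rightarrow> s \<otimes>\<^bsub>D\<^esub> t)"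
    using ab by (simp add: hom_set_prod_cat D_tens_hom)
  fix ab' st'' assume ab': "ab' \<in> hom_set (prod_cat D D) st' st''"
  obtain a' b' s'' t'' where [simp]: "ab' = (a', b')" "st'' = (s'', t'')"
    by (cases ab', cases st'')
  have a: "a \<in> hom_set D s s'" and b: "b \<in> hom_set D t t'"
    and a': "a' \<in> hom_set D s' s''" and b': "b' \<in> hom_set D t' t''"
    using ab ab' by (simp_all add: hom_set_prod_cat)
  have "(a \<Zsemi>\<^bsub>D\<^esub> a') \<otimes>\<^sub>a\<^bsub>D\<^esub> (b \<Zsemi>\<^bsub>D\<^esub> b') = (a \<otimes>\<^sub>a\<^bsub>D\<^esub> b) \<Zsemi>\<^bsub>D\<^esub> (a' \<otimes>\<^sub>a\<^bsub>D\<^esub> b')"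
    by (rule over_eqI,
        (rule over_comp over_tens over_self[OF a] over_self[OF b] over_self[OF a'] over_self[OF b'])+)
      (simp add: C.interchange hom_setD[OF a] hom_setD[OF b] hom_setD[OF a'] hom_setD[OF b'])
  then show "(case ab \<Zsemi>\<^bsub>prod_cat D D\<^esub> ab' of (f, g) \<Rightarrow> f \<otimes>\<^sub>a\<^bsub>D\<^esub> g)
      = (case ab of (f, g) \<Rightarrow> f \<otimes>\<^sub>a\<^bsub>D\<^esub> g) \<Zsemi>\<^bsub>D\<^esub> (case ab' of (f, g) \<Rightarrow> f \<otimes>\<^sub>a\<^bsub>D\<^esub> g)"
    by (simp add: prod_cat_def)
next
  fix a s s' assume a: "a \<in> hom_set D s s'"
  note sa = over_self[OF a] and fs = frame_idn[OF dom.hom_Ob(1)[OF a]] frame_idn[OF dom.hom_Ob(2)[OF a]]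
  note [simp] = hom_setD[OF a] hom_setD[OF FA_hom[OF a]] dom.hom_Ob[OF a]
  show "(idn D \<one>\<^bsub>D\<^esub> \<otimes>\<^sub>a\<^bsub>D\<^esub> a) \<Zsemi>\<^bsub>D\<^esub> lun D s' = lun D s \<Zsemi>\<^bsub>D\<^esub> a"
    by (rule over_eqI, (rule over_comp over_tens over_lun over_idn frame_unit sa fs)+)
      (rule C.lun_natural, rule FA_hom[OF a])
  show "(a \<otimes>\<^sub>a\<^bsub>D\<^esub> idn D \<one>\<^bsub>D\<^esub>) \<Zsemi>\<^bsub>D\<^esub> run D s' = run D s \<Zsemi>\<^bsub>D\<^esub> a"
    by (rule over_eqI, (rule over_comp over_tens over_run over_idn frame_unit sa fs)+)
      (rule C.run_natural, rule FA_hom[OF a])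
  fix b t t' assume b: "b \<in> hom_set D t t'"
  note sb = over_self[OF b] and ft = frame_idn[OF dom.hom_Ob(1)[OF b]] frame_idn[OF dom.hom_Ob(2)[OF b]]
  show "(a \<otimes>\<^sub>a\<^bsub>D\<^esub> b) \<Zsemi>\<^bsub>D\<^esub> braid D s' t' = braid D s t \<Zsemi>\<^bsub>D\<^esub> (b \<otimes>\<^sub>a\<^bsub>D\<^esub> a)"
    by (rule over_eqI, (rule over_comp over_tens over_braid sa sb fs ft)+)
      (rule C.braid_natural FA_hom a b)+
  fix c u u' assume c: "c \<in> hom_set D u u'"
  note sc = over_self[OF c] and fu = frame_idn[OF dom.hom_Ob(1)[OF c]] frame_idn[OF dom.hom_Ob(2)[OF c]]
  show "((a \<otimes>\<^sub>a\<^bsub>D\<^esub> b) \<otimes>\<^sub>a\<^bsub>D\<^esub> c) \<Zsemi>\<^bsub>D\<^esub> assr D s' t' u' = assr D s t u \<Zsemi>\<^bsub>D\<^esub> (a \<otimes>\<^sub>a\<^bsub>D\<^esub> (b \<otimes>\<^sub>a\<^bsub>D\<^esub> c))"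
    by (rule over_eqI, (rule over_comp over_tens over_assr sa sb sc fs ft fu)+)
      (rule C.assr_natural FA_hom a b c)+
qed (simp_all add: D_assr_hom D_lun_hom D_run_hom D_braid_hom)

end

context monoidal_comparison
begin

section \<open>Frobenius structures and equivalences of hypergraph categories\<close>

text \<open>
  The frame \<open>i\<close> identifies a Frobenius structure on \<open>X\<close> with one on \<open>s\<close>.
\<close>

definition frobenius_over ::
  "'o \<Rightarrow> 'p \<Rightarrow> 'a \<Rightarrow> 'a \<Rightarrow> 'a \<Rightarrow> 'a \<Rightarrow> 'a \<Rightarrow> 'b \<Rightarrow> 'b \<Rightarrow> 'b \<Rightarrow> 'b \<Rightarrow> bool" where
  "frobenius_over X s i \<mu> \<eta> \<delta> \<epsilon> \<mu>' \<eta>' \<delta>' \<epsilon>' \<longleftrightarrow> frame X s i \<and>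
     over (s \<otimes>\<^bsub>D\<^esub> s) s (tens_frame s i s i) i \<mu> \<mu>' \<and>
     over \<one>\<^bsub>D\<^esub> s m0 i \<eta> \<eta>' \<and>
     over s (s \<otimes>\<^bsub>D\<^esub> s) i (tens_frame s i s i) \<delta> \<delta>' \<and>
     over s \<one>\<^bsub>D\<^esub> i m0 \<epsilon> \<epsilon>'"

lemma frobenius_overD:
  assumes "frobenius_over X s i \<mu> \<eta> \<delta> \<epsilon> \<mu>' \<eta>' \<delta>' \<epsilon>'"
  shows "frame X s i"
    "over (s \<otimes>\<^bsub>D\<^esub> s) s (tens_frame s i s i) i \<mu> \<mu>'"
    "over \<one>\<^bsub>D\<^esub> s m0 i \<eta> \<eta>'"
    "over s (s \<otimes>\<^bsub>D\<^esub> s) i (tens_frame s i s i) \<delta> \<delta>'"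
    "over s \<one>\<^bsub>D\<^esub> i m0 \<epsilon> \<epsilon>'"
  using assms by (simp_all add: frobenius_over_def)

lemma frobenius_over_Ar:
  assumes "frobenius_over X s i \<mu> \<eta> \<delta> \<epsilon> \<mu>' \<eta>' \<delta>' \<epsilon>'"
  shows "\<mu>' \<in> Ar D" "dm D \<mu>' = s \<otimes>\<^bsub>D\<^esub> s" "cd D \<mu>' = s"
    "\<eta>' \<in> Ar D" "dm D \<eta>' = \<one>\<^bsub>D\<^esub>" "cd D \<eta>' = s"
    "\<delta>' \<in> Ar D" "dm D \<delta>' = s" "cd D \<delta>' = s \<otimes>\<^bsub>D\<^esub> s"
    "\<epsilon>' \<in> Ar D" "dm D \<epsilon>' = s" "cd D \<epsilon>' = \<one>\<^bsub>D\<^esub>"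
  using assms by (auto simp: frobenius_over_def over_def hom_set_def)

text \<open>
  The Frobenius axioms are equations between formal composites, hence subject to the transfer principle.
\<close>

lemma frobenius_reflect:
  assumes over: "frobenius_over X s i \<mu> \<eta> \<delta> \<epsilon> \<mu>' \<eta>' \<delta>' \<epsilon>'"
    and F: "frobenius_structure C X \<mu> \<eta> \<delta> \<epsilon>"
  shows "frobenius_structure D s \<mu>' \<eta>' \<delta>' \<epsilon>'"
proof -
  note X = frobenius_overD(1)[OF over] and mu = frobenius_overD(2)[OF over]
    and eta = frobenius_overD(3)[OF over] and delta = frobenius_overD(4)[OF over]
    and eps = frobenius_overD(5)[OF over]
  note [simp] = frameD[OF X]
  note F' = F[unfolded frobenius_structure_def commutative_monoid_def cocommutative_comonoid_def]
  have inv: "over (s \<otimes>\<^bsub>D\<^esub> (s \<otimes>\<^bsub>D\<^esub> s)) (s \<otimes>\<^bsub>D\<^esub> s \<otimes>\<^bsub>D\<^esub> s)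
      (tens_frame s i (s \<otimes>\<^bsub>D\<^esub> s) (tens_frame s i s i))
      (tens_frame (s \<otimes>\<^bsub>D\<^esub> s) (tens_frame s i s i) s i)
      (inverse_of C (assr C X X X)) (inverse_of D (assr D s s s))"
    by (rule over_inverse(2)[OF over_assr[OF X X X]]) simp
  have "\<mu>' \<in> hom_set D (s \<otimes>\<^bsub>D\<^esub> s) s" "\<eta>' \<in> hom_set D \<one>\<^bsub>D\<^esub> s"
    "\<delta>' \<in> hom_set D s (s \<otimes>\<^bsub>D\<^esub> s)" "\<epsilon>' \<in> hom_set D s \<one>\<^bsub>D\<^esub>"
    using mu eta delta eps by (simp_all add: over_def)
  moreover have "(\<mu>' \<otimes>\<^sub>a\<^bsub>D\<^esub> idn D s) \<Zsemi>\<^bsub>D\<^esub> \<mu>' = assr D s s s \<Zsemi>\<^bsub>D\<^esub> (idn D s \<otimes>\<^sub>a\<^bsub>D\<^esub> \<mu>') \<Zsemi>\<^bsub>D\<^esub> \<mu>'"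
    by (rule over_eqI, (rule over_comp over_tens mu over_assr over_idn X)+) (use F' in blast)
  moreover have "(\<eta>' \<otimes>\<^sub>a\<^bsub>D\<^esub> idn D s) \<Zsemi>\<^bsub>D\<^esub> \<mu>' = lun D s"
    by (rule over_eqI, (rule over_comp over_tens mu eta over_lun over_idn X)+) (use F' in blast)
  moreover have "(idn D s \<otimes>\<^sub>a\<^bsub>D\<^esub> \<eta>') \<Zsemi>\<^bsub>D\<^esub> \<mu>' = run D s"
    by (rule over_eqI, (rule over_comp over_tens mu eta over_run over_idn X)+) (use F' in blast)
  moreover have "braid D s s \<Zsemi>\<^bsub>D\<^esub> \<mu>' = \<mu>'"
    by (rule over_eqI, (rule over_comp mu over_braid X)+) (use F' in blast)
  moreover have "\<delta>' \<Zsemi>\<^bsub>D\<^esub> (\<delta>' \<otimes>\<^sub>a\<^bsub>D\<^esub> idn D s) \<Zsemi>\<^bsub>D\<^esub> assr D s s s = \<delta>' \<Zsemi>\<^bsub>D\<^esub> (idn D s \<otimes>\<^sub>a\<^bsub>D\<^esub> \<delta>')"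
    by (rule over_eqI, (rule over_comp over_tens delta over_assr over_idn X)+) (use F' in blast)
  moreover have "\<delta>' \<Zsemi>\<^bsub>D\<^esub> (\<epsilon>' \<otimes>\<^sub>a\<^bsub>D\<^esub> idn D s) \<Zsemi>\<^bsub>D\<^esub> lun D s = idn D s"
    by (rule over_eqI, (rule over_comp over_tens delta eps over_lun over_idn X)+) (use F' in blast)
  moreover have "\<delta>' \<Zsemi>\<^bsub>D\<^esub> (idn D s \<otimes>\<^sub>a\<^bsub>D\<^esub> \<epsilon>') \<Zsemi>\<^bsub>D\<^esub> run D s = idn D s"
    by (rule over_eqI, (rule over_comp over_tens delta eps over_run over_idn X)+) (use F' in blast)
  moreover have "\<delta>' \<Zsemi>\<^bsub>D\<^esub> braid D s s = \<delta>'"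
    by (rule over_eqI, (rule over_comp delta over_braid X)+) (use F' in blast)
  moreover have "(\<delta>' \<otimes>\<^sub>a\<^bsub>D\<^esub> idn D s) \<Zsemi>\<^bsub>D\<^esub> assr D s s s \<Zsemi>\<^bsub>D\<^esub> (idn D s \<otimes>\<^sub>a\<^bsub>D\<^esub> \<mu>') = \<mu>' \<Zsemi>\<^bsub>D\<^esub> \<delta>'"
    by (rule over_eqI, (rule over_comp over_tens mu delta over_assr over_idn X)+) (use F' in blast)
  moreover have "(idn D s \<otimes>\<^sub>a\<^bsub>D\<^esub> \<delta>') \<Zsemi>\<^bsub>D\<^esub> inverse_of D (assr D s s s) \<Zsemi>\<^bsub>D\<^esub> (\<mu>' \<otimes>\<^sub>a\<^bsub>D\<^esub> idn D s) = \<mu>' \<Zsemi>\<^bsub>D\<^esub> \<delta>'"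
    by (rule over_eqI, (rule over_comp over_tens mu delta inv over_idn X)+) (use F' in blast)
  moreover have "\<delta>' \<Zsemi>\<^bsub>D\<^esub> \<mu>' = idn D s"
    by (rule over_eqI, (rule over_comp mu delta over_idn X)+) (use F' in blast)
  ultimately show ?thesis
    unfolding frobenius_structure_def commutative_monoid_def cocommutative_comonoid_def by blast
qed

end

text \<open>
  The frames \<open>r\<close> say that \<open>P\<close> is essentially surjective. A hypergraph category may carry different
  Frobenius structures on isomorphic objects, so compatibility with the frames \<open>r\<close> is a condition
  separate from compatibility with identity frames: the latter makes \<open>down\<close> a hypergraph functor, the
  former its pseudo-inverse \<open>up\<close>.
\<close>

locale hypergraph_comparison =
  monoidal_comparison D C P U m m0 + C: hypergraph_category C + D: hypergraph_category D
  for D :: "('p, 'b) hypergraph_data" and C :: "('o, 'a) hypergraph_data"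
    and P :: "'p \<Rightarrow> 'o" and U :: "'b \<Rightarrow> 'a" and m m0 +
  fixes J :: "'o \<Rightarrow> 'p" and r :: "'o \<Rightarrow> 'a"
  assumes frobenius_over_idn: "s \<in> Ob D \<Longrightarrow> frobenius_over (P s) s (idn C (P s))
      (mu C (P s)) (eta C (P s)) (delta C (P s)) (eps C (P s)) (mu D s) (eta D s) (delta D s) (eps D s)"
    and frobenius_over_J: "x \<in> Ob C \<Longrightarrow> frobenius_over x (J x) (r x)
      (mu C x) (eta C x) (delta C x) (eps C x) (mu D (J x)) (eta D (J x)) (delta D (J x)) (eps D (J x))"
begin

lemmas over_idn_frame = frobenius_overD[OF frobenius_over_idn]
  and over_J_frame = frobenius_overD[OF frobenius_over_J]

lemmas frame_J = over_J_frame(1)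

lemma r_Ar [simp]:
  assumes "x \<in> Ob C"
  shows "J x \<in> Ob D" "r x \<in> Ar C" "is_iso C (r x)" "dm C (r x) = x" "cd C (r x) = P (J x)"
  using frameD[OF frame_J[OF assms]] by auto

definition down :: "('p, 'b, 'o, 'a) monoidal_functor_data" where
  "down =
    \<lparr> on_ob = restrict P (Ob D),
      on_ar = restrict U (Ar D),
      phi = (\<lambda>s t. if s \<in> Ob D \<and> t \<in> Ob D then m s t else undefined),
      phi_unit = m0 \<rparr>"

lemma down_simps [simp]:
  "s \<in> Ob D \<Longrightarrow> on_ob down s = P s" "a \<in> Ar D \<Longrightarrow> on_ar down a = U a"
  "\<lbrakk>s \<in> Ob D; t \<in> Ob D\<rbrakk> \<Longrightarrow> phi down s t = m s t" "phi_unit down = m0"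
  by (simp_all add: down_def)

lemma inverse_of_shift:
  assumes "f = g \<Zsemi>\<^bsub>C\<^esub> h" "is_iso C h" "g \<in> Ar C" "cd C g = dm C h"
  shows "g = f \<Zsemi>\<^bsub>C\<^esub> inverse_of C h"
  using assms by simp

theorem hypergraph_functor_down: "hypergraph_functor D C down"
proof (intro hypergraph_functor.intro hypergraph_functor_axioms.intro
    strong_symmetric_monoidal_functor.intro strong_symmetric_monoidal_functor_axioms.intro
    cat_functor.intro cat_functor_axioms.intro)
  show "hypergraph_category D" "hypergraph_category C" "symmetric_monoidal_category D"
    "symmetric_monoidal_category C" "category D" "category C" by unfold_locales
  show "on_ob down \<in> extensional (Ob D)" "on_ar down \<in> extensional (Ar D)"
    by (simp_all add: down_def)
  show "phi down s t = undefined" if "\<not> (s \<in> Ob D \<and> t \<in> Ob D)" for s t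
    using that by (auto simp: down_def)
  show "on_ar down a \<in> hom_set C (on_ob down s) (on_ob down t)" if "a \<in> hom_set D s t" for a s t
    using that dom.hom_Ob[OF that] by (simp add: hom_set_def)
  show "on_ar down (a \<Zsemi>\<^bsub>D\<^esub> b) = on_ar down a \<Zsemi>\<^bsub>C\<^esub> on_ar down b"
    if "a \<in> hom_set D s t" "b \<in> hom_set D t u" for a b s t u
    using that by (simp add: hom_set_def)
  show "(on_ar down a \<otimes>\<^sub>a\<^bsub>C\<^esub> on_ar down b) \<Zsemi>\<^bsub>C\<^esub> phi down s' t'
      = phi down s t \<Zsemi>\<^bsub>C\<^esub> on_ar down (a \<otimes>\<^sub>a\<^bsub>D\<^esub> b)"
    if "a \<in> hom_set D s s'" "b \<in> hom_set D t t'" for a b s s' t t'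
    using m_natural[OF that] dom.hom_Ob[OF that(1)] dom.hom_Ob[OF that(2)]
      hom_setD[OF that(1)] hom_setD[OF that(2)] by simp
  fix s assume s [simp]: "s \<in> Ob D"
  show "mu C (on_ob down s) = phi down s s \<Zsemi>\<^bsub>C\<^esub> on_ar down (mu D s)"
    using overD(7)[OF over_idn_frame(2)[OF s]] by (simp add: tens_frame_def)
  show "eta C (on_ob down s) = phi_unit down \<Zsemi>\<^bsub>C\<^esub> on_ar down (eta D s)"
    using overD(7)[OF over_idn_frame(3)[OF s]] by simp
  show "delta C (on_ob down s) = on_ar down (delta D s) \<Zsemi>\<^bsub>C\<^esub> inverse_of C (phi down s s)"
    using overD(7)[OF over_idn_frame(4)[OF s]] inverse_of_shift[of "U (delta D s)" "delta C (P s)" "m s s"]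
    by (simp add: tens_frame_def)
  show "eps C (on_ob down s) = on_ar down (eps D s) \<Zsemi>\<^bsub>C\<^esub> inverse_of C (phi_unit down)"
    using overD(7)[OF over_idn_frame(5)[OF s]] inverse_of_shift[of "U (eps D s)" "eps C (P s)" m0] by simp
  show "(phi_unit down \<otimes>\<^sub>a\<^bsub>C\<^esub> idn C (on_ob down s)) \<Zsemi>\<^bsub>C\<^esub> phi down \<one>\<^bsub>D\<^esub> s \<Zsemi>\<^bsub>C\<^esub> on_ar down (lun D s)
      = lun C (on_ob down s)"
    using m_lun[OF s] by simp
  show "(idn C (on_ob down s) \<otimes>\<^sub>a\<^bsub>C\<^esub> phi_unit down) \<Zsemi>\<^bsub>C\<^esub> phi down s \<one>\<^bsub>D\<^esub> \<Zsemi>\<^bsub>C\<^esub> on_ar down (run D s)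
      = run C (on_ob down s)"
    using m_run[OF s] by simp
  fix t u assume t [simp]: "t \<in> Ob D" and u [simp]: "u \<in> Ob D"
  show "(phi down s t \<otimes>\<^sub>a\<^bsub>C\<^esub> idn C (on_ob down u)) \<Zsemi>\<^bsub>C\<^esub> phi down (s \<otimes>\<^bsub>D\<^esub> t) u \<Zsemi>\<^bsub>C\<^esub> on_ar down (assr D s t u)
      = assr C (on_ob down s) (on_ob down t) (on_ob down u)
        \<Zsemi>\<^bsub>C\<^esub> (idn C (on_ob down s) \<otimes>\<^sub>a\<^bsub>C\<^esub> phi down t u) \<Zsemi>\<^bsub>C\<^esub> phi down s (t \<otimes>\<^bsub>D\<^esub> u)"
    using m_assr[OF s t u] by simp
qed (simp_all add: m_hom m0_hom m_braid)

text \<open>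
  The pseudo-inverse of \<open>down\<close>. Its values on arrows and its comparison maps are the arrows lying over
  the given arrow and over identities, with respect to the frames \<open>r\<close>.
\<close>

definition up :: "('o, 'a, 'p, 'b) monoidal_functor_data" where
  "up =
    \<lparr> on_ob = restrict J (Ob C),
      on_ar = restrict (\<lambda>f. lift (J (dm C f)) (J (cd C f)) (r (dm C f)) (r (cd C f)) f) (Ar C),
      phi = (\<lambda>x y. if x \<in> Ob C \<and> y \<in> Ob C
               then lift (J x \<otimes>\<^bsub>D\<^esub> J y) (J (x \<otimes>\<^bsub>C\<^esub> y)) (tens_frame (J x) (r x) (J y) (r y))
                 (r (x \<otimes>\<^bsub>C\<^esub> y)) (idn C (x \<otimes>\<^bsub>C\<^esub> y))
               else undefined),
      phi_unit = lift \<one>\<^bsub>D\<^esub> (J \<one>\<^bsub>C\<^esub>) m0 (r \<one>\<^bsub>C\<^esub>) (idn C \<one>\<^bsub>C\<^esub>) \<rparr>"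

lemma on_ob_up [simp]: "x \<in> Ob C \<Longrightarrow> on_ob up x = J x"
  by (simp add: up_def)

lemma over_up:
  assumes "f \<in> hom_set C x y"
  shows "over (J x) (J y) (r x) (r y) f (on_ar up f)"
  using hom_setD[OF assms] C.hom_Ob[OF assms] over_lift[OF frame_J frame_J, of x y f]
  by (simp add: up_def)

lemma over_up_phi:
  assumes "x \<in> Ob C" "y \<in> Ob C"
  shows "over (J x \<otimes>\<^bsub>D\<^esub> J y) (J (x \<otimes>\<^bsub>C\<^esub> y)) (tens_frame (J x) (r x) (J y) (r y)) (r (x \<otimes>\<^bsub>C\<^esub> y))
    (idn C (x \<otimes>\<^bsub>C\<^esub> y)) (phi up x y)"
  using assms over_lift[OF frame_tens[OF frame_J frame_J] frame_J, of x y "x \<otimes>\<^bsub>C\<^esub> y" "idn C (x \<otimes>\<^bsub>C\<^esub> y)"]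
  by (simp add: up_def)

lemma over_up_phi_unit: "over \<one>\<^bsub>D\<^esub> (J \<one>\<^bsub>C\<^esub>) m0 (r \<one>\<^bsub>C\<^esub>) (idn C \<one>\<^bsub>C\<^esub>) (phi_unit up)"
  using over_lift[OF frame_unit frame_J, of "\<one>\<^bsub>C\<^esub>" "idn C \<one>\<^bsub>C\<^esub>"] by (simp add: up_def)

lemma hom_C_intros:
  assumes "x \<in> Ob C"
  shows "lun C x \<in> hom_set C (\<one>\<^bsub>C\<^esub> \<otimes>\<^bsub>C\<^esub> x) x" "run C x \<in> hom_set C (x \<otimes>\<^bsub>C\<^esub> \<one>\<^bsub>C\<^esub>) x"
    "mu C x \<in> hom_set C (x \<otimes>\<^bsub>C\<^esub> x) x" "eta C x \<in> hom_set C \<one>\<^bsub>C\<^esub> x"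
    "delta C x \<in> hom_set C x (x \<otimes>\<^bsub>C\<^esub> x)" "eps C x \<in> hom_set C x \<one>\<^bsub>C\<^esub>"
    "idn C x \<in> hom_set C x x"
  using assms by (simp_all add: hom_set_def)

text \<open>
  The comparison maps of \<open>up\<close> lie over identities, so each axiom reduces to an equation in \<open>C\<close> between
  a structure map and itself.
\<close>

theorem hypergraph_functor_up: "hypergraph_functor C D up"
proof (intro hypergraph_functor.intro hypergraph_functor_axioms.intro
    strong_symmetric_monoidal_functor.intro strong_symmetric_monoidal_functor_axioms.intro
    cat_functor.intro cat_functor_axioms.intro)
  show "hypergraph_category D" "hypergraph_category C" "symmetric_monoidal_category D"
    "symmetric_monoidal_category C" "category D" "category C" by unfold_locales
  show "on_ob up \<in> extensional (Ob C)" "on_ar up \<in> extensional (Ar C)"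
    by (simp_all add: up_def)
  show "phi up x y = undefined" if "\<not> (x \<in> Ob C \<and> y \<in> Ob C)" for x y
    using that by (auto simp: up_def)
  show up_hom: "on_ar up f \<in> hom_set D (on_ob up x) (on_ob up y)" if "f \<in> hom_set C x y" for f x y
    using overD[OF over_up[OF that]] C.hom_Ob[OF that] by (simp add: hom_set_def)
  show "on_ar up (f \<Zsemi>\<^bsub>C\<^esub> g) = on_ar up f \<Zsemi>\<^bsub>D\<^esub> on_ar up g"
    if f: "f \<in> hom_set C x y" and g: "g \<in> hom_set C y z" for f g x y z
    by (rule over_eqI, (rule over_comp over_up f g C.comp_hom[OF f g])+) simp
  show "(on_ar up f \<otimes>\<^sub>a\<^bsub>D\<^esub> on_ar up g) \<Zsemi>\<^bsub>D\<^esub> phi up x' y' = phi up x y \<Zsemi>\<^bsub>D\<^esub> on_ar up (f \<otimes>\<^sub>a\<^bsub>C\<^esub> g)"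
    if f: "f \<in> hom_set C x x'" and g: "g \<in> hom_set C y y'" for f g x x' y y'
  proof -
    have fg: "f \<otimes>\<^sub>a\<^bsub>C\<^esub> g \<in> hom_set C (x \<otimes>\<^bsub>C\<^esub> y) (x' \<otimes>\<^bsub>C\<^esub> y')"
      using hom_setD[OF f] hom_setD[OF g] by (simp add: hom_set_def)
    show ?thesis
      by (rule over_eqI, (rule over_comp over_tens over_up over_up_phi f g fg C.hom_Ob[OF f] C.hom_Ob[OF g])+)
        (use hom_setD[OF fg] in simp)
  qed
  show "phi_unit up \<in> hom_set D \<one>\<^bsub>D\<^esub> (on_ob up \<one>\<^bsub>C\<^esub>)"
    using overD[OF over_up_phi_unit] by (simp add: hom_set_def)
  show phi_unit_iso: "is_iso D (phi_unit up)"
    by (rule over_inverse(1)[OF over_up_phi_unit]) simp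
  fix x assume x [simp]: "x \<in> Ob C"
  note fx = frame_J[OF x]
  show "on_ob up x \<in> Ob D" by simp
  show "on_ar up (idn C x) = idn D (on_ob up x)"
    unfolding on_ob_up[OF x] by (rule over_eqI, (rule over_up hom_C_intros x over_idn fx)+) simp
  show "(phi_unit up \<otimes>\<^sub>a\<^bsub>D\<^esub> idn D (on_ob up x)) \<Zsemi>\<^bsub>D\<^esub> phi up \<one>\<^bsub>C\<^esub> x \<Zsemi>\<^bsub>D\<^esub> on_ar up (lun C x) = lun D (on_ob up x)"
    unfolding on_ob_up[OF x]
    by (rule over_eqI, (rule over_comp over_tens over_up_phi_unit over_up_phi over_up hom_C_intros
          over_lun C.unit_Ob x over_idn fx)+) simp
  show "(idn D (on_ob up x) \<otimes>\<^sub>a\<^bsub>D\<^esub> phi_unit up) \<Zsemi>\<^bsub>D\<^esub> phi up x \<one>\<^bsub>C\<^esub> \<Zsemi>\<^bsub>D\<^esub> on_ar up (run C x) = run D (on_ob up x)"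
    unfolding on_ob_up[OF x]
    by (rule over_eqI, (rule over_comp over_tens over_up_phi_unit over_up_phi over_up hom_C_intros
          over_run C.unit_Ob x over_idn fx)+) simp
  show "mu D (on_ob up x) = phi up x x \<Zsemi>\<^bsub>D\<^esub> on_ar up (mu C x)"
    unfolding on_ob_up[OF x]
    by (rule over_eqI, (rule over_comp over_J_frame(2)[OF x] over_up_phi over_up hom_C_intros x)+) simp
  show "eta D (on_ob up x) = phi_unit up \<Zsemi>\<^bsub>D\<^esub> on_ar up (eta C x)"
    unfolding on_ob_up[OF x]
    by (rule over_eqI, (rule over_comp over_J_frame(3)[OF x] over_up_phi_unit over_up hom_C_intros x)+) simp
  show "delta D (on_ob up x) = on_ar up (delta C x) \<Zsemi>\<^bsub>D\<^esub> inverse_of D (phi up x x)"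
    unfolding on_ob_up[OF x]
    by (rule over_eqI, (rule over_comp over_J_frame(4)[OF x] over_inverse(2)[OF over_up_phi] over_up hom_C_intros x
          C.iso_idn C.tens_Ob)+) simp
  show "eps D (on_ob up x) = on_ar up (eps C x) \<Zsemi>\<^bsub>D\<^esub> inverse_of D (phi_unit up)"
    unfolding on_ob_up[OF x]
    by (rule over_eqI, (rule over_comp over_J_frame(5)[OF x] over_inverse(2)[OF over_up_phi_unit] over_up hom_C_intros x
          C.iso_idn C.unit_Ob)+) simp
  fix y assume y [simp]: "y \<in> Ob C"
  note fy = frame_J[OF y]
  show "phi up x y \<in> hom_set D (on_ob up x \<otimes>\<^bsub>D\<^esub> on_ob up y) (on_ob up (x \<otimes>\<^bsub>C\<^esub> y))"
    using overD[OF over_up_phi[OF x y]] by (simp add: hom_set_def)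
  show "is_iso D (phi up x y)"
    by (rule over_inverse(1)[OF over_up_phi[OF x y]]) simp
  show "phi up x y \<Zsemi>\<^bsub>D\<^esub> on_ar up (braid C x y) = braid D (on_ob up x) (on_ob up y) \<Zsemi>\<^bsub>D\<^esub> phi up y x"
    unfolding on_ob_up[OF x] on_ob_up[OF y]
    by (rule over_eqI, (rule over_comp over_up_phi over_up C.braid_hom over_braid x y fx fy)+) simp
  fix z assume z [simp]: "z \<in> Ob C"
  note fz = frame_J[OF z]
  show "(phi up x y \<otimes>\<^sub>a\<^bsub>D\<^esub> idn D (on_ob up z)) \<Zsemi>\<^bsub>D\<^esub> phi up (x \<otimes>\<^bsub>C\<^esub> y) z \<Zsemi>\<^bsub>D\<^esub> on_ar up (assr C x y z)
      = assr D (on_ob up x) (on_ob up y) (on_ob up z)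
        \<Zsemi>\<^bsub>D\<^esub> (idn D (on_ob up x) \<otimes>\<^sub>a\<^bsub>D\<^esub> phi up y z) \<Zsemi>\<^bsub>D\<^esub> phi up x (y \<otimes>\<^bsub>C\<^esub> z)"
    unfolding on_ob_up[OF x] on_ob_up[OF y] on_ob_up[OF z]
    by (rule over_eqI, (rule over_comp over_tens over_up_phi over_up C.assr_hom over_assr over_idn
          C.tens_Ob x y z fx fy fz)+) simp
qed

sublocale up: hypergraph_functor C D up by (rule hypergraph_functor_up)
sublocale down: hypergraph_functor D C down by (rule hypergraph_functor_down)
sublocale ud: composable_hypergraph_functors C D C up down by unfold_locales
sublocale du: composable_hypergraph_functors D C D down up by unfold_locales

lemma tens_frame_idn: "\<lbrakk>s \<in> Ob D; t \<in> Ob D\<rbrakk> \<Longrightarrow> tens_frame s (idn C (P s)) t (idn C (P t)) = m s t"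
  by (simp add: tens_frame_def)

lemma id_functor_simps [simp]:
  "x \<in> Ob A \<Longrightarrow> on_ob (id_functor A) x = x" "f \<in> Ar A \<Longrightarrow> on_ar (id_functor A) f = f"
  "\<lbrakk>x \<in> Ob A; y \<in> Ob A\<rbrakk> \<Longrightarrow> phi (id_functor A) x y = idn A (x \<otimes>\<^bsub>A\<^esub> y)"
  "phi_unit (id_functor A) = idn A \<one>\<^bsub>A\<^esub>"
  by (simp_all add: id_functor_def)

text \<open>
  The components are the frames \<open>r\<close>. Naturality and monoidality are the squares which say that the
  arrow part and the comparison maps of \<open>up\<close> lie over arrows and identities of \<open>C\<close>.
\<close>

lemma unit_isomorphic: "isomorphic (Hyp_hom C C) (id_functor C) (comp_functors C C up down)"
proof -
  let ?t = "\<lparr>src = id_functor C, tgt = comp_functors C C up down, component = restrict r (Ob C)\<rparr>"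
  have "hypergraph_category C" ..
  then have hyp: "hypergraph_functor C C (id_functor C)" by (rule hypergraph_functor_id)
  then interpret I: hypergraph_functor C C "id_functor C" .
  interpret T: hypergraph_functor C C "comp_functors C C up down" by (rule ud.hypergraph_functor_comp)
  have "strong_symmetric_monoidal_functor C C (id_functor C)"
    "strong_symmetric_monoidal_functor C C (comp_functors C C up down)" ..
  then have "monoidal_transformation C C ?t"
  proof (intro monoidal_transformation.intro monoidal_transformation_axioms.intro)
    show "component ?t x \<in> hom_set C (on_ob (src ?t) x) (on_ob (tgt ?t) x)" if "x \<in> Ob C" for x
      using that by (simp add: hom_set_def)
    show "on_ar (src ?t) f \<Zsemi>\<^bsub>C\<^esub> component ?t y = component ?t x \<Zsemi>\<^bsub>C\<^esub> on_ar (tgt ?t) f"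
      if "f \<in> hom_set C x y" for f x y
      using overD(7)[OF over_up[OF that]] hom_setD[OF that] C.hom_Ob[OF that] by simp
    show "phi (src ?t) x y \<Zsemi>\<^bsub>C\<^esub> component ?t (x \<otimes>\<^bsub>C\<^esub> y)
        = (component ?t x \<otimes>\<^sub>a\<^bsub>C\<^esub> component ?t y) \<Zsemi>\<^bsub>C\<^esub> phi (tgt ?t) x y"
      if "x \<in> Ob C" "y \<in> Ob C" for x y
      using overD(7)[OF over_up_phi[OF that]] that by (simp add: tens_frame_def)
    show "phi_unit (src ?t) \<Zsemi>\<^bsub>C\<^esub> component ?t \<one>\<^bsub>C\<^esub> = phi_unit (tgt ?t)"
      using overD(7)[OF over_up_phi_unit] by simp
  qed simp_all
  then have t: "?t \<in> Ar (Hyp_hom C C)"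
    using hyp ud.hypergraph_functor_comp by (simp add: Hyp_hom_def)
  have "is_iso (Hyp_hom C C) ?t"
    by (rule monoidal_transformation_inverse[OF t]) simp
  moreover have "?t \<in> hom_set (Hyp_hom C C) (id_functor C) (comp_functors C C up down)"
    using t by (simp add: hom_set_def) (simp add: Hyp_hom_def)
  ultimately show ?thesis unfolding isomorphic_def by blast
qed

text \<open>
  The component at \<open>s\<close> lies over the identity of \<open>P s\<close>, from the frame \<open>r (P s)\<close> to the identity frame.
\<close>

lemma counit_isomorphic: "isomorphic (Hyp_hom D D) (comp_functors D D down up) (id_functor D)"
proof -
  let ?c = "\<lambda>s. lift (J (P s)) s (r (P s)) (idn C (P s)) (idn C (P s))"
  let ?t = "\<lparr>src = comp_functors D D down up, tgt = id_functor D, component = restrict ?c (Ob D)\<rparr>"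
  have c: "over (J (P s)) s (r (P s)) (idn C (P s)) (idn C (P s)) (?c s)" if "s \<in> Ob D" for s
    by (rule over_lift[OF frame_J frame_idn]) (use that in simp_all)
  have "hypergraph_category D" ..
  then have hyp: "hypergraph_functor D D (id_functor D)" by (rule hypergraph_functor_id)
  then interpret I: hypergraph_functor D D "id_functor D" .
  interpret T: hypergraph_functor D D "comp_functors D D down up" by (rule du.hypergraph_functor_comp)
  have "strong_symmetric_monoidal_functor D D (id_functor D)"
    "strong_symmetric_monoidal_functor D D (comp_functors D D down up)" ..
  then have "monoidal_transformation D D ?t"
  proof (intro monoidal_transformation.intro monoidal_transformation_axioms.intro)
    show "component ?t s \<in> hom_set D (on_ob (src ?t) s) (on_ob (tgt ?t) s)" if "s \<in> Ob D" for s
      using overD[OF c[OF that]] that by (simp add: hom_set_def)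
    show "on_ar (src ?t) a \<Zsemi>\<^bsub>D\<^esub> component ?t u = component ?t s \<Zsemi>\<^bsub>D\<^esub> on_ar (tgt ?t) a"
      if a: "a \<in> hom_set D s u" for a s u
    proof -
      note [simp] = hom_setD[OF a] dom.hom_Ob[OF a]
      have "on_ar up (U a) \<Zsemi>\<^bsub>D\<^esub> ?c u = ?c s \<Zsemi>\<^bsub>D\<^esub> a"
        by (rule over_eqI, (rule over_comp over_up FA_hom[OF a] c dom.hom_Ob[OF a] over_self[OF a])+) simp
      then show ?thesis by simp
    qed
    show "phi (src ?t) s u \<Zsemi>\<^bsub>D\<^esub> component ?t (s \<otimes>\<^bsub>D\<^esub> u)
        = (component ?t s \<otimes>\<^sub>a\<^bsub>D\<^esub> component ?t u) \<Zsemi>\<^bsub>D\<^esub> phi (tgt ?t) s u"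
      if [simp]: "s \<in> Ob D" "u \<in> Ob D" for s u
    proof -
      note su = D_tens_Ob[OF that]
      have "over (J (P s) \<otimes>\<^bsub>D\<^esub> J (P u)) (s \<otimes>\<^bsub>D\<^esub> u) (tens_frame (J (P s)) (r (P s)) (J (P u)) (r (P u)))
          (m s u \<Zsemi>\<^bsub>C\<^esub> idn C (P (s \<otimes>\<^bsub>D\<^esub> u))) (idn C (P s) \<otimes>\<^sub>a\<^bsub>C\<^esub> idn C (P u)) (?c s \<otimes>\<^sub>a\<^bsub>D\<^esub> ?c u)"
        using over_tens[OF c[OF that(1)] c[OF that(2)]] by (simp add: tens_frame_idn)
      \<comment> \<open>The tensor product of identity frames is \<open>m s u\<close>, whereas the other side ends in an identity frame.\<close>
      note cc = over_reframe[OF this m_iso[OF that] frame_idn[OF su]]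
      have "phi up (P s) (P u) \<Zsemi>\<^bsub>D\<^esub> on_ar up (m s u) \<Zsemi>\<^bsub>D\<^esub> ?c (s \<otimes>\<^bsub>D\<^esub> u) = ?c s \<otimes>\<^sub>a\<^bsub>D\<^esub> ?c u"
        by (rule over_eqI, (rule over_comp over_up_phi over_up m_hom FO_Ob c su that)+, rule cc) simp_all
      then show ?thesis
        using overD(4-6)[OF c[OF that(1)]] overD(4-6)[OF c[OF that(2)]] by simp
    qed
    show "phi_unit (src ?t) \<Zsemi>\<^bsub>D\<^esub> component ?t \<one>\<^bsub>D\<^esub> = phi_unit (tgt ?t)"
    proof -
      have "over \<one>\<^bsub>D\<^esub> \<one>\<^bsub>D\<^esub> m0 (m0 \<Zsemi>\<^bsub>C\<^esub> idn C (P \<one>\<^bsub>D\<^esub>)) (idn C \<one>\<^bsub>C\<^esub>) (idn D \<one>\<^bsub>D\<^esub>)"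
        using over_idn[OF frame_unit] by simp
      note cc = over_reframe[OF this m0_iso frame_idn[OF D_unit_Ob]]
      have "phi_unit up \<Zsemi>\<^bsub>D\<^esub> on_ar up m0 \<Zsemi>\<^bsub>D\<^esub> ?c \<one>\<^bsub>D\<^esub> = idn D \<one>\<^bsub>D\<^esub>"
        by (rule over_eqI, (rule over_comp over_up_phi_unit over_up m0_hom c D_unit_Ob)+, rule cc) simp_all
      then show ?thesis by simp
    qed
  qed simp_all
  then have t: "?t \<in> Ar (Hyp_hom D D)"
    using hyp du.hypergraph_functor_comp by (simp add: Hyp_hom_def)
  have "is_iso (Hyp_hom D D) ?t"
    by (rule monoidal_transformation_inverse[OF t]) (simp, rule over_inverse(1)[OF c], simp_all)
  moreover have "?t \<in> hom_set (Hyp_hom D D) (comp_functors D D down up) (id_functor D)"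
    using t by (simp add: hom_set_def) (simp add: Hyp_hom_def)
  ultimately show ?thesis unfolding isomorphic_def by blast
qed

end

theorem equivalent_in_Hyp:
  assumes "hypergraph_comparison D C P U m m0 J r"
  shows "equivalent_in Hyp C D"
proof -
  interpret hypergraph_comparison D C P U m m0 J r by fact
  show ?thesis
    unfolding equivalent_in_def
    using unit_isomorphic counit_isomorphic hypergraph_functor_up hypergraph_functor_down
    by (auto simp: Hyp_def Hyp_hom_def)
qed

section \<open>The middle swap in a strict symmetric monoidal category\<close>

locale strict_symmetric_monoidal_category = symmetric_monoidal_category C
  for C :: "('o, 'a, 'z) symmetric_monoidal_data_scheme" (structure) +
  assumes strict: "strict_monoidal C"
begin

lemma strict_ob [simp]:
  "\<lbrakk>x \<in> Ob C; y \<in> Ob C; z \<in> Ob C\<rbrakk> \<Longrightarrow> x \<otimes> y \<otimes> z = x \<otimes> (y \<otimes> z)"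
  "x \<in> Ob C \<Longrightarrow> \<one> \<otimes> x = x" "x \<in> Ob C \<Longrightarrow> x \<otimes> \<one> = x"
  "\<lbrakk>x \<in> Ob C; y \<in> Ob C; z \<in> Ob C\<rbrakk> \<Longrightarrow> assr C x y z = idn C (x \<otimes> (y \<otimes> z))"
  "x \<in> Ob C \<Longrightarrow> lun C x = idn C x" "x \<in> Ob C \<Longrightarrow> run C x = idn C x"
  using strict by (simp_all add: strict_monoidal_def)

lemma strict_ar [simp]:
  "\<lbrakk>f \<in> Ar C; g \<in> Ar C; h \<in> Ar C\<rbrakk> \<Longrightarrow> f \<otimes>\<^sub>a g \<otimes>\<^sub>a h = f \<otimes>\<^sub>a (g \<otimes>\<^sub>a h)"
  "f \<in> Ar C \<Longrightarrow> idn C \<one> \<otimes>\<^sub>a f = f" "f \<in> Ar C \<Longrightarrow> f \<otimes>\<^sub>a idn C \<one> = f"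
  using assr_nat[of f g h, OF _ _ _ refl refl refl] lun_nat[of f, OF _ refl] run_nat[of f, OF _ refl]
  by simp_all

lemma idn_tens_idn_tens [simp]:
  "\<lbrakk>x \<in> Ob C; y \<in> Ob C; f \<in> Ar C\<rbrakk> \<Longrightarrow> idn C x \<otimes>\<^sub>a (idn C y \<otimes>\<^sub>a f) = idn C (x \<otimes> y) \<otimes>\<^sub>a f"
  using strict_ar(1)[of "idn C x" "idn C y" f] by simp

lemma mid_swap_strict:
  "\<lbrakk>w \<in> Ob C; x \<in> Ob C; y \<in> Ob C; z \<in> Ob C\<rbrakk>
    \<Longrightarrow> mid_swap C w x y z = idn C w \<otimes>\<^sub>a (braid C x y \<otimes>\<^sub>a idn C z)"
  by (simp add: mid_swap_def)

lemma braid_tens_right: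
  assumes [simp]: "x \<in> Ob C" "y \<in> Ob C" "z \<in> Ob C"
  shows "braid C x (y \<otimes> z) = (braid C x y \<otimes>\<^sub>a idn C z) \<Zsemi> (idn C y \<otimes>\<^sub>a braid C x z)"
  using hexagon[OF assms] by simp

lemma braid_iso:
  assumes [simp]: "x \<in> Ob C" "y \<in> Ob C"
  shows "is_iso C (braid C x y)" "inverse_of C (braid C x y) = braid C y x"
proof -
  have "inverse_arrows C (braid C x y) (braid C y x)"
    by (simp add: inverse_arrows_def hom_set_def braid_braid)
  then show "is_iso C (braid C x y)" "inverse_of C (braid C x y) = braid C y x"
    using inverse_of_eq unfolding is_iso_def by blast+
qed

lemma braid_tens_left:
  assumes [simp]: "x \<in> Ob C" "y \<in> Ob C" "z \<in> Ob C"
  shows "braid C (x \<otimes> y) z = (idn C x \<otimes>\<^sub>a braid C y z) \<Zsemi> (braid C x z \<otimes>\<^sub>a idn C y)"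
proof -
  have "braid C (x \<otimes> y) z = inverse_of C (braid C z (x \<otimes> y))"
    by (simp add: braid_iso)
  also have "\<dots> = inverse_of C ((braid C z x \<otimes>\<^sub>a idn C y) \<Zsemi> (idn C x \<otimes>\<^sub>a braid C z y))"
    by (simp add: braid_tens_right)
  also have "\<dots> = (idn C x \<otimes>\<^sub>a braid C y z) \<Zsemi> (braid C x z \<otimes>\<^sub>a idn C y)"
    by (simp add: braid_iso)
  finally show ?thesis .
qed

text \<open>
  The hexagon on \<open>x, \<one>, \<one>\<close> makes the braiding with the unit idempotent, and it is invertible.
\<close>

lemma braid_unit:
  assumes [simp]: "x \<in> Ob C"
  shows "braid C x \<one> = idn C x" "braid C \<one> x = idn C x"
proof -
  have "braid C x \<one> \<Zsemi> braid C x \<one> = braid C x \<one> \<Zsemi> idn C x"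
    using braid_tens_right[of x \<one> \<one>] by simp
  then show 1: "braid C x \<one> = idn C x"
    by (rule iso_cancel_left) (simp_all add: braid_iso)
  show "braid C \<one> x = idn C x"
    using braid_braid[of x \<one>] by (simp add: 1)
qed

lemma mid_swap_iso:
  assumes [simp]: "w \<in> Ob C" "x \<in> Ob C" "y \<in> Ob C" "z \<in> Ob C"
  shows "mid_swap C w x y z \<in> Ar C" "dm C (mid_swap C w x y z) = w \<otimes> (x \<otimes> (y \<otimes> z))"
    "cd C (mid_swap C w x y z) = w \<otimes> (y \<otimes> (x \<otimes> z))"
    "is_iso C (mid_swap C w x y z)" "inverse_of C (mid_swap C w x y z) = mid_swap C w y x z"
  by (simp_all add: mid_swap_strict braid_iso)

text \<open>
  Both sides permute \<open>x y z x' y' z'\<close> into \<open>x x' y y' z z'\<close>. By the two hexagons each decomposes into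
  the transpositions of \<open>z, x'\<close>, of \<open>z, y'\<close> and of \<open>y, x'\<close>. The first comes first on both sides, and
  the other two act on disjoint positions.
\<close>

lemma mid_swap_assoc:
  assumes [simp]: "x \<in> Ob C" "y \<in> Ob C" "z \<in> Ob C" "x' \<in> Ob C" "y' \<in> Ob C" "z' \<in> Ob C"
  shows "mid_swap C (x \<otimes> y) z (x' \<otimes> y') z' \<Zsemi> (mid_swap C x y x' y' \<otimes>\<^sub>a idn C (z \<otimes> z'))
    = mid_swap C x (y \<otimes> z) x' (y' \<otimes> z') \<Zsemi> (idn C (x \<otimes> x') \<otimes>\<^sub>a mid_swap C y z y' z')"
proof -
  let ?A = "idn C (x \<otimes> y) \<otimes>\<^sub>a (braid C z x' \<otimes>\<^sub>a idn C (y' \<otimes> z'))"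
  let ?B = "idn C (x \<otimes> (y \<otimes> x')) \<otimes>\<^sub>a (braid C z y' \<otimes>\<^sub>a idn C z')"
  let ?K = "idn C x \<otimes>\<^sub>a (braid C y x' \<otimes>\<^sub>a idn C (y' \<otimes> (z \<otimes> z')))"
  let ?K' = "idn C x \<otimes>\<^sub>a (braid C y x' \<otimes>\<^sub>a idn C (z \<otimes> (y' \<otimes> z')))"
  let ?B' = "idn C (x \<otimes> (x' \<otimes> y)) \<otimes>\<^sub>a (braid C z y' \<otimes>\<^sub>a idn C z')"
  have "mid_swap C (x \<otimes> y) z (x' \<otimes> y') z' = ?A \<Zsemi> ?B"
  proof -
    have "?A \<Zsemi> ?B = (idn C (x \<otimes> y) \<otimes>\<^sub>a (braid C z x' \<otimes>\<^sub>a idn C y' \<otimes>\<^sub>a idn C z'))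
        \<Zsemi> (idn C (x \<otimes> y) \<otimes>\<^sub>a (idn C x' \<otimes>\<^sub>a braid C z y' \<otimes>\<^sub>a idn C z'))" by simp
    also have "\<dots> = idn C (x \<otimes> y) \<otimes>\<^sub>a
        (((braid C z x' \<otimes>\<^sub>a idn C y') \<Zsemi> (idn C x' \<otimes>\<^sub>a braid C z y')) \<otimes>\<^sub>a (idn C z' \<Zsemi> idn C z'))"
      by (simp only: interchange tens_Ar idn_Ar braid_Ar assms tens_Ob strict_ob idn_left)
    finally show ?thesis by (simp add: mid_swap_strict braid_tens_right)
  qed
  moreover have "mid_swap C x y x' y' \<otimes>\<^sub>a idn C (z \<otimes> z') = ?K"
    by (simp add: mid_swap_strict)
  moreover have "mid_swap C x (y \<otimes> z) x' (y' \<otimes> z') = ?A \<Zsemi> ?K'"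
  proof -
    have "?A \<Zsemi> ?K' = (idn C x \<otimes>\<^sub>a (idn C y \<otimes>\<^sub>a braid C z x' \<otimes>\<^sub>a idn C (y' \<otimes> z')))
        \<Zsemi> (idn C x \<otimes>\<^sub>a (braid C y x' \<otimes>\<^sub>a idn C z \<otimes>\<^sub>a idn C (y' \<otimes> z')))" by simp
    also have "\<dots> = idn C x \<otimes>\<^sub>a (((idn C y \<otimes>\<^sub>a braid C z x') \<Zsemi> (braid C y x' \<otimes>\<^sub>a idn C z))
        \<otimes>\<^sub>a (idn C (y' \<otimes> z') \<Zsemi> idn C (y' \<otimes> z')))"
      by (simp only: interchange tens_Ar idn_Ar braid_Ar assms tens_Ob strict_ob idn_left)
    finally show ?thesis by (simp add: mid_swap_strict braid_tens_left)
  qed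
  moreover have "idn C (x \<otimes> x') \<otimes>\<^sub>a mid_swap C y z y' z' = ?B'"
    by (simp add: mid_swap_strict)
  moreover have "?B \<Zsemi> ?K = ?K' \<Zsemi> ?B'"
  proof -
    have "?B \<Zsemi> ?K = (idn C x \<otimes>\<^sub>a (idn C (y \<otimes> x') \<otimes>\<^sub>a (braid C z y' \<otimes>\<^sub>a idn C z')))
        \<Zsemi> (idn C x \<otimes>\<^sub>a (braid C y x' \<otimes>\<^sub>a idn C (y' \<otimes> (z \<otimes> z'))))" by simp
    also have "\<dots> = idn C x \<otimes>\<^sub>a (braid C y x' \<otimes>\<^sub>a (braid C z y' \<otimes>\<^sub>a idn C z'))"
      by (simp only: interchange tens_Ar idn_Ar braid_Ar assms tens_Ob strict_ob idn_left idn_right)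
    also have "\<dots> = (idn C x \<otimes>\<^sub>a (braid C y x' \<otimes>\<^sub>a idn C (z \<otimes> (y' \<otimes> z'))))
        \<Zsemi> (idn C x \<otimes>\<^sub>a (idn C (x' \<otimes> y) \<otimes>\<^sub>a (braid C z y' \<otimes>\<^sub>a idn C z')))"
      by (simp only: interchange tens_Ar idn_Ar braid_Ar assms tens_Ob strict_ob idn_left idn_right)
    finally show ?thesis by simp
  qed
  ultimately show ?thesis by simp
qed

text \<open>
  The inverse of a middle swap is a middle swap, so this is \<open>mid_swap_assoc\<close> inverted.
\<close>

lemma mid_swap_coassoc:
  assumes [simp]: "x \<in> Ob C" "y \<in> Ob C" "z \<in> Ob C" "x' \<in> Ob C" "y' \<in> Ob C" "z' \<in> Ob C"
  shows "(mid_swap C x x' y y' \<otimes>\<^sub>a idn C (z \<otimes> z')) \<Zsemi> mid_swap C (x \<otimes> y) (x' \<otimes> y') z z'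
    = (idn C (x \<otimes> x') \<otimes>\<^sub>a mid_swap C y y' z z') \<Zsemi> mid_swap C x x' (y \<otimes> z) (y' \<otimes> z')"
  using arg_cong[OF mid_swap_assoc[OF assms], of "inverse_of C"]
  by (simp add: mid_swap_iso)

end

section \<open>Coherent tensor products of words\<close>

context monoidal_category
begin

primrec tens_list :: "'o list \<Rightarrow> 'o" where
  "tens_list [] = \<one>"
| "tens_list (x # xs) = x \<otimes> tens_list xs"

text \<open>
  The isomorphism that moves brackets to the right in \<open>(\<Otimes>xs) \<otimes> (\<Otimes>ys)\<close> and removes the unit ending \<open>\<Otimes>xs\<close>.
\<close>

primrec join :: "'o list \<Rightarrow> 'o list \<Rightarrow> 'a" where
  "join [] ys = lun C (tens_list ys)"
| "join (x # xs) ys = assr C x (tens_list xs) (tens_list ys) \<Zsemi> (idn C x \<otimes>\<^sub>a join xs ys)"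

lemma tens_list_Ob [simp]: "xs \<in> lists (Ob C) \<Longrightarrow> tens_list xs \<in> Ob C"
  by (induction xs) auto

lemma join_Ar [simp]:
  assumes "xs \<in> lists (Ob C)" "ys \<in> lists (Ob C)"
  shows "is_iso C (join xs ys)" "dm C (join xs ys) = tens_list xs \<otimes> tens_list ys"
    "cd C (join xs ys) = tens_list (xs @ ys)" "join xs ys \<in> Ar C"
proof -
  have "is_iso C (join xs ys) \<and> dm C (join xs ys) = tens_list xs \<otimes> tens_list ys
      \<and> cd C (join xs ys) = tens_list (xs @ ys)"
    using assms by (induction xs) auto
  then show "is_iso C (join xs ys)" "dm C (join xs ys) = tens_list xs \<otimes> tens_list ys"
    "cd C (join xs ys) = tens_list (xs @ ys)" "join xs ys \<in> Ar C"
    by auto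
qed

lemma join_Nil: "xs \<in> lists (Ob C) \<Longrightarrow> join xs [] = run C (tens_list xs)"
  by (induction xs) (auto simp: lun_unit_eq_run_unit assr_run)

text \<open>
  By induction on \<open>xs\<close>. The base case is \<open>assr_lun\<close>. In the step, naturality of the associator
  isolates the induction hypothesis tensored with \<open>x\<close>, and the pentagon closes the diagram.
\<close>

lemma join_assoc:
  assumes "xs \<in> lists (Ob C)" and ys [simp]: "ys \<in> lists (Ob C)" and zs [simp]: "zs \<in> lists (Ob C)"
  shows "(join xs ys \<otimes>\<^sub>a idn C (tens_list zs)) \<Zsemi> join (xs @ ys) zs
    = assr C (tens_list xs) (tens_list ys) (tens_list zs)
      \<Zsemi> (idn C (tens_list xs) \<otimes>\<^sub>a join ys zs) \<Zsemi> join xs (ys @ zs)"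
  using assms(1)
proof (induction xs)
  case Nil
  have "assr C \<one> (tens_list ys) (tens_list zs) \<Zsemi> ((idn C \<one> \<otimes>\<^sub>a join ys zs) \<Zsemi> lun C (tens_list (ys @ zs)))
      = (assr C \<one> (tens_list ys) (tens_list zs) \<Zsemi> lun C (tens_list ys \<otimes> tens_list zs)) \<Zsemi> join ys zs"
    by (subst lun_nat) simp_all
  then show ?case by (simp add: assr_lun)
next
  case (Cons x xs)
  then have x [simp]: "x \<in> Ob C" and xs [simp]: "xs \<in> lists (Ob C)" by auto
  let ?X = "tens_list xs" and ?Y = "tens_list ys" and ?Z = "tens_list zs" and ?i = "idn C x"
  have "(join (x # xs) ys \<otimes>\<^sub>a idn C ?Z) \<Zsemi> join ((x # xs) @ ys) zs
      = ((assr C x ?X ?Y \<Zsemi> (?i \<otimes>\<^sub>a join xs ys)) \<otimes>\<^sub>a (idn C ?Z \<Zsemi> idn C ?Z))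
        \<Zsemi> (assr C x (tens_list (xs @ ys)) ?Z \<Zsemi> (?i \<otimes>\<^sub>a join (xs @ ys) zs))"
    by simp
  also have "\<dots> = (assr C x ?X ?Y \<otimes>\<^sub>a idn C ?Z) \<Zsemi>
      (((?i \<otimes>\<^sub>a join xs ys) \<otimes>\<^sub>a idn C ?Z) \<Zsemi> assr C x (tens_list (xs @ ys)) ?Z) \<Zsemi> (?i \<otimes>\<^sub>a join (xs @ ys) zs)"
    by (subst interchange[symmetric]) simp_all
  also have "\<dots> = (assr C x ?X ?Y \<otimes>\<^sub>a idn C ?Z) \<Zsemi> (assr C x (?X \<otimes> ?Y) ?Z \<Zsemi>
      ((?i \<otimes>\<^sub>a (join xs ys \<otimes>\<^sub>a idn C ?Z)) \<Zsemi> (?i \<otimes>\<^sub>a join (xs @ ys) zs)))"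
    by (subst assr_nat) simp_all
  also have "\<dots> = (assr C x ?X ?Y \<otimes>\<^sub>a idn C ?Z) \<Zsemi> (assr C x (?X \<otimes> ?Y) ?Z \<Zsemi>
      (?i \<otimes>\<^sub>a ((join xs ys \<otimes>\<^sub>a idn C ?Z) \<Zsemi> join (xs @ ys) zs)))"
    by (subst interchange) simp_all
  also have "\<dots> = (assr C x ?X ?Y \<otimes>\<^sub>a idn C ?Z) \<Zsemi> (assr C x (?X \<otimes> ?Y) ?Z \<Zsemi>
      (?i \<otimes>\<^sub>a (assr C ?X ?Y ?Z \<Zsemi> (idn C ?X \<otimes>\<^sub>a join ys zs) \<Zsemi> join xs (ys @ zs))))"
    by (subst Cons.IH) simp_all
  also have "\<dots> = ((assr C x ?X ?Y \<otimes>\<^sub>a idn C ?Z) \<Zsemi> assr C x (?X \<otimes> ?Y) ?Z \<Zsemi> (?i \<otimes>\<^sub>a assr C ?X ?Y ?Z))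
      \<Zsemi> ((?i \<otimes>\<^sub>a (idn C ?X \<otimes>\<^sub>a join ys zs)) \<Zsemi> (?i \<otimes>\<^sub>a join xs (ys @ zs)))"
    by (simp add: interchange)
  also have "\<dots> = assr C (x \<otimes> ?X) ?Y ?Z \<Zsemi> (assr C x ?X (?Y \<otimes> ?Z) \<Zsemi> (?i \<otimes>\<^sub>a (idn C ?X \<otimes>\<^sub>a join ys zs)))
      \<Zsemi> (?i \<otimes>\<^sub>a join xs (ys @ zs))"
    by (subst pentagon[symmetric]) simp_all
  also have "\<dots> = assr C (x \<otimes> ?X) ?Y ?Z \<Zsemi> (((?i \<otimes>\<^sub>a idn C ?X) \<otimes>\<^sub>a join ys zs) \<Zsemi> assr C x ?X (tens_list (ys @ zs)))
      \<Zsemi> (?i \<otimes>\<^sub>a join xs (ys @ zs))"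
    by (subst assr_nat) simp_all
  finally show ?case by simp
qed

end

section \<open>The strictification on words of objects\<close>

text \<open>
  Words of objects and triples of domain, arrow and codomain are encoded in arbitrary types, which for
  the theorem are the types of objects and arrows of \<open>C\<close> themselves.
\<close>

locale free_strictification = hypergraph_category C
  for C :: "('o, 'a) hypergraph_data" (structure) +
  fixes enc_ob :: "'o list \<Rightarrow> 'p" and enc_ar :: "'p \<times> 'a \<times> 'p \<Rightarrow> 'b"
  assumes inj_enc_ob: "inj_on enc_ob (lists (Ob C))"
    and inj_enc_ar: "inj_on enc_ar (enc_ob ` lists (Ob C) \<times> Ar C \<times> enc_ob ` lists (Ob C))"
begin

definition objects :: "'p set" where "objects = enc_ob ` lists (Ob C)"

definition word :: "'p \<Rightarrow> 'o list" where "word = inv_into (lists (Ob C)) enc_ob"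

definition word_tens :: "'p \<Rightarrow> 'o" where "word_tens s = tens_list (word s)"

definition triple :: "'b \<Rightarrow> 'p \<times> 'a \<times> 'p" where
  "triple = inv_into (objects \<times> Ar C \<times> objects) enc_ar"

definition source :: "'b \<Rightarrow> 'p" where "source a = fst (triple a)"
definition body :: "'b \<Rightarrow> 'a" where "body a = fst (snd (triple a))"
definition target :: "'b \<Rightarrow> 'p" where "target a = snd (snd (triple a))"

definition merge :: "'p \<Rightarrow> 'p \<Rightarrow> 'a" where "merge s t = join (word s) (word t)"

definition s_idn :: "'p \<Rightarrow> 'b" where "s_idn s = enc_ar (s, idn C (word_tens s), s)"

definition s_comp :: "'b \<Rightarrow> 'b \<Rightarrow> 'b" where
  "s_comp a b = enc_ar (source a, body a \<Zsemi> body b, target b)"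

definition s_tens_ob :: "'p \<Rightarrow> 'p \<Rightarrow> 'p" where "s_tens_ob s t = enc_ob (word s @ word t)"

definition s_tens_ar :: "'b \<Rightarrow> 'b \<Rightarrow> 'b" where
  "s_tens_ar a b = enc_ar (s_tens_ob (source a) (source b),
     inverse_of C (merge (source a) (source b)) \<Zsemi> (body a \<otimes>\<^sub>a body b) \<Zsemi> merge (target a) (target b),
     s_tens_ob (target a) (target b))"

definition s_braid :: "'p \<Rightarrow> 'p \<Rightarrow> 'b" where
  "s_braid s t = enc_ar (s_tens_ob s t,
     inverse_of C (merge s t) \<Zsemi> braid C (word_tens s) (word_tens t) \<Zsemi> merge t s, s_tens_ob t s)"

abbreviation letter :: "'o \<Rightarrow> 'p" where "letter x \<equiv> enc_ob [x]"

text \<open>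
  The tensor product of a one-letter word \<open>[x]\<close> is \<open>x \<otimes> \<one>\<close>, not \<open>x\<close>. The structure on the object \<open>x\<close> is
  therefore carried to the letter along the inverse of the right unitor.
\<close>

definition letter_frame :: "'o \<Rightarrow> 'a" where "letter_frame x = inverse_of C (run C x)"

definition letter_pair_frame :: "'o \<Rightarrow> 'a" where
  "letter_pair_frame x = (letter_frame x \<otimes>\<^sub>a letter_frame x) \<Zsemi> merge (letter x) (letter x)"

definition l_mu :: "'o \<Rightarrow> 'b" where
  "l_mu x = enc_ar (enc_ob [x, x], inverse_of C (letter_pair_frame x) \<Zsemi> mu C x \<Zsemi> letter_frame x, letter x)"

definition l_eta :: "'o \<Rightarrow> 'b" where
  "l_eta x = enc_ar (enc_ob [], eta C x \<Zsemi> letter_frame x, letter x)"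

definition l_delta :: "'o \<Rightarrow> 'b" where
  "l_delta x = enc_ar (letter x, run C x \<Zsemi> delta C x \<Zsemi> letter_pair_frame x, enc_ob [x, x])"

definition l_eps :: "'o \<Rightarrow> 'b" where
  "l_eps x = enc_ar (letter x, run C x \<Zsemi> eps C x, enc_ob [])"

text \<open>
  The middle swap of the strictification, without the associators that are identities there. It is
  written with the raw operations because it takes part in the definition of the hypergraph category.
\<close>

definition s_mid :: "'p \<Rightarrow> 'p \<Rightarrow> 'p \<Rightarrow> 'p \<Rightarrow> 'b" where
  "s_mid s t u v = s_tens_ar (s_idn s) (s_tens_ar (s_braid t u) (s_idn v))"

text \<open>
  The Frobenius structure of a word is forced by the tensor formula, applied to its first letter and the
  remaining word.
\<close>

primrec s_mu :: "'o list \<Rightarrow> 'b" where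
  "s_mu [] = s_idn (enc_ob [])"
| "s_mu (x # xs) = s_comp (s_mid (letter x) (enc_ob xs) (letter x) (enc_ob xs))
     (s_tens_ar (l_mu x) (s_mu xs))"

primrec s_eta :: "'o list \<Rightarrow> 'b" where
  "s_eta [] = s_idn (enc_ob [])"
| "s_eta (x # xs) = s_tens_ar (l_eta x) (s_eta xs)"

primrec s_delta :: "'o list \<Rightarrow> 'b" where
  "s_delta [] = s_idn (enc_ob [])"
| "s_delta (x # xs) = s_comp
     (s_tens_ar (l_delta x) (s_delta xs))
     (s_mid (letter x) (letter x) (enc_ob xs) (enc_ob xs))"

primrec s_eps :: "'o list \<Rightarrow> 'b" where
  "s_eps [] = s_idn (enc_ob [])"
| "s_eps (x # xs) = s_tens_ar (l_eps x) (s_eps xs)"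

definition strictification :: "('p, 'b) hypergraph_data" where
  "strictification =
    \<lparr> Ob = objects,
      Ar = {enc_ar (s, f, t) | s f t. s \<in> objects \<and> t \<in> objects \<and> f \<in> hom_set C (word_tens s) (word_tens t)},
      dm = source, cd = target, idn = s_idn, cmp = s_comp,
      tens_ob = s_tens_ob, tens_ar = s_tens_ar, unit_ob = enc_ob [],
      assr = (\<lambda>s t u. s_idn (s_tens_ob s (s_tens_ob t u))), lun = s_idn, run = s_idn, braid = s_braid,
      mu = (\<lambda>s. s_mu (word s)), eta = (\<lambda>s. s_eta (word s)),
      delta = (\<lambda>s. s_delta (word s)), eps = (\<lambda>s. s_eps (word s)) \<rparr>"

abbreviation "S \<equiv> strictification"

lemma S_simps [simp]:
  "Ob S = objects" "dm S = source" "cd S = target" "idn S = s_idn" "cmp S = s_comp"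
  "tens_ob S = s_tens_ob" "tens_ar S = s_tens_ar" "unit_ob S = enc_ob []"
  "assr S s t u = s_idn (s_tens_ob s (s_tens_ob t u))" "lun S = s_idn" "run S = s_idn"
  "braid S = s_braid" "mu S s = s_mu (word s)" "eta S s = s_eta (word s)"
  "delta S s = s_delta (word s)" "eps S s = s_eps (word s)"
  by (simp_all add: strictification_def)

lemma word_enc [simp]: "xs \<in> lists (Ob C) \<Longrightarrow> word (enc_ob xs) = xs"
  by (simp add: word_def inj_enc_ob)

lemma enc_word [simp]: "s \<in> objects \<Longrightarrow> enc_ob (word s) = s"
  by (simp add: word_def objects_def f_inv_into_f)

lemma word_lists [simp]: "s \<in> objects \<Longrightarrow> word s \<in> lists (Ob C)"
  unfolding word_def objects_def by (rule inv_into_into)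

lemma enc_objects [simp]: "xs \<in> lists (Ob C) \<Longrightarrow> enc_ob xs \<in> objects"
  by (auto simp: objects_def)

lemma word_tens_Ob [simp]: "s \<in> objects \<Longrightarrow> word_tens s \<in> Ob C"
  unfolding word_tens_def by (rule tens_list_Ob[OF word_lists])

lemma triple_enc:
  assumes "s \<in> objects" "t \<in> objects" "f \<in> Ar C"
  shows "source (enc_ar (s, f, t)) = s" "body (enc_ar (s, f, t)) = f" "target (enc_ar (s, f, t)) = t"
  using assms inv_into_f_f[OF inj_enc_ar, of "(s, f, t)"]
  by (simp_all add: source_def body_def target_def triple_def objects_def)

lemma enc_hom:
  assumes "s \<in> objects" "t \<in> objects" "f \<in> Ar C" "dm C f = word_tens s" "cd C f = word_tens t"
  shows "enc_ar (s, f, t) \<in> hom_set S s t" "body (enc_ar (s, f, t)) = f"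
  using assms by (auto simp: hom_set_def triple_enc strictification_def)

lemma hom_S_D:
  assumes "a \<in> hom_set S s t"
  shows "s \<in> objects" "t \<in> objects" "source a = s" "target a = t" "body a \<in> Ar C"
    "dm C (body a) = word_tens s" "cd C (body a) = word_tens t"
  using assms by (auto simp: hom_set_def strictification_def triple_enc)

lemma hom_S_enc: "a \<in> hom_set S s t \<Longrightarrow> enc_ar (s, body a, t) = a"
  by (auto simp: hom_set_def strictification_def triple_enc)

lemma hom_S_objects: "a \<in> Ar S \<Longrightarrow> source a \<in> objects" "a \<in> Ar S \<Longrightarrow> target a \<in> objects"
  by (auto simp: strictification_def triple_enc hom_set_def)

lemma merge_Ar [simp]:
  assumes "s \<in> objects" "t \<in> objects"
  shows "s_tens_ob s t \<in> objects" "is_iso C (merge s t)" "merge s t \<in> Ar C"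
    "dm C (merge s t) = word_tens s \<otimes> word_tens t" "cd C (merge s t) = word_tens (s_tens_ob s t)"
    "word (s_tens_ob s t) = word s @ word t"
  using word_lists[OF assms(1)] word_lists[OF assms(2)]
  by (simp_all add: merge_def word_tens_def s_tens_ob_def)

lemma s_idn_hom [simp]:
  assumes "s \<in> objects"
  shows "s_idn s \<in> hom_set S s s" "body (s_idn s) = idn C (word_tens s)"
  unfolding s_idn_def using assms by (simp_all add: enc_hom)

lemma s_comp_hom:
  assumes "a \<in> hom_set S s t" "b \<in> hom_set S t u"
  shows "s_comp a b \<in> hom_set S s u" "body (s_comp a b) = body a \<Zsemi> body b"
  unfolding s_comp_def using hom_S_D[OF assms(1)] hom_S_D[OF assms(2)] by (simp_all add: enc_hom)

lemma s_tens_hom: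
  assumes "a \<in> hom_set S s s'" "b \<in> hom_set S t t'"
  shows "s_tens_ar a b \<in> hom_set S (s_tens_ob s t) (s_tens_ob s' t')"
    "body (s_tens_ar a b) = inverse_of C (merge s t) \<Zsemi> (body a \<otimes>\<^sub>a body b) \<Zsemi> merge s' t'"
  unfolding s_tens_ar_def using hom_S_D[OF assms(1)] hom_S_D[OF assms(2)] by (simp_all add: enc_hom)

lemma s_braid_hom:
  assumes "s \<in> objects" "t \<in> objects"
  shows "s_braid s t \<in> hom_set S (s_tens_ob s t) (s_tens_ob t s)"
    "body (s_braid s t) = inverse_of C (merge s t) \<Zsemi> braid C (word_tens s) (word_tens t) \<Zsemi> merge t s"
  unfolding s_braid_def using assms by (simp_all add: enc_hom)

lemma S_arrow_eqI:
  assumes "a \<in> hom_set S s t" "b \<in> hom_set S s t" "body a = body b"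
  shows "a = b"
  by (metis hom_S_enc assms)

lemma category_S: "category S"
proof
  show "dm S a \<in> Ob S" "cd S a \<in> Ob S" if "a \<in> Ar S" for a
    using hom_S_objects[OF that] by simp_all
  show "idn S s \<in> hom_set S s s" if "s \<in> Ob S" for s
    using that by simp
  show "a \<Zsemi>\<^bsub>S\<^esub> b \<in> hom_set S s u" if "a \<in> hom_set S s t" "b \<in> hom_set S t u" for a b s t u
    using s_comp_hom[OF that] by simp
  show "idn S s \<Zsemi>\<^bsub>S\<^esub> a = a" if a: "a \<in> hom_set S s t" for a s t
  proof -
    note s = s_idn_hom[OF hom_S_D(1)[OF a]]
    show ?thesis
      unfolding S_simps
      by (rule S_arrow_eqI[OF s_comp_hom(1)[OF s(1) a] a])
        (use s_comp_hom(2)[OF s(1) a] s hom_S_D[OF a] in simp)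
  qed
  show "a \<Zsemi>\<^bsub>S\<^esub> idn S t = a" if a: "a \<in> hom_set S s t" for a s t
  proof -
    note s = s_idn_hom[OF hom_S_D(2)[OF a]]
    show ?thesis
      unfolding S_simps
      by (rule S_arrow_eqI[OF s_comp_hom(1)[OF a s(1)] a])
        (use s_comp_hom(2)[OF a s(1)] s hom_S_D[OF a] in simp)
  qed
  show "(a \<Zsemi>\<^bsub>S\<^esub> b) \<Zsemi>\<^bsub>S\<^esub> c = a \<Zsemi>\<^bsub>S\<^esub> (b \<Zsemi>\<^bsub>S\<^esub> c)"
    if a: "a \<in> hom_set S s t" and b: "b \<in> hom_set S t u" and c: "c \<in> hom_set S u v" for a b c s t u v
  proof -
    note ab = s_comp_hom[OF a b] and bc = s_comp_hom[OF b c]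
    note l = s_comp_hom[OF ab(1) c] and r = s_comp_hom[OF a bc(1)]
    show ?thesis
      unfolding S_simps
      by (rule S_arrow_eqI[OF l(1) r(1)])
        (simp add: ab l bc r hom_S_D[OF a] hom_S_D[OF b] hom_S_D[OF c])
  qed
qed

lemma monoidal_comparison_S: "monoidal_comparison S C word_tens body merge (idn C \<one>)"
proof (intro monoidal_comparison.intro monoidal_comparison_axioms.intro cat_functor.intro
    cat_functor_axioms.intro category_S)
  show "symmetric_monoidal_category C" "category C" by unfold_locales
  show "body a \<in> hom_set C (word_tens s) (word_tens t)" if "a \<in> hom_set S s t" for a s t
    using hom_S_D[OF that] by (simp add: hom_set_def)
  show "body (a \<Zsemi>\<^bsub>S\<^esub> b) = body a \<Zsemi> body b" if "a \<in> hom_set S s t" "b \<in> hom_set S t u" for a b s t u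
    using s_comp_hom[OF that] by simp
  show "fully_faithful S C word_tens body"
    unfolding fully_faithful_def
  proof (intro ballI)
    fix s t assume st: "s \<in> Ob S" "t \<in> Ob S"
    show "bij_betw body (hom_set S s t) (hom_set C (word_tens s) (word_tens t))"
    proof (rule bij_betw_byWitness[of _ "\<lambda>f. enc_ar (s, f, t)"])
      show "\<forall>a\<in>hom_set S s t. enc_ar (s, body a, t) = a" using hom_S_enc by blast
      show "\<forall>f\<in>hom_set C (word_tens s) (word_tens t). body (enc_ar (s, f, t)) = f"
        "(\<lambda>f. enc_ar (s, f, t)) ` hom_set C (word_tens s) (word_tens t) \<subseteq> hom_set S s t"
        using st enc_hom by (auto simp: hom_set_def[of C])
      show "body ` hom_set S s t \<subseteq> hom_set C (word_tens s) (word_tens t)"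
        using hom_S_D by (fastforce simp: hom_set_def[of C])
    qed
  qed
  show "a \<otimes>\<^sub>a\<^bsub>S\<^esub> b \<in> hom_set S (s \<otimes>\<^bsub>S\<^esub> t) (s' \<otimes>\<^bsub>S\<^esub> t')"
    "(body a \<otimes>\<^sub>a body b) \<Zsemi> merge s' t' = merge s t \<Zsemi> body (a \<otimes>\<^sub>a\<^bsub>S\<^esub> b)"
    if "a \<in> hom_set S s s'" "b \<in> hom_set S t t'" for a b s s' t t'
    using s_tens_hom[OF that] hom_S_D[OF that(1)] hom_S_D[OF that(2)] by simp_all
  show "idn C \<one> \<in> hom_set C \<one> (word_tens \<one>\<^bsub>S\<^esub>)" "is_iso C (idn C \<one>)"
    by (simp_all add: word_tens_def hom_set_def)
  fix s assume s: "s \<in> Ob S"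
  then have [simp]: "s \<in> objects" by simp
  have e: "merge (enc_ob []) s = lun C (word_tens s)" "merge s (enc_ob []) = run C (word_tens s)"
    by (simp_all add: merge_def word_tens_def join_Nil)
  have te: "s_tens_ob (enc_ob []) s = s" "s_tens_ob s (enc_ob []) = s" by (simp_all add: s_tens_ob_def)
  show "lun S s \<in> hom_set S (\<one>\<^bsub>S\<^esub> \<otimes>\<^bsub>S\<^esub> s) s" "run S s \<in> hom_set S (s \<otimes>\<^bsub>S\<^esub> \<one>\<^bsub>S\<^esub>) s"
    by (simp_all add: te)
  show "(idn C \<one> \<otimes>\<^sub>a idn C (word_tens s)) \<Zsemi> merge \<one>\<^bsub>S\<^esub> s \<Zsemi> body (lun S s) = lun C (word_tens s)"
    "(idn C (word_tens s) \<otimes>\<^sub>a idn C \<one>) \<Zsemi> merge s \<one>\<^bsub>S\<^esub> \<Zsemi> body (run S s) = run C (word_tens s)"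
    by (simp_all add: e)
  fix t assume t: "t \<in> Ob S"
  then have [simp]: "t \<in> objects" by simp
  show "merge s t \<Zsemi> body (braid S s t) = braid C (word_tens s) (word_tens t) \<Zsemi> merge t s"
    by (simp add: s_braid_hom)
  fix u assume u: "u \<in> Ob S"
  then have [simp]: "u \<in> objects" by simp
  have tt: "s_tens_ob (s_tens_ob s t) u = s_tens_ob s (s_tens_ob t u)"
    by (simp add: s_tens_ob_def)
  show "assr S s t u \<in> hom_set S (s \<otimes>\<^bsub>S\<^esub> t \<otimes>\<^bsub>S\<^esub> u) (s \<otimes>\<^bsub>S\<^esub> (t \<otimes>\<^bsub>S\<^esub> u))"
    by (simp add: tt)
  show "(merge s t \<otimes>\<^sub>a idn C (word_tens u)) \<Zsemi> merge (s \<otimes>\<^bsub>S\<^esub> t) u \<Zsemi> body (assr S s t u)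
      = assr C (word_tens s) (word_tens t) (word_tens u) \<Zsemi> (idn C (word_tens s) \<otimes>\<^sub>a merge t u) \<Zsemi> merge s (t \<otimes>\<^bsub>S\<^esub> u)"
    using join_assoc[of "word s" "word t" "word u"] merge_Ar(3-5)[of "s_tens_ob s t" u]
    by (simp add: tt) (simp add: merge_def word_tens_def)
qed (simp_all add: s_braid_hom hom_set_def[of C])

lemma strict_S: "strict_monoidal S"
proof -
  have "s_tens_ob (s_tens_ob s t) u = s_tens_ob s (s_tens_ob t u)"
    if "s \<in> objects" "t \<in> objects" "u \<in> objects" for s t u
    using that by (simp add: s_tens_ob_def)
  then show ?thesis by (simp add: strict_monoidal_def) (simp add: s_tens_ob_def)
qed

sublocale S: monoidal_comparison S C word_tens body merge "idn C \<one>"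
  by (rule monoidal_comparison_S)

sublocale S: strict_symmetric_monoidal_category S
  by (intro strict_symmetric_monoidal_category.intro strict_symmetric_monoidal_category_axioms.intro
      S.symmetric_monoidal strict_S)

section \<open>
From here on the operations of \<open>S\<close> stay folded, so that the rules for strict symmetric monoidal
categories apply to them.
\<close>

declare S_simps(2-) [simp del]
declare s_mu.simps [simp del] s_eta.simps [simp del] s_delta.simps [simp del] s_eps.simps [simp del]

lemma objects_tens [simp]:
  "\<one>\<^bsub>S\<^esub> \<in> objects" "\<lbrakk>s \<in> objects; t \<in> objects\<rbrakk> \<Longrightarrow> s \<otimes>\<^bsub>S\<^esub> t \<in> objects"
  by (simp_all add: S_simps)

lemma enc_Nil: "enc_ob [] = \<one>\<^bsub>S\<^esub>"
  by (simp add: S_simps)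

lemma word_Nil:
  "s_mu [] = idn S \<one>\<^bsub>S\<^esub>" "s_eta [] = idn S \<one>\<^bsub>S\<^esub>" "s_delta [] = idn S \<one>\<^bsub>S\<^esub>" "s_eps [] = idn S \<one>\<^bsub>S\<^esub>"
  by (simp_all add: S_simps s_mu.simps s_eta.simps s_delta.simps s_eps.simps)

abbreviation idf :: "'p \<Rightarrow> 'a" where "idf s \<equiv> idn C (word_tens s)"

lemma frame_letter: "x \<in> Ob C \<Longrightarrow> S.frame x (letter x) (letter_frame x)"
  by (simp add: S.frame_def letter_frame_def word_tens_def)

lemma letter_pair_frame_eq:
  "letter_pair_frame x = S.tens_frame (letter x) (letter_frame x) (letter x) (letter_frame x)"
  by (simp add: letter_pair_frame_def S.tens_frame_def)

lemma letter_pair: "x \<in> Ob C \<Longrightarrow> s_tens_ob (letter x) (letter x) = enc_ob [x, x]"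
  by (simp add: s_tens_ob_def)

lemma s_tens_ob_enc:
  "\<lbrakk>xs \<in> lists (Ob C); ys \<in> lists (Ob C)\<rbrakk> \<Longrightarrow> s_tens_ob (enc_ob xs) (enc_ob ys) = enc_ob (xs @ ys)"
  by (simp add: s_tens_ob_def)

lemma over_enc:
  assumes "S.frame X s i" "S.frame Y t j" "g \<in> Ar C" "dm C g = X" "cd C g = Y"
  shows "S.over s t i j g (enc_ar (s, inverse_of C i \<Zsemi> g \<Zsemi> j, t))"
proof -
  note [simp] = S.frameD[OF assms(1)] S.frameD[OF assms(2)] assms(3-5)
  have "s \<in> objects" "t \<in> objects" using S.frameD(1)[OF assms(1)] S.frameD(1)[OF assms(2)] by simp_all
  then have "enc_ar (s, inverse_of C i \<Zsemi> g \<Zsemi> j, t) \<in> hom_set S s t"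
    "body (enc_ar (s, inverse_of C i \<Zsemi> g \<Zsemi> j, t)) = inverse_of C i \<Zsemi> g \<Zsemi> j"
    by (simp_all add: enc_hom)
  then show ?thesis
    using hom_setD[of _ S s t] by (intro S.overI[OF assms(1,2)]) simp_all
qed

lemma frame_pair: "x \<in> Ob C \<Longrightarrow> S.frame (x \<otimes> x) (enc_ob [x, x]) (letter_pair_frame x)"
  using S.frame_tens[OF frame_letter frame_letter, of x x] by (simp add: S_simps letter_pair letter_pair_frame_eq)

lemma frobenius_over_letter:
  assumes x: "x \<in> Ob C"
  shows "S.frobenius_over x (letter x) (letter_frame x) (mu C x) (eta C x) (delta C x) (eps C x)
    (l_mu x) (l_eta x) (l_delta x) (l_eps x)"
  unfolding l_mu_def l_eta_def l_delta_def l_eps_def S.frobenius_over_def S_simps letter_pair[OF x] letter_pair_frame_eq[symmetric]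
proof (intro conjI)
  note [simp] = x
  note l = frame_letter[OF x] and p = frame_pair[OF x]
  have u: "S.frame \<one> (enc_ob []) (idn C \<one>)" using S.frame_unit by (simp add: S_simps)
  show "S.frame x (letter x) (letter_frame x)" by (rule l)
  show "S.over (enc_ob [x, x]) (letter x) (letter_pair_frame x) (letter_frame x) (mu C x)
    (enc_ar (enc_ob [x, x], inverse_of C (letter_pair_frame x) \<Zsemi> mu C x \<Zsemi> letter_frame x, letter x))"
    by (rule over_enc[OF p l]) simp_all
  show "S.over (enc_ob []) (letter x) (idn C \<one>) (letter_frame x) (eta C x)
    (enc_ar (enc_ob [], eta C x \<Zsemi> letter_frame x, letter x))"
    using over_enc[OF u l, of "eta C x"] by simp
  show "S.over (letter x) (enc_ob [x, x]) (letter_frame x) (letter_pair_frame x) (delta C x)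
    (enc_ar (letter x, run C x \<Zsemi> delta C x \<Zsemi> letter_pair_frame x, enc_ob [x, x]))"
    using over_enc[OF l p, of "delta C x"] by (simp add: letter_frame_def)
  show "S.over (letter x) (enc_ob []) (letter_frame x) (idn C \<one>) (eps C x)
    (enc_ar (letter x, run C x \<Zsemi> eps C x, enc_ob []))"
    using over_enc[OF l u, of "eps C x"] by (simp add: letter_frame_def)
qed

lemma s_mid_eq:
  "\<lbrakk>s \<in> objects; t \<in> objects; u \<in> objects; v \<in> objects\<rbrakk> \<Longrightarrow> s_mid s t u v = mid_swap S s t u v"
  by (simp add: S.mid_swap_strict) (simp add: S_simps s_mid_def)

lemma s_mu_Cons:
  assumes "x \<in> Ob C" "xs \<in> lists (Ob C)"
  shows "s_mu (x # xs) = mid_swap S (letter x) (enc_ob xs) (letter x) (enc_ob xs) \<Zsemi>\<^bsub>S\<^esub>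
    (l_mu x \<otimes>\<^sub>a\<^bsub>S\<^esub> s_mu xs)"
  using assms by (simp add: S_simps s_mid_eq s_mu.simps)

lemma s_delta_Cons:
  assumes "x \<in> Ob C" "xs \<in> lists (Ob C)"
  shows "s_delta (x # xs) = (l_delta x \<otimes>\<^sub>a\<^bsub>S\<^esub> s_delta xs) \<Zsemi>\<^bsub>S\<^esub>
    mid_swap S (letter x) (letter x) (enc_ob xs) (enc_ob xs)"
  using assms by (simp add: S_simps s_mid_eq s_delta.simps)

lemma s_eta_Cons:
  assumes "x \<in> Ob C" "S.over \<one>\<^bsub>S\<^esub> t m0 j g (s_eta xs)"
  shows "s_eta (x # xs) = inverse_of S (lun S \<one>\<^bsub>S\<^esub>) \<Zsemi>\<^bsub>S\<^esub> (l_eta x \<otimes>\<^sub>a\<^bsub>S\<^esub> s_eta xs)"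
proof -
  note L = S.overD[OF S.frobenius_overD(3)[OF frobenius_over_letter[OF assms(1)]]]
    and W = S.overD[OF assms(2)]
  have "s_eta (x # xs) = l_eta x \<otimes>\<^sub>a\<^bsub>S\<^esub> s_eta xs" by (simp add: S_simps s_eta.simps)
  then show ?thesis using L W S.D_unit_Ob by simp
qed

lemma s_eps_Cons:
  assumes "x \<in> Ob C" "S.over t \<one>\<^bsub>S\<^esub> i m0 g (s_eps xs)"
  shows "s_eps (x # xs) = (l_eps x \<otimes>\<^sub>a\<^bsub>S\<^esub> s_eps xs) \<Zsemi>\<^bsub>S\<^esub> lun S \<one>\<^bsub>S\<^esub>"
proof -
  note L = S.overD[OF S.frobenius_overD(5)[OF frobenius_over_letter[OF assms(1)]]]
    and W = S.overD[OF assms(2)]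
  have "s_eps (x # xs) = l_eps x \<otimes>\<^sub>a\<^bsub>S\<^esub> s_eps xs" by (simp add: S_simps s_eps.simps)
  then show ?thesis using L W S.D_unit_Ob by simp
qed

text \<open>
  With the identity as unit of the monoid \<open>\<one>\<close>, the unit law leaves only one possible multiplication.
\<close>

lemma mu_unit: "mu C \<one> = lun C \<one>" and delta_unit: "delta C \<one> = inverse_of C (lun C \<one>)"
proof -
  have F: "frobenius_structure C \<one> (mu C \<one>) (idn C \<one>) (delta C \<one>) (idn C \<one>)"
    using frobenius[of \<one>] by (simp add: eta_unit eps_unit)
  then have "(idn C \<one> \<otimes>\<^sub>a idn C \<one>) \<Zsemi> mu C \<one> = lun C \<one>"
    and "delta C \<one> \<Zsemi> (idn C \<one> \<otimes>\<^sub>a idn C \<one>) \<Zsemi> lun C \<one> = idn C \<one>"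
    unfolding frobenius_structure_def commutative_monoid_def cocommutative_comonoid_def by blast+
  then have "mu C \<one> = lun C \<one>" and d: "delta C \<one> \<Zsemi> lun C \<one> = idn C \<one>" by simp_all
  then show "mu C \<one> = lun C \<one>" by simp
  show "delta C \<one> = inverse_of C (lun C \<one>)"
    by (rule iso_cancel_right[of _ "lun C \<one>"]) (use d in simp_all)
qed

text \<open>
  The right unitor in the letter frame cancels against the unit introduced by \<open>join [x] xs\<close>, by the
  triangle. Hence letters framed by \<open>letter_frame\<close> assemble to words framed by identities.
\<close>

lemma tens_frame_letter:
  assumes "x \<in> Ob C" "xs \<in> lists (Ob C)"
  shows "S.tens_frame (letter x) (letter_frame x) (enc_ob xs) (idf (enc_ob xs)) = idf (enc_ob (x # xs))"
proof -
  have "S.tens_frame (letter x) (letter_frame x) (enc_ob xs) (idf (enc_ob xs))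
      = (letter_frame x \<otimes>\<^sub>a idn C (tens_list xs)) \<Zsemi>
        (assr C x \<one> (tens_list xs) \<Zsemi> (idn C x \<otimes>\<^sub>a lun C (tens_list xs)))"
    using assms by (simp add: S.tens_frame_def merge_def word_tens_def)
  also have "\<dots> = idf (enc_ob (x # xs))"
    using assms by (simp add: triangle interchange letter_frame_def word_tens_def)
  finally show ?thesis .
qed

text \<open>
  By induction on the word: the structure of \<open>x # xs\<close> in the strictification and that of
  \<open>x \<otimes> \<Otimes>xs\<close> in \<open>C\<close> arise from those of \<open>x\<close> and \<open>xs\<close> by the same formula. For the empty word, the
  Frobenius structure of the unit consists of coherence maps (\<open>mu_unit\<close>, \<open>delta_unit\<close>).
\<close>

lemma frobenius_over_word:
  assumes "xs \<in> lists (Ob C)"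
  defines "X \<equiv> tens_list xs"
  shows "S.frobenius_over X (enc_ob xs) (idn C X) (mu C X) (eta C X) (delta C X) (eps C X)
    (s_mu xs) (s_eta xs) (s_delta xs) (s_eps xs)"
  using assms(1) unfolding X_def
proof (induction xs)
  case Nil
  have u: "S.frame \<one> \<one>\<^bsub>S\<^esub> (idn C \<one>)" by (rule S.frame_unit)
  note i = S.over_idn[OF u] and l = S.over_lun[OF u]
  have "S.over \<one>\<^bsub>S\<^esub> (\<one>\<^bsub>S\<^esub> \<otimes>\<^bsub>S\<^esub> \<one>\<^bsub>S\<^esub>) (idn C \<one>) (S.tens_frame \<one>\<^bsub>S\<^esub> (idn C \<one>) \<one>\<^bsub>S\<^esub> (idn C \<one>))
      (delta C \<one>) (idn S \<one>\<^bsub>S\<^esub>)"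
    using S.over_inverse(2)[OF l] S.dom.iso_idn(2)[OF S.D_unit_Ob] S.strict_ob(5)[OF S.D_unit_Ob]
    by (simp add: delta_unit)
  then show ?case
    using u i l by (simp add: enc_Nil word_Nil S.frobenius_over_def eta_unit eps_unit mu_unit)
next
  case (Cons x xs)
  then have x [simp]: "x \<in> Ob C" and xs [simp]: "xs \<in> lists (Ob C)" by auto
  let ?s = "letter x" and ?t = "enc_ob xs" and ?i = "letter_frame x" and ?X = "tens_list xs"
  have [simp]: "idf ?t = idn C ?X" by (simp add: word_tens_def)
  note L = S.frobenius_overD[OF frobenius_over_letter[OF x]]
    and W = S.frobenius_overD[OF Cons.IH]
  have st: "enc_ob (x # xs) = ?s \<otimes>\<^bsub>S\<^esub> ?t" by (simp add: S_simps s_tens_ob_enc)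
  have fr: "idn C (x \<otimes> ?X) = S.tens_frame ?s ?i ?t (idn C ?X)"
    using tens_frame_letter[OF x xs] by (simp add: word_tens_def)
  let ?F = "S.tens_frame ?s ?i ?t (idn C ?X)"
  show ?case
    unfolding S.frobenius_over_def tens_list.simps st fr mu_tensor[OF x tens_list_Ob[OF xs]]
      eta_tensor[OF x tens_list_Ob[OF xs]] delta_tensor[OF x tens_list_Ob[OF xs]]
      eps_tensor[OF x tens_list_Ob[OF xs]]
  proof (intro conjI)
    show "S.frame (x \<otimes> ?X) (?s \<otimes>\<^bsub>S\<^esub> ?t) (S.tens_frame ?s ?i ?t (idn C ?X))"
      by (rule S.frame_tens[OF L(1) W(1)])
    show "S.over (?s \<otimes>\<^bsub>S\<^esub> ?t \<otimes>\<^bsub>S\<^esub> (?s \<otimes>\<^bsub>S\<^esub> ?t)) (?s \<otimes>\<^bsub>S\<^esub> ?t)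
        (S.tens_frame (?s \<otimes>\<^bsub>S\<^esub> ?t) ?F (?s \<otimes>\<^bsub>S\<^esub> ?t) ?F) ?F
        (mid_swap C x ?X x ?X \<Zsemi> (mu C x \<otimes>\<^sub>a mu C ?X)) (s_mu (x # xs))"
      unfolding s_mu_Cons[OF x xs]
      by (rule S.over_comp S.over_mid_swap S.over_tens L W)+
    show "S.over \<one>\<^bsub>S\<^esub> (?s \<otimes>\<^bsub>S\<^esub> ?t) (idn C \<one>) ?F
        (inverse_of C (lun C \<one>) \<Zsemi> (eta C x \<otimes>\<^sub>a eta C ?X)) (s_eta (x # xs))"
      unfolding s_eta_Cons[OF x W(3)]
      by (rule S.over_comp S.over_inverse(2)[OF S.over_lun] S.frame_unit S.over_tens L W lun_iso unit_Ob)+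
    show "S.over (?s \<otimes>\<^bsub>S\<^esub> ?t) (?s \<otimes>\<^bsub>S\<^esub> ?t \<otimes>\<^bsub>S\<^esub> (?s \<otimes>\<^bsub>S\<^esub> ?t)) ?F
        (S.tens_frame (?s \<otimes>\<^bsub>S\<^esub> ?t) ?F (?s \<otimes>\<^bsub>S\<^esub> ?t) ?F)
        ((delta C x \<otimes>\<^sub>a delta C ?X) \<Zsemi> mid_swap C x x ?X ?X) (s_delta (x # xs))"
      unfolding s_delta_Cons[OF x xs]
      by (rule S.over_comp S.over_mid_swap S.over_tens L W)+
    show "S.over (?s \<otimes>\<^bsub>S\<^esub> ?t) \<one>\<^bsub>S\<^esub> ?F (idn C \<one>)
        ((eps C x \<otimes>\<^sub>a eps C ?X) \<Zsemi> lun C \<one>) (s_eps (x # xs))"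
      unfolding s_eps_Cons[OF x W(5)]
      by (rule S.over_comp S.over_lun S.frame_unit S.over_tens L W)+
  qed
qed

lemmas word_Ar [simp] = S.frobenius_over_Ar[OF frobenius_over_word]
lemmas letter_Ar [simp] = S.frobenius_over_Ar[OF frobenius_over_letter]

lemma enc_append:
  "\<lbrakk>xs \<in> lists (Ob C); ys \<in> lists (Ob C)\<rbrakk> \<Longrightarrow> enc_ob (xs @ ys) = enc_ob xs \<otimes>\<^bsub>S\<^esub> enc_ob ys"
  by (simp add: S_simps s_tens_ob_enc)

text \<open>
  By induction on the first word; the step moves the middle swap of the induction hypothesis past the
  first letter, which is \<open>mid_swap_assoc\<close>.
\<close>

lemma s_mu_append:
  assumes "xs \<in> lists (Ob C)" and ys [simp]: "ys \<in> lists (Ob C)"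
  defines "s \<equiv> enc_ob xs" and "t \<equiv> enc_ob ys"
  shows "s_mu (xs @ ys) = mid_swap S s t s t \<Zsemi>\<^bsub>S\<^esub> (s_mu xs \<otimes>\<^sub>a\<^bsub>S\<^esub> s_mu ys)"
  using assms(1) unfolding s_def t_def
proof (induction xs)
  case Nil
  then show ?case
    using word_Ar(1-3)[OF ys] by (simp add: word_Nil enc_Nil S.mid_swap_strict S.braid_unit)
next
  case (Cons x xs)
  then have x [simp]: "x \<in> Ob C" and xs [simp]: "xs \<in> lists (Ob C)" by auto
  let ?x = "letter x" and ?s = "enc_ob xs" and ?t = "enc_ob ys"
  have o: "?x \<in> Ob S" "?s \<in> Ob S" "?t \<in> Ob S" by simp_all
  have "s_mu (x # xs @ ys) = mid_swap S ?x (?s \<otimes>\<^bsub>S\<^esub> ?t) ?x (?s \<otimes>\<^bsub>S\<^esub> ?t) \<Zsemi>\<^bsub>S\<^esub>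
      (l_mu x \<otimes>\<^sub>a\<^bsub>S\<^esub> (mid_swap S ?s ?t ?s ?t \<Zsemi>\<^bsub>S\<^esub> (s_mu xs \<otimes>\<^sub>a\<^bsub>S\<^esub> s_mu ys)))"
    using s_mu_Cons[of x "xs @ ys"] Cons.IH by (simp add: enc_append)
  also have "\<dots> = (mid_swap S ?x (?s \<otimes>\<^bsub>S\<^esub> ?t) ?x (?s \<otimes>\<^bsub>S\<^esub> ?t) \<Zsemi>\<^bsub>S\<^esub>
      (idn S (?x \<otimes>\<^bsub>S\<^esub> ?x) \<otimes>\<^sub>a\<^bsub>S\<^esub> mid_swap S ?s ?t ?s ?t)) \<Zsemi>\<^bsub>S\<^esub> (l_mu x \<otimes>\<^sub>a\<^bsub>S\<^esub> (s_mu xs \<otimes>\<^sub>a\<^bsub>S\<^esub> s_mu ys))"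
    by (simp add: S.mid_swap_iso S.interchange)
  also have "\<dots> = (mid_swap S (?x \<otimes>\<^bsub>S\<^esub> ?s) ?t (?x \<otimes>\<^bsub>S\<^esub> ?s) ?t \<Zsemi>\<^bsub>S\<^esub>
      (mid_swap S ?x ?s ?x ?s \<otimes>\<^sub>a\<^bsub>S\<^esub> idn S (?t \<otimes>\<^bsub>S\<^esub> ?t))) \<Zsemi>\<^bsub>S\<^esub> ((l_mu x \<otimes>\<^sub>a\<^bsub>S\<^esub> s_mu xs) \<otimes>\<^sub>a\<^bsub>S\<^esub> s_mu ys)"
    by (subst S.mid_swap_assoc) (simp_all)
  also have "\<dots> = mid_swap S (?x \<otimes>\<^bsub>S\<^esub> ?s) ?t (?x \<otimes>\<^bsub>S\<^esub> ?s) ?t \<Zsemi>\<^bsub>S\<^esub> (s_mu (x # xs) \<otimes>\<^sub>a\<^bsub>S\<^esub> s_mu ys)"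
    by (simp add: S.mid_swap_iso S.interchange s_mu_Cons del: S.strict_ar(1))
  finally show ?case using enc_append[of "[x]" xs] by simp
qed

lemma s_delta_append:
  assumes "xs \<in> lists (Ob C)" and ys [simp]: "ys \<in> lists (Ob C)"
  defines "s \<equiv> enc_ob xs" and "t \<equiv> enc_ob ys"
  shows "s_delta (xs @ ys) = (s_delta xs \<otimes>\<^sub>a\<^bsub>S\<^esub> s_delta ys) \<Zsemi>\<^bsub>S\<^esub> mid_swap S s s t t"
  using assms(1) unfolding s_def t_def
proof (induction xs)
  case Nil
  then show ?case
    using word_Ar(7-9)[OF ys] by (simp add: word_Nil enc_Nil S.mid_swap_strict S.braid_unit)
next
  case (Cons x xs)
  then have x [simp]: "x \<in> Ob C" and xs [simp]: "xs \<in> lists (Ob C)" by auto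
  let ?x = "letter x" and ?s = "enc_ob xs" and ?t = "enc_ob ys"
  have "s_delta (x # xs @ ys) = (l_delta x \<otimes>\<^sub>a\<^bsub>S\<^esub> ((s_delta xs \<otimes>\<^sub>a\<^bsub>S\<^esub> s_delta ys) \<Zsemi>\<^bsub>S\<^esub> mid_swap S ?s ?s ?t ?t))
      \<Zsemi>\<^bsub>S\<^esub> mid_swap S ?x ?x (?s \<otimes>\<^bsub>S\<^esub> ?t) (?s \<otimes>\<^bsub>S\<^esub> ?t)"
    using s_delta_Cons[of x "xs @ ys"] Cons.IH by (simp add: enc_append)
  also have "\<dots> = (l_delta x \<otimes>\<^sub>a\<^bsub>S\<^esub> (s_delta xs \<otimes>\<^sub>a\<^bsub>S\<^esub> s_delta ys)) \<Zsemi>\<^bsub>S\<^esub>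
      ((idn S (?x \<otimes>\<^bsub>S\<^esub> ?x) \<otimes>\<^sub>a\<^bsub>S\<^esub> mid_swap S ?s ?s ?t ?t) \<Zsemi>\<^bsub>S\<^esub> mid_swap S ?x ?x (?s \<otimes>\<^bsub>S\<^esub> ?t) (?s \<otimes>\<^bsub>S\<^esub> ?t))"
    by (simp add: S.mid_swap_iso S.interchange_extend)
  also have "\<dots> = ((l_delta x \<otimes>\<^sub>a\<^bsub>S\<^esub> s_delta xs) \<otimes>\<^sub>a\<^bsub>S\<^esub> s_delta ys) \<Zsemi>\<^bsub>S\<^esub>
      ((mid_swap S ?x ?x ?s ?s \<otimes>\<^sub>a\<^bsub>S\<^esub> idn S (?t \<otimes>\<^bsub>S\<^esub> ?t)) \<Zsemi>\<^bsub>S\<^esub> mid_swap S (?x \<otimes>\<^bsub>S\<^esub> ?s) (?x \<otimes>\<^bsub>S\<^esub> ?s) ?t ?t)"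
    by (subst S.mid_swap_coassoc) (simp_all)
  also have "\<dots> = (s_delta (x # xs) \<otimes>\<^sub>a\<^bsub>S\<^esub> s_delta ys) \<Zsemi>\<^bsub>S\<^esub> mid_swap S (?x \<otimes>\<^bsub>S\<^esub> ?s) (?x \<otimes>\<^bsub>S\<^esub> ?s) ?t ?t"
    by (simp add: S.mid_swap_iso S.interchange_extend s_delta_Cons del: S.strict_ar(1))
  finally show ?case using enc_append[of "[x]" xs] by simp
qed

lemma s_eta_append:
  "\<lbrakk>xs \<in> lists (Ob C); ys \<in> lists (Ob C)\<rbrakk> \<Longrightarrow> s_eta (xs @ ys) = s_eta xs \<otimes>\<^sub>a\<^bsub>S\<^esub> s_eta ys"
  and s_eps_append:
  "\<lbrakk>xs \<in> lists (Ob C); ys \<in> lists (Ob C)\<rbrakk> \<Longrightarrow> s_eps (xs @ ys) = s_eps xs \<otimes>\<^sub>a\<^bsub>S\<^esub> s_eps ys"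
proof -
  have eta: "s_eta (x # zs) = l_eta x \<otimes>\<^sub>a\<^bsub>S\<^esub> s_eta zs" and eps: "s_eps (x # zs) = l_eps x \<otimes>\<^sub>a\<^bsub>S\<^esub> s_eps zs" for x zs
    by (simp_all add: S_simps s_eta.simps s_eps.simps)
  assume ys: "ys \<in> lists (Ob C)" and xs: "xs \<in> lists (Ob C)"
  show "s_eta (xs @ ys) = s_eta xs \<otimes>\<^sub>a\<^bsub>S\<^esub> s_eta ys"
    using xs by (induction xs) (use word_Ar(4)[OF ys] in \<open>auto simp: word_Nil eta\<close>)
  show "s_eps (xs @ ys) = s_eps xs \<otimes>\<^sub>a\<^bsub>S\<^esub> s_eps ys"
    using xs by (induction xs) (use word_Ar(10)[OF ys] in \<open>auto simp: word_Nil eps\<close>)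
qed

lemma frobenius_over_S:
  assumes "s \<in> objects"
  shows "S.frobenius_over (word_tens s) s (idf s) (mu C (word_tens s)) (eta C (word_tens s))
    (delta C (word_tens s)) (eps C (word_tens s)) (mu S s) (eta S s) (delta S s) (eps S s)"
  using frobenius_over_word[OF word_lists[OF assms]] assms by (simp add: word_tens_def S_simps(13-))

theorem hypergraph_category_S: "hypergraph_category S"
proof (intro hypergraph_category.intro hypergraph_category_axioms.intro S.symmetric_monoidal)
  fix s assume "s \<in> Ob S"
  then have s [simp]: "s \<in> objects" by simp
  show "frobenius_structure S s (mu S s) (eta S s) (delta S s) (eps S s)"
    by (rule S.frobenius_reflect[OF frobenius_over_S[OF s] frobenius]) simp
  fix t assume "t \<in> Ob S"
  then have t [simp]: "t \<in> objects" by simp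
  have w: "word (s \<otimes>\<^bsub>S\<^esub> t) = word s @ word t" by (simp add: S_simps)
  have st: "word s \<in> lists (Ob C)" "word t \<in> lists (Ob C)" by simp_all
  show "mu S (s \<otimes>\<^bsub>S\<^esub> t) = mid_swap S s t s t \<Zsemi>\<^bsub>S\<^esub> (mu S s \<otimes>\<^sub>a\<^bsub>S\<^esub> mu S t)"
    using s_mu_append[OF st] by (simp add: S_simps(13) w)
  show "delta S (s \<otimes>\<^bsub>S\<^esub> t) = (delta S s \<otimes>\<^sub>a\<^bsub>S\<^esub> delta S t) \<Zsemi>\<^bsub>S\<^esub> mid_swap S s s t t"
    using s_delta_append[OF st] by (simp add: S_simps(15) w)
  show "eta S (s \<otimes>\<^bsub>S\<^esub> t) = inverse_of S (lun S \<one>\<^bsub>S\<^esub>) \<Zsemi>\<^bsub>S\<^esub> (eta S s \<otimes>\<^sub>a\<^bsub>S\<^esub> eta S t)"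
    using s_eta_append[OF st] by (simp add: S_simps(14) w)
  show "eps S (s \<otimes>\<^bsub>S\<^esub> t) = (eps S s \<otimes>\<^sub>a\<^bsub>S\<^esub> eps S t) \<Zsemi>\<^bsub>S\<^esub> lun S \<one>\<^bsub>S\<^esub>"
    using s_eps_append[OF st] by (simp add: S_simps(16) w)
next
  have "word \<one>\<^bsub>S\<^esub> = []" by (simp add: S_simps)
  then show "eta S \<one>\<^bsub>S\<^esub> = idn S \<one>\<^bsub>S\<^esub>" "eps S \<one>\<^bsub>S\<^esub> = idn S \<one>\<^bsub>S\<^esub>"
    by (simp_all add: S_simps(14,16) word_Nil)
qed

lemma letter_structure:
  assumes "x \<in> Ob C"
  shows "mu S (letter x) = l_mu x" "eta S (letter x) = l_eta x"
    "delta S (letter x) = l_delta x" "eps S (letter x) = l_eps x"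
proof -
  note [simp] = assms letter_Ar[OF assms]
  have 1: "s_eta [x] = l_eta x \<otimes>\<^sub>a\<^bsub>S\<^esub> idn S \<one>\<^bsub>S\<^esub>" "s_eps [x] = l_eps x \<otimes>\<^sub>a\<^bsub>S\<^esub> idn S \<one>\<^bsub>S\<^esub>"
    by (simp_all add: S_simps s_eta.simps s_eps.simps)
  have w: "word (letter x) = [x]" by simp
  show "mu S (letter x) = l_mu x" "delta S (letter x) = l_delta x"
    using s_mu_Cons[of x "[]"] s_delta_Cons[of x "[]"]
    by (simp_all add: S_simps(13,15) w word_Nil enc_Nil S.mid_swap_strict S.braid_unit)
  show "eta S (letter x) = l_eta x" "eps S (letter x) = l_eps x"
    by (simp_all add: S_simps(14,16) w 1)
qed

text \<open>
  Every object \<open>x\<close> of \<open>C\<close> is isomorphic to the tensor product of the letter \<open>[x]\<close>, compatibly with the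
  Frobenius structures because the structure of a letter was defined by this isomorphism.
\<close>

theorem hypergraph_comparison_S:
  "hypergraph_comparison S C word_tens body merge (idn C \<one>) letter letter_frame"
proof (intro hypergraph_comparison.intro hypergraph_comparison_axioms.intro monoidal_comparison_S
    hypergraph_category_S)
  show "hypergraph_category C" by unfold_locales
qed (use frobenius_over_S frobenius_over_letter letter_structure in simp_all)

end

theorem (in free_strictification) bij_betw_enc_ob: "bij_betw enc_ob (lists (Ob C)) (Ob S)"
  using inj_enc_ob by (simp add: bij_betw_def objects_def)

section \<open>Encoding words and arrows\<close>

lemma inj_pair:
  assumes "infinite (UNIV :: 'a set)"
  obtains p :: "'a \<times> 'a \<Rightarrow> 'a" where "inj p"
proof -
  obtain p :: "'a \<times> 'a \<Rightarrow> 'a" where "bij_betw p (UNIV \<times> UNIV) UNIV"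
    using card_of_ordIso[THEN iffD2, OF card_of_Times_same_infinite[OF assms]] by blast
  then show ?thesis using that by (auto simp: bij_betw_def)
qed

text \<open>
  A word is encoded by folding a pairing function over it. The folding is injective on words of the same
  length; the length is recorded separately.
\<close>

lemma inj_list:
  assumes "infinite (UNIV :: 'a set)"
  obtains l :: "'a list \<Rightarrow> 'a" where "inj l"
proof -
  obtain p :: "'a \<times> 'a \<Rightarrow> 'a" where p: "inj p" by (rule inj_pair[OF assms])
  obtain c :: "nat \<Rightarrow> 'a" where c: "inj c" using infinite_countable_subset[OF assms] by blast
  \<comment> \<open>The start value \<open>c 0\<close> is arbitrary.\<close>
  define f where "f xs = foldr (\<lambda>x y. p (x, y)) xs (c 0)" for xs
  have f: "f xs = f ys \<Longrightarrow> xs = ys" if "length xs = length ys" for xs ys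
    using that
  proof (induction rule: list_induct2)
    case (Cons x xs y ys)
    then show ?case using injD[OF p, of "(x, f xs)" "(y, f ys)"] by (simp add: f_def)
  qed simp
  have "inj (\<lambda>xs. p (c (length xs), f xs))"
  proof (rule injI)
    fix xs ys assume "p (c (length xs), f xs) = p (c (length ys), f ys)"
    then have "c (length xs) = c (length ys)" "f xs = f ys" using injD[OF p] by blast+
    then show "xs = ys" using f injD[OF c] by blast
  qed
  then show ?thesis using that by blast
qed

lemma (in category) inj_on_idn: "inj_on (idn C) (Ob C)"
  by (metis inj_onI idn_Ar(2))

text \<open>
  The type of arrows may be smaller than the type of objects. But the objects of \<open>H\<close> embed into its
  arrows as identities, so a word of objects is encoded in an arrow triple by its word of identities.
\<close>

lemma free_strictification_exists:
  fixes H :: "('o, 'a) hypergraph_data"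
  assumes "infinite (UNIV :: 'o set)" "infinite (UNIV :: 'a set)" "hypergraph_category H"
  obtains e :: "'o list \<Rightarrow> 'o" and k :: "'o \<times> 'a \<times> 'o \<Rightarrow> 'a" where "free_strictification H e k"
proof -
  interpret H: hypergraph_category H by fact
  obtain e :: "'o list \<Rightarrow> 'o" where e: "inj e" by (rule inj_list[OF assms(1)])
  obtain l :: "'a list \<Rightarrow> 'a" where l: "inj l" by (rule inj_list[OF assms(2)])
  define w where "w s = map (idn H) (inv e s)" for s
  define k where "k = (\<lambda>(s, f, t). l [l (w s), f, l (w t)])"
  have w: "inj_on w (e ` lists (Ob H))"
  proof (rule inj_onI)
    fix s t assume "s \<in> e ` lists (Ob H)" "t \<in> e ` lists (Ob H)" "w s = w t"
    then obtain xs ys where xs: "s = e xs" "xs \<in> lists (Ob H)" and ys: "t = e ys" "ys \<in> lists (Ob H)"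
      by blast
    moreover from this have "map (idn H) xs = map (idn H) ys"
      using \<open>w s = w t\<close> e by (simp add: w_def)
    moreover have "inj_on (idn H) (set xs \<union> set ys)"
      by (rule inj_on_subset[OF H.inj_on_idn]) (use xs ys in auto)
    ultimately show "s = t" by (simp add: inj_on_map_eq_map)
  qed
  have "inj_on k (e ` lists (Ob H) \<times> Ar H \<times> e ` lists (Ob H))"
  proof (rule inj_onI)
    fix a b assume ab: "a \<in> e ` lists (Ob H) \<times> Ar H \<times> e ` lists (Ob H)"
      "b \<in> e ` lists (Ob H) \<times> Ar H \<times> e ` lists (Ob H)" "k a = k b"
    obtain s f t s' f' t' where [simp]: "a = (s, f, t)" "b = (s', f', t')" by (cases a, cases b)
    have "w s = w s'" "f = f'" "w t = w t'" using ab(3) by (simp_all add: k_def inj_eq[OF l])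
    then show "a = b" using ab(1,2) inj_onD[OF w, of s s'] inj_onD[OF w, of t t'] by simp
  qed
  moreover have "inj_on e (lists (Ob H))" using e by (rule inj_on_subset) simp
  ultimately have "free_strictification H e k"
    by (intro free_strictification.intro free_strictification_axioms.intro assms)
  then show ?thesis using that by blast
qed

section \<open>The 2-equivalence\<close>

theorem strictification_equivalent:
  fixes H :: "('o, 'a) hypergraph_data"
  assumes "infinite (UNIV :: 'o set)" "infinite (UNIV :: 'a set)" "hypergraph_category H"
  shows "\<exists>X :: ('o, 'a) of_hypergraph_data. of_hypergraph_category X \<and> equivalent_in Hyp H (of_cat X)"
proof -
  obtain e :: "'o list \<Rightarrow> 'o" and k :: "'o \<times> 'a \<times> 'o \<Rightarrow> 'a" where "free_strictification H e k"
    by (rule free_strictification_exists[OF assms])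
  then interpret free_strictification H e k .
  let ?X = "\<lparr>of_cat = S, of_gen = Ob H, of_iso = e\<rparr>"
  have "of_hypergraph_category ?X"
    by (intro of_hypergraph_category.intro)
      (simp_all add: hypergraph_category_S strict_S bij_betw_enc_ob[simplified] enc_Nil enc_append)
  moreover have "equivalent_in Hyp H S"
    by (rule equivalent_in_Hyp[OF hypergraph_comparison_S])
  ultimately show ?thesis by (intro exI[of _ ?X]) simp
qed

theorem theorem1p1:
  assumes "infinite (UNIV :: 'o set)"
    and "infinite (UNIV :: 'a set)"
  shows "two_equivalence
      (Hyp_OF :: (('o, 'a) of_hypergraph_data, ('o, 'a) hyp_1cell, ('o, 'a) hyp_2cell) two_category_data)
      (Hyp :: (('o, 'a) hypergraph_data, ('o, 'a) hyp_1cell, ('o, 'a) hyp_2cell) two_category_data)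
      forget_OF
    \<and> (\<forall>H :: ('o, 'a) hypergraph_data. hypergraph_category H \<longrightarrow>
        (\<exists>X :: ('o, 'a) of_hypergraph_data. of_hypergraph_category X \<and> equivalent_in Hyp H (of_cat X)))"
proof (intro conjI allI impI)
  show "\<exists>X :: ('o, 'a) of_hypergraph_data. of_hypergraph_category X \<and> equivalent_in Hyp H (of_cat X)"
    if "hypergraph_category H" for H :: "('o, 'a) hypergraph_data"
    by (rule strictification_equivalent[OF assms that])
  then show "two_equivalence
      (Hyp_OF :: (('o, 'a) of_hypergraph_data, ('o, 'a) hyp_1cell, ('o, 'a) hyp_2cell) two_category_data)
      (Hyp :: (('o, 'a) hypergraph_data, ('o, 'a) hyp_1cell, ('o, 'a) hyp_2cell) two_category_data)
      forget_OF"
    by (intro two_equivalence.intro two_equivalence_axioms.intro two_functor_forget_OF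
        fully_faithful_forget_OF) (auto simp: Hyp_OF_def Hyp_def forget_OF_def)
qed

end
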